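(* Let $n\ge2$, $d\ge1$, and let $f$ be a real-valued $\mathcal{C}^d$-smooth function on $\mathbb{R}^n\setminus\{0\}$ which is $p$-homogeneous for some real number $p>d-3$ and which is orthogonal in $L^2(\sigma_{n-1})$ to all polynomials of total degree at most $d-1$. Moreover, assume that $$\lVert f^{(d)}\rVert_{\mathrm{HS},2}\le 1\qquad\text{and}\qquad\lVert f^{(d)}\rVert_{\mathrm{Op},\infty}\le 1.$$ Then, with some universal constant $c>0$, $$\int_{S^{n-1}}\exp\big\{c\,(n-1)\,|f|^{2/d}\big\}\,d\sigma_{n-1}\le 2.$$ A possible choice is $c=1/(8e)$. The same holds for $p\le d-3$, if $n>d-p-1$.
   Context: $S^{n-1}$ is the unit sphere in $\mathbb{R}^n$ and $\sigma_{n-1}$ the uniform probability measure on it. A function $f$ on $\mathbb{R}^n\setminus\{0\}$ is $p$-homogeneous if $f(\lambda x)=\lambda^pf(x)$ for all $x\ne0$, $\lambda>0$. $f^{(d)}(x)$ is the hypermatrix of usual (Euclidean) $d$-th order partial derivatives at $x$, viewed as a symmetric $d$-linear form; $|f^{(d)}(x)|_{\mathrm{HS}}$ is its Euclidean norm in $\mathbb{R}^{n^d}$ and $|f^{(d)}(x)|_{\mathrm{Op}}=\sup\{f^{(d)}(x)[v_1,\dots,v_d]:|v_1|=\dots=|v_d|=1\}$. $\lVert f^{(d)}\rVert_{\mathrm{HS},2}$ is the $L^2(\sigma_{n-1})$-norm of $|f^{(d)}|_{\mathrm{HS}}$ restricted to $S^{n-1}$, and $\lVert f^{(d)}\rVert_{\mathrm{Op},\infty}$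 is the $L^\infty(\sigma_{n-1})$-norm of $|f^{(d)}|_{\mathrm{Op}}$ restricted to $S^{n-1}$. *)

theory Defs
  imports "HOL-Probability.Probability"
begin

section \<open>The uniform distribution on the unit sphere\<close>

text \<open>
  The uniform probability measure on the unit sphere is the law of \<open>X / norm X\<close> for \<open>X\<close> uniformly
  distributed in the unit ball (normalised cone measure). The origin, where \<open>sgn 0 = 0\<close>, is a null
  set of the ball, so restricting to the sphere loses no mass.
\<close>

definition sphere_measure :: "(real ^ 'n) measure" where
  "sphere_measure =
     restrict_space (distr (uniform_measure lborel (cball 0 1)) borel sgn) (sphere 0 1)"

lemma space_sphere_measure [simp]: "space sphere_measure = sphere 0 1"
  by (simp add: sphere_measure_def space_restrict_space)

lemma sets_sphere_measure [measurable_cong]: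
  "sets sphere_measure = sets (restrict_space borel (sphere 0 1))"
  unfolding sphere_measure_def by (rule sets_restrict_space_cong) simp

lemma emeasure_sphere_measure:
  fixes A :: "(real ^ 'n) set"
  assumes [measurable]: "A \<in> sets borel" and A: "A \<subseteq> sphere 0 1"
  shows "emeasure sphere_measure A =
           emeasure lborel (cball 0 1 \<inter> sgn -` A) / emeasure lborel (cball 0 1 :: (real ^ 'n) set)"
proof -
  have m: "sgn -` A \<in> sets borel"
    using measurable_sets[OF borel_measurable_sgn assms(1)] by simp
  have "emeasure sphere_measure A = emeasure (distr (uniform_measure lborel (cball 0 1)) borel sgn) A"
    unfolding sphere_measure_def using A by (intro emeasure_restrict_space) auto
  also have "\<dots> = emeasure (uniform_measure lborel (cball 0 1)) (sgn -` A)"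
    by (subst emeasure_distr) auto
  also have "\<dots> = emeasure lborel (cball 0 1 \<inter> sgn -` A) / emeasure lborel (cball 0 1 :: (real ^ 'n) set)"
    using m by (intro emeasure_uniform_measure) auto
  finally show ?thesis .
qed

lemma prob_space_sphere_measure: "prob_space (sphere_measure :: (real ^ 'n) measure)"
proof
  let ?B = "cball 0 1 :: (real ^ 'n) set"
  have fin: "emeasure lborel ?B \<noteq> \<infinity>"
    using emeasure_bounded_finite[OF bounded_cball, of "0 :: real ^ 'n" 1] by simp
  have "0 < measure lborel ?B"
    by (rule content_cball_pos) simp
  hence pos: "emeasure lborel ?B \<noteq> 0"
    by (auto simp: measure_def)
  have "?B \<inter> sgn -` sphere 0 1 = ?B - {0}"
    by (auto simp: norm_sgn)
  hence "emeasure lborel (?B \<inter> sgn -` sphere 0 1) = emeasure lborel ?B"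
    by (simp add: emeasure_Diff)
  thus "emeasure sphere_measure (space sphere_measure :: (real ^ 'n) set) = 1"
    using pos fin by (simp add: emeasure_sphere_measure ennreal_divide_self less_top)
qed

section \<open>Partial derivatives of order \<open>d\<close>\<close>

definition partial_deriv :: "'n \<Rightarrow> (real ^ 'n \<Rightarrow> real) \<Rightarrow> real ^ 'n \<Rightarrow> real" where
  "partial_deriv i f x = deriv (\<lambda>t. f (x + t *\<^sub>R axis i 1)) 0"

fun iter_partial_deriv :: "'n list \<Rightarrow> (real ^ 'n \<Rightarrow> real) \<Rightarrow> real ^ 'n \<Rightarrow> real" where
  "iter_partial_deriv [] f = f"
| "iter_partial_deriv (i # is) f = partial_deriv i (iter_partial_deriv is f)"

text \<open>
  For open \<open>S\<close>: all partial derivatives of order at most \<open>d\<close> exist and are continuous on \<open>S\<close>.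
\<close>

definition C_smooth_on :: "nat \<Rightarrow> (real ^ 'n) set \<Rightarrow> (real ^ 'n \<Rightarrow> real) \<Rightarrow> bool" where
  "C_smooth_on d S f \<longleftrightarrow>
     (\<forall>is. length is < d \<longrightarrow>
        (\<forall>i. \<forall>x\<in>S. (\<lambda>t. iter_partial_deriv is f (x + t *\<^sub>R axis i 1)) differentiable (at 0))) \<and>
     (\<forall>is. length is \<le> d \<longrightarrow> continuous_on S (iter_partial_deriv is f))"

text \<open>
  The entries of the hypermatrix of \<open>d\<close>-th order partial derivatives are indexed by the lists of
  coordinates of length \<open>d\<close>; a \<open>d\<close>-tuple of vectors is likewise a list of length \<open>d\<close>.
\<close>

definition deriv_form ::
  "nat \<Rightarrow> (real ^ 'n \<Rightarrow> real) \<Rightarrow> real ^ 'n \<Rightarrow> (real ^ 'n) list \<Rightarrow> real" where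
  "deriv_form d f x vs =
     (\<Sum>is | length is = d. iter_partial_deriv is f x * (\<Prod>k<d. (vs ! k) $ (is ! k)))"

definition deriv_HS :: "nat \<Rightarrow> (real ^ 'n \<Rightarrow> real) \<Rightarrow> real ^ 'n \<Rightarrow> real" where
  "deriv_HS d f x = sqrt (\<Sum>is | length is = d. (iter_partial_deriv is f x)\<^sup>2)"

definition deriv_Op :: "nat \<Rightarrow> (real ^ 'n \<Rightarrow> real) \<Rightarrow> real ^ 'n \<Rightarrow> real" where
  "deriv_Op d f x =
     (SUP vs \<in> {vs. length vs = d \<and> (\<forall>v \<in> set vs. norm v = 1)}. deriv_form d f x vs)"

definition deriv_HS_L2 :: "nat \<Rightarrow> (real ^ 'n \<Rightarrow> real) \<Rightarrow> real" where
  "deriv_HS_L2 d f = sqrt (\<integral>x. (deriv_HS d f x)\<^sup>2 \<partial>sphere_measure)"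

text \<open>
  The Bochner integral above is only meaningful for square-integrable \<open>deriv_HS d f\<close>; this is automatic
  if \<open>f\<close> is \<open>d\<close> times continuously differentiable off the origin, the sphere being compact.
\<close>

definition deriv_Op_Linf :: "nat \<Rightarrow> (real ^ 'n \<Rightarrow> real) \<Rightarrow> ereal" where
  "deriv_Op_Linf d f = esssup sphere_measure (\<lambda>x. ereal \<bar>deriv_Op d f x\<bar>)"

section \<open>Homogeneous functions and polynomials\<close>

definition homogeneous :: "real \<Rightarrow> (real ^ 'n \<Rightarrow> real) \<Rightarrow> bool" where
  "homogeneous p f \<longleftrightarrow> (\<forall>x l. x \<noteq> 0 \<longrightarrow> l > 0 \<longrightarrow> f (l *\<^sub>R x) = l powr p * f x)"

definition poly_fun_le :: "nat \<Rightarrow> (real ^ 'n \<Rightarrow> real) set" where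
  "poly_fun_le k =
     {q. \<exists>c :: ('n \<Rightarrow> nat) \<Rightarrow> real.
          q = (\<lambda>x. \<Sum>\<alpha> | (\<Sum>i\<in>UNIV. \<alpha> i) \<le> k. c \<alpha> * (\<Prod>i\<in>UNIV. (x $ i) ^ \<alpha> i))}"

end

theory Submission
  imports Defs
begin

text \<open>
  The engine is a covariance inequality. Let \<open>X, Y\<close> be independent standard Gaussian vectors and extend
  functions from the sphere 0-homogeneously. Rotating \<open>(X, Y)\<close> by an angle \<open>s\<close> and integrating by parts in
  \<open>Y\<close> writes the covariance of \<open>g\<close> and \<open>h\<close> as an integral over \<open>s\<close> of \<open>sin s\<close> times the expectation of
  \<open>\<nabla>g(X\<^sub>s) \<bullet> \<nabla>h(X)\<close>. The gradients carry factors \<open>1 / norm X\<close> with \<open>E(1 / norm X\<^sup>2) = 1 / (n - 2)\<close>, so for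
  \<open>n \<ge> 3\<close> no logarithmic Sobolev inequality is needed: with \<open>h = \<bar>g\<bar>\<^bsup>q-2\<^esup> g\<close> and Young's inequality, mean zero
  functions satisfy \<open>E \<bar>g\<bar>\<^bsup>q\<^esup> \<le> ((q - 1) / (n - 2))\<^bsup>q/2\<^esup> E \<bar>\<nabla>g\<bar>\<^bsup>q\<^esup>\<close> for all \<open>q \<ge> 2\<close>. This loses at most a factor
  2 against the optimal constant, which \<open>c = 1 / (8 e)\<close> can afford.

  All partial derivatives of \<open>f\<close> of order below \<open>d\<close> have mean zero, hence the Hilbert-Schmidt norms are
  controlled by the case \<open>q = 2\<close>. The operator norm of the \<open>k\<close>-th derivative is a limit of soft maxima whose
  gradients are bounded by the operator norm of the next derivative; iterating gives the growth of the moments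
  of \<open>f\<close>, and the exponential series is summed term by term. On the circle, \<open>\<bar>f\<bar> \<le> \<pi>\<^bsup>d\<^esup>\<close> holds pointwise.
\<close>

section \<open>Polar decomposition of Lebesgue measure\<close>

text \<open>An operator norm need not have mean zero. Each level of the iteration therefore splits
  it into its mean, at most a power of P = 1 / sqrt (n - 2) by comparison with Hilbert-Schmidt
  norms, and its fluctuation, for which the moment inequality costs K = sqrt ((q - 1) / (n - 2)).
  The induction closes on powers of K + P because P^(m+1) + K (K + P)^m is at most (K + P)^(m+1).
  The function f itself has mean zero, so its own step contributes K alone. For q = 2 k / d the
  outcome is E |f|^(2k/d) \<le> (2 k / (n - 2))^k; exponents below 2 are out of reach of the
  iteration and are interpolated from the second moment. The constant: since n - 1 \<le> 2 (n - 2)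
  and k^k \<le> e^k k!, the k-th term of the exponential series is at most (4 c e)^k, and c = 1 / (8
  e) turns this into 2^(-k), with sum 2.\<close>

lemma nn_integral_lborel_affine:
  fixes f :: "'a::euclidean_space \<Rightarrow> ennreal"
  assumes [measurable]: "f \<in> borel_measurable borel" and c: "c \<noteq> 0"
  shows "(\<integral>\<^sup>+x. f x \<partial>lborel) = ennreal (\<bar>c\<bar> ^ DIM('a)) * (\<integral>\<^sup>+x. f (t + c *\<^sub>R x) \<partial>lborel)"
proof -
  have "(\<integral>\<^sup>+x. f x \<partial>lborel) =
      (\<integral>\<^sup>+x. f x \<partial>density (distr lborel borel (\<lambda>x. t + c *\<^sub>R x)) (\<lambda>_. \<bar>c\<bar> ^ DIM('a)))"
    using lborel_affine[OF c, of t] by simp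
  also have "\<dots> = ennreal (\<bar>c\<bar> ^ DIM('a)) * (\<integral>\<^sup>+x. f (t + c *\<^sub>R x) \<partial>lborel)"
    by (simp add: nn_integral_density nn_integral_distr nn_integral_cmult)
  finally show ?thesis .
qed

lemma nn_integral_lborel_translate:
  fixes f :: "'a::euclidean_space \<Rightarrow> ennreal"
  assumes [measurable]: "f \<in> borel_measurable borel"
  shows "(\<integral>\<^sup>+x. f (x + t) \<partial>lborel) = (\<integral>\<^sup>+x. f x \<partial>lborel)"
  using nn_integral_lborel_affine[OF assms, of 1 t] by (simp add: add.commute)

lemma nn_integral_lborel_scaleR:
  fixes f :: "'a::euclidean_space \<Rightarrow> ennreal"
  assumes [measurable]: "f \<in> borel_measurable borel" and c: "c > 0"
  shows "(\<integral>\<^sup>+x. f (c *\<^sub>R x) \<partial>lborel) = ennreal (1 / c ^ DIM('a)) * (\<integral>\<^sup>+x. f x \<partial>lborel)"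
proof -
  have "ennreal (1 / c ^ DIM('a)) * (\<integral>\<^sup>+x. f x \<partial>lborel)
     = ennreal (1 / c ^ DIM('a)) * (ennreal (c ^ DIM('a)) * (\<integral>\<^sup>+x. f (c *\<^sub>R x) \<partial>lborel))"
    using nn_integral_lborel_affine[OF assms(1), of c 0] c by simp
  also have "\<dots> = (\<integral>\<^sup>+x. f (c *\<^sub>R x) \<partial>lborel)"
    using c by (simp add: mult.assoc[symmetric] ennreal_mult[symmetric])
  finally show ?thesis by simp
qed

lemma sgn_scaleR_pos: "c > 0 \<Longrightarrow> sgn (c *\<^sub>R x) = sgn (x :: 'a::real_normed_vector)"
  by (simp add: sgn_scaleR)

lemma nn_integral_sphere_measure:
  fixes A :: "real ^ 'n \<Rightarrow> ennreal"
  assumes [measurable]: "A \<in> borel_measurable borel"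
  shows "(\<integral>\<^sup>+x. A x \<partial>sphere_measure) =
     (\<integral>\<^sup>+x. A x \<partial>distr (uniform_measure lborel (cball 0 1)) borel sgn)"
proof -
  let ?U = "uniform_measure lborel (cball 0 1) :: (real ^ 'n) measure"
  let ?S = "distr ?U borel sgn"
  have "(\<integral>\<^sup>+x. A x \<partial>sphere_measure) = (\<integral>\<^sup>+x. A x * indicator (sphere 0 1) x \<partial>?S)"
    unfolding sphere_measure_def by (subst nn_integral_restrict_space) auto
  also have "\<dots> = (\<integral>\<^sup>+x. A x \<partial>?S)"
  proof (rule nn_integral_cong_AE)
    have "AE x in lborel. x \<noteq> (0 :: real ^ 'n)" by (rule AE_lborel_singleton)
    then have "AE x in ?U. sgn x \<in> sphere 0 1"
      by (intro AE_uniform_measureI) (auto simp: norm_sgn)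
    then have "AE x in ?S. x \<in> sphere 0 1" by (subst AE_distr_iff) auto
    then show "AE x in ?S. A x * indicator (sphere 0 1) x = A x" by auto
  qed
  finally show ?thesis .
qed

text \<open>Scaling by \<open>r\<close> maps the truncated cone of radius 1 over a set of directions
  onto the one of radius \<open>r\<close> and multiplies its volume by r^n. Hence direction and
  length are independent under Lebesgue measure: first for lengths up to \<open>r\<close>, then for
  all Borel sets of lengths by uniqueness of measures.\<close>

lemma nn_integral_polar:
  fixes A :: "real ^ 'n \<Rightarrow> ennreal" and \<rho> :: "real \<Rightarrow> ennreal"
  assumes [measurable]: "A \<in> borel_measurable borel" "\<rho> \<in> borel_measurable borel"
  shows "(\<integral>\<^sup>+x. A (sgn x) * \<rho> (norm x) \<partial>lborel) =
    (\<integral>\<^sup>+x. A x \<partial>sphere_measure) * (\<integral>\<^sup>+x. \<rho> (norm (x::real^'n)) \<partial>lborel)"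
proof -
  let ?n = "CARD('n)"
  let ?U = "uniform_measure lborel (cball 0 1) :: (real ^ 'n) measure"
  let ?S = "distr ?U borel sgn"
  let ?\<tau> = "distr (lborel :: (real^'n) measure) borel norm"
  let ?J = "distr (lborel :: (real^'n) measure) (borel \<Otimes>\<^sub>M borel) (\<lambda>x. (sgn x, norm x))"
  have fin: "emeasure lborel (cball 0 1 :: (real ^ 'n) set) \<noteq> \<infinity>"
    using emeasure_bounded_finite[OF bounded_cball, of "0 :: real ^ 'n" 1] by simp
  have "0 < measure lborel (cball 0 1 :: (real ^ 'n) set)"
    by (rule content_cball_pos) simp
  hence pos: "emeasure lborel (cball 0 1 :: (real ^ 'n) set) \<noteq> 0"
    by (auto simp: measure_def)
  interpret U: prob_space ?U using fin pos by (intro prob_space_uniform_measure) auto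
  interpret S: prob_space ?S by (rule U.prob_space_distr) simp
  have ball: "emeasure lborel {x :: real^'n. sgn x \<in> B \<and> norm x \<le> r} =
      ennreal (r ^ ?n) * emeasure lborel {x :: real^'n. sgn x \<in> B \<and> norm x \<le> 1}"
    if [measurable]: "B \<in> sets borel" and r: "r \<ge> 0" for B r
  proof (cases "r = 0")
    case True
    have "emeasure lborel {x :: real^'n. sgn x \<in> B \<and> norm x \<le> r} \<le> emeasure lborel {0 :: real^'n}"
      by (rule emeasure_mono) (auto simp: True)
    then show ?thesis by (simp add: True power_0_left)
  next
    case False
    have "emeasure lborel {x :: real^'n. sgn x \<in> B \<and> norm x \<le> r} =
       (\<integral>\<^sup>+x. indicator {x :: real^'n. sgn x \<in> B \<and> norm x \<le> r} x \<partial>lborel)" by simp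
    also have "\<dots> = ennreal (r ^ ?n) *
       (\<integral>\<^sup>+x. indicator {x :: real^'n. sgn x \<in> B \<and> norm x \<le> r} (0 + r *\<^sub>R x) \<partial>lborel)"
      using False r by (subst nn_integral_lborel_affine[where c = r and t = 0]) auto
    also have "(\<lambda>x. indicator {x :: real^'n. sgn x \<in> B \<and> norm x \<le> r} (0 + r *\<^sub>R x) :: ennreal) =
        indicator {x :: real^'n. sgn x \<in> B \<and> norm x \<le> 1}"
      using False r by (auto simp: indicator_def fun_eq_iff sgn_scaleR_pos)
    finally show ?thesis by simp
  qed
  have \<tau>: "emeasure ?\<tau> {..r} = ennreal (r ^ ?n) * emeasure lborel (cball 0 1 :: (real ^ 'n) set)"
    if "r \<ge> 0" for r
  proof -
    have "{x::real^'n. norm x \<le> 1} = cball 0 1" by auto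
    moreover have "norm -` {..r} = {x::real^'n. norm x \<le> r}" by auto
    ultimately show ?thesis using ball[of UNIV r] that by (simp add: emeasure_distr)
  qed
  \<comment> \<open>The law of the length has infinite mass, but the half-lines up to an integer
    exhaust it with finite mass.\<close>
  have sf: "sigma_finite_measure ?\<tau>"
  proof
    have "x \<in> (\<Union>i::nat. {..real i})" for x by (simp add: real_arch_simple)
    then have "\<Union> (range (\<lambda>i::nat. {..real i})) = UNIV" by blast
    then show "\<exists>A. countable A \<and> A \<subseteq> sets ?\<tau> \<and> \<Union> A = space ?\<tau> \<and> (\<forall>a\<in>A. emeasure ?\<tau> a \<noteq> \<infinity>)"
      using fin by (intro exI[of _ "range (\<lambda>i::nat. {..real i})"])
        (auto simp: \<tau> ennreal_mult_eq_top_iff)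
  qed
  have prod: "?S \<Otimes>\<^sub>M ?\<tau> = ?J"
  proof (rule pair_measure_eqI)
    show "sigma_finite_measure ?S" by unfold_locales
    show "sigma_finite_measure ?\<tau>" by (rule sf)
    show "sets (?S \<Otimes>\<^sub>M ?\<tau>) = sets ?J" by (simp cong: sets_pair_measure_cong)
    fix B R assume "B \<in> sets ?S" "R \<in> sets ?\<tau>"
    then have [measurable]: "B \<in> sets borel" "R \<in> sets borel" by auto
    let ?M = "distr (density lborel (indicator {x::real^'n. sgn x \<in> B})) borel norm"
    let ?N = "scale_measure (emeasure ?S B) ?\<tau>"
    have eqM: "emeasure ?M R = emeasure lborel {x::real^'n. sgn x \<in> B \<and> norm x \<in> R}"
      if [measurable]: "R \<in> sets borel" for R
    proof -
      have "emeasure ?M R = emeasure (density lborel (indicator {x::real^'n. sgn x \<in> B})) (norm -` R)"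
        by (simp add: emeasure_distr)
      also have "\<dots> = (\<integral>\<^sup>+x. indicator {x::real^'n. sgn x \<in> B} x * indicator (norm -` R) x \<partial>lborel)"
      proof (rule emeasure_density)
        show "indicator {x::real^'n. sgn x \<in> B} \<in> borel_measurable lborel" by measurable
        show "norm -` R \<in> sets (lborel :: (real^'n) measure)"
          using measurable_sets_borel[OF borel_measurable_norm that] by simp
      qed
      also have "\<dots> = (\<integral>\<^sup>+x. indicator {x::real^'n. sgn x \<in> B \<and> norm x \<in> R} x \<partial>lborel)"
        by (intro nn_integral_cong) (auto simp: indicator_def)
      finally show ?thesis by simp
    qed
    have SB: "emeasure ?S B * emeasure lborel (cball 0 1 :: (real ^ 'n) set)
        = emeasure lborel {x::real^'n. sgn x \<in> B \<and> norm x \<le> 1}"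
    proof -
      have m: "sgn -` B \<in> sets (borel :: (real^'n) measure)"
        using measurable_sets[OF borel_measurable_sgn \<open>B \<in> sets borel\<close>] by simp
      have "emeasure ?S B = emeasure lborel (cball 0 1 \<inter> sgn -` B) / emeasure lborel (cball 0 1 :: (real ^ 'n) set)"
        using m by (subst emeasure_distr) (auto intro!: emeasure_uniform_measure)
      moreover have "cball 0 1 \<inter> sgn -` B = {x::real^'n. sgn x \<in> B \<and> norm x \<le> 1}" by auto
      ultimately show ?thesis using pos fin
        by (simp add: ennreal_divide_times ennreal_mult_divide_eq less_top)
    qed
    \<comment> \<open>The law of the length restricted to directions in \<open>B\<close> against the
      full law times the share of \<open>B\<close>. The half-lines are stable under intersection and
      generate the Borel sets, so comparing on them suffices.\<close>
    have "?M = ?N"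
    proof (rule measure_eqI_generator_eq)
      let ?E = "range (\<lambda>r::real. {..r})"
      show "Int_stable ?E" by (auto simp: Int_stable_def)
      show "?E \<subseteq> Pow UNIV" by simp
      have "sets (borel :: real measure) = sigma_sets UNIV ?E"
        unfolding borel_eq_atMost by (rule sets_measure_of) simp
      then show "sets ?M = sigma_sets UNIV ?E" "sets ?N = sigma_sets UNIV ?E" by simp_all
      show "range (\<lambda>i::nat. {..real i}) \<subseteq> ?E" by auto
      show "(\<Union>i::nat. {..real i}) = UNIV" by (auto simp: real_arch_simple)
      show "emeasure ?M {..real i} \<noteq> \<infinity>" for i
      proof -
        have "emeasure ?M {..real i} \<le> emeasure lborel (cball (0::real^'n) (real i))"
          unfolding eqM[OF atMost_borel] by (rule emeasure_mono) auto
        also have "\<dots> < \<infinity>" by (rule emeasure_bounded_finite) simp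
        finally show ?thesis by simp
      qed
      fix X assume "X \<in> ?E"
      then obtain r where X: "X = {..r}" by auto
      show "emeasure ?M X = emeasure ?N X"
      proof (cases "r \<ge> 0")
        case True
        show ?thesis using ball[of B r] SB True \<tau>[OF True] by (simp add: X eqM mult_ac)
      next
        case False
        then have "\<not> norm x \<le> r" for x :: "real^'n" using norm_ge_zero[of x] by linarith
        then have "{x::real^'n. sgn x \<in> B \<and> norm x \<in> {..r}} = {}" "norm -` {..r} = ({}::(real^'n) set)"
          by auto
        then show ?thesis unfolding X using eqM[of "{..r}"] by (simp add: emeasure_distr)
      qed
    qed
    then have "emeasure ?S B * emeasure ?\<tau> R = emeasure ?M R" by simp
    also have "\<dots> = emeasure ?J (B \<times> R)"
    proof -
      have "(\<lambda>x. (sgn x, norm x)) -` (B \<times> R) = {x::real^'n. sgn x \<in> B \<and> norm x \<in> R}" by auto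
      then show ?thesis by (subst emeasure_distr) (simp_all add: eqM)
    qed
    finally show "emeasure ?S B * emeasure ?\<tau> R = emeasure ?J (B \<times> R)" .
  qed
  have "(\<integral>\<^sup>+x. A (sgn x) * \<rho> (norm x) \<partial>lborel) = (\<integral>\<^sup>+z. A (fst z) * \<rho> (snd z) \<partial>?J)"
    by (simp add: nn_integral_distr)
  also have "\<dots> = (\<integral>\<^sup>+z. A (fst z) * \<rho> (snd z) \<partial>(?S \<Otimes>\<^sub>M ?\<tau>))" by (simp only: prod)
  also have "\<dots> = (\<integral>\<^sup>+a. \<integral>\<^sup>+r. A a * \<rho> r \<partial>?\<tau> \<partial>?S)"
    by (subst sigma_finite_measure.nn_integral_fst[OF sf, symmetric])
       (simp_all, measurable)
  also have "\<dots> = (\<integral>\<^sup>+a. A a \<partial>?S) * (\<integral>\<^sup>+r. \<rho> r \<partial>?\<tau>)"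
    by (simp add: nn_integral_cmult nn_integral_multc)
  finally show ?thesis
    by (simp add: nn_integral_sphere_measure nn_integral_distr)
qed

section \<open>The Gaussian measure\<close>

definition gauss_density :: "'a::euclidean_space \<Rightarrow> real" where
  "gauss_density x = (1 / sqrt (2 * pi)) ^ DIM('a) * exp (- (norm x)\<^sup>2 / 2)"

definition gauss :: "'a::euclidean_space measure" where
  "gauss = density lborel (\<lambda>x. ennreal (gauss_density x))"

lemma gauss_density_pos: "gauss_density x > 0"
  by (simp add: gauss_density_def)

lemma gauss_density_measurable [measurable]: "gauss_density \<in> borel_measurable borel"
  unfolding gauss_density_def[abs_def] by measurable

lemma sets_gauss [measurable_cong, simp]: "sets gauss = sets borel"
  and space_gauss [simp]: "space gauss = UNIV"
  by (simp_all add: gauss_def)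

lemma nn_integral_gauss:
  "f \<in> borel_measurable borel \<Longrightarrow>
     (\<integral>\<^sup>+x. f x \<partial>gauss) = (\<integral>\<^sup>+x. ennreal (gauss_density x) * f x \<partial>lborel)"
  unfolding gauss_def by (subst nn_integral_density) auto

lemma nn_integral_gauss_density: "(\<integral>\<^sup>+x. ennreal (gauss_density (x::'a::euclidean_space)) \<partial>lborel) = 1"
proof -
  have "gauss_density x = (\<Prod>b\<in>Basis. std_normal_density (x \<bullet> b))" for x :: 'a
    by (simp add: gauss_density_def std_normal_density_def prod.distrib prod_dividef exp_sum[symmetric]
        norm_eq_sqrt_inner euclidean_inner[of x x] power2_eq_square sum_divide_distrib
        sum_negf power_one_over inner_ge_zero sum_nonneg)
  then have "(\<integral>\<^sup>+x. ennreal (gauss_density (x::'a)) \<partial>lborel) =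
      (\<integral>\<^sup>+x. (\<Prod>b\<in>Basis. ennreal (std_normal_density (x \<bullet> (b::'a)))) \<partial>lborel)"
    by (simp add: prod_ennreal)
  also have "\<dots> = (\<Prod>b\<in>(Basis::'a set). (\<integral>\<^sup>+x. ennreal (std_normal_density x) \<partial>lborel))"
    by (rule nn_integral_lborel_prod) auto
  also have "(\<integral>\<^sup>+x. ennreal (std_normal_density x) \<partial>lborel) = 1"
    by (subst nn_integral_eq_integral) (auto simp: integrable_normal_density)
  finally show ?thesis by simp
qed

lemma prob_space_gauss: "prob_space (gauss :: 'a::euclidean_space measure)"
proof
  show "emeasure gauss (space gauss :: 'a set) = 1"
    using nn_integral_gauss_density[where 'a='a]
    by (simp add: gauss_def emeasure_density)
qed

interpretation gauss: prob_space "gauss :: 'a::euclidean_space measure"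
  by (rule prob_space_gauss)

interpretation gauss_pair: pair_prob_space
  "gauss :: 'a::euclidean_space measure" "gauss :: 'b::euclidean_space measure" ..

text \<open>Shift and factor have the form left over by completing a square; translation invariance
  removes the shift.\<close>

lemma gauss_density_scaleR:
  fixes x :: "'a::euclidean_space"
  assumes a: "a > 0"
  shows "(\<integral>\<^sup>+x. ennreal (gauss_density (sqrt a *\<^sub>R (x + t) :: 'a)) \<partial>lborel) = ennreal (1 / sqrt a ^ DIM('a))"
proof -
  have "(\<integral>\<^sup>+x. ennreal (gauss_density (sqrt a *\<^sub>R (x + t) :: 'a)) \<partial>lborel)
     = (\<integral>\<^sup>+x. ennreal (gauss_density (sqrt a *\<^sub>R x :: 'a)) \<partial>lborel)"
    by (subst nn_integral_lborel_translate[where f = "\<lambda>x. ennreal (gauss_density (sqrt a *\<^sub>R x))"]) auto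
  also have "\<dots> = ennreal (1 / sqrt a ^ DIM('a))"
    using a by (subst nn_integral_lborel_scaleR[where f = "\<lambda>x. ennreal (gauss_density x)"])
      (auto simp: nn_integral_gauss_density)
  finally show ?thesis .
qed

section \<open>Rotation invariance of a pair of independent Gaussian vectors\<close>

lemma lborel_rotation:
  fixes \<Psi> :: "'a::euclidean_space \<times> 'a \<Rightarrow> ennreal"
  assumes [measurable]: "\<Psi> \<in> borel_measurable (borel \<Otimes>\<^sub>M borel)"
    and cs: "c\<^sup>2 + s\<^sup>2 = (1::real)"
  shows "(\<integral>\<^sup>+x. \<integral>\<^sup>+y. \<Psi> (c *\<^sub>R x + s *\<^sub>R y, c *\<^sub>R y - s *\<^sub>R x) \<partial>lborel \<partial>lborel) =
    (\<integral>\<^sup>+x. \<integral>\<^sup>+y. \<Psi> (x, y) \<partial>lborel \<partial>lborel)"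
proof (cases "s = 0")
  case True
  then consider "c = 1" | "c = -1" using cs by (auto simp: power2_eq_1_iff)
  then show ?thesis
  proof cases
    case 2
    have refl: "(\<integral>\<^sup>+x. f (- x) \<partial>lborel) = (\<integral>\<^sup>+x. f x \<partial>lborel)" if "f \<in> borel_measurable borel" for f :: "'a \<Rightarrow> ennreal"
      using nn_integral_lborel_affine[OF that, of "-1" 0] by simp
    have "(\<integral>\<^sup>+x. \<integral>\<^sup>+y. \<Psi> (- x, - y) \<partial>lborel \<partial>lborel) = (\<integral>\<^sup>+x. \<integral>\<^sup>+y. \<Psi> (- x, y) \<partial>lborel \<partial>lborel)"
      by (intro nn_integral_cong refl) measurable
    also have "\<dots> = (\<integral>\<^sup>+x. \<integral>\<^sup>+y. \<Psi> (x, y) \<partial>lborel \<partial>lborel)"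
      by (rule refl[of "\<lambda>x. \<integral>\<^sup>+y. \<Psi> (x, y) \<partial>lborel"]) measurable
    finally show ?thesis using True 2 by simp
  qed (use True in simp)
next
  case False
  \<comment> \<open>a rotation is a product of three shears\<close>
  define a where "a = (1 - c) / s"
  have sa: "s * a = 1 - c" using False by (simp add: a_def)
  have "s * (s - c * a) = s\<^sup>2 - c * (s * a)"
    by (simp add: algebra_simps power2_eq_square)
  also have "\<dots> = (c\<^sup>2 + s\<^sup>2) - c"
    unfolding sa by (simp add: algebra_simps power2_eq_square)
  finally have "s * (s - c * a) = s * a"
    unfolding cs sa .
  \<comment> \<open>With c = cos t and s = sin t, \<open>a\<close> is tan (t / 2). This half-angle
    identity is what gives the first and the last shear the same coefficient.\<close>
  then have ca: "s - c * a = a" using False by simp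
  have swap: "(\<integral>\<^sup>+x. \<integral>\<^sup>+y. f x y \<partial>lborel \<partial>lborel) = (\<integral>\<^sup>+y. \<integral>\<^sup>+x. f x y \<partial>lborel \<partial>lborel)"
    if "(\<lambda>(x, y). f x y) \<in> borel_measurable (borel \<Otimes>\<^sub>M borel)" for f :: "'a \<Rightarrow> 'a \<Rightarrow> ennreal"
    by (rule lborel_pair.Fubini'[symmetric]) (use that in simp)
  have "(\<integral>\<^sup>+x. \<integral>\<^sup>+y. \<Psi> (c *\<^sub>R x + s *\<^sub>R y, c *\<^sub>R y - s *\<^sub>R x) \<partial>lborel \<partial>lborel)
      = (\<integral>\<^sup>+y. \<integral>\<^sup>+x. \<Psi> (c *\<^sub>R x + s *\<^sub>R y, c *\<^sub>R y - s *\<^sub>R x) \<partial>lborel \<partial>lborel)"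
    by (rule swap) measurable
  also have "\<dots> = (\<integral>\<^sup>+y. \<integral>\<^sup>+x. \<Psi> (c *\<^sub>R x + a *\<^sub>R y, y - s *\<^sub>R x) \<partial>lborel \<partial>lborel)"
  proof (rule nn_integral_cong)
    fix y :: 'a
    have "c *\<^sub>R (x + a *\<^sub>R y) + a *\<^sub>R y = c *\<^sub>R x + (s - c * a + c * a) *\<^sub>R y" for x
      using ca by (simp add: algebra_simps)
    moreover have "y - s *\<^sub>R (x + a *\<^sub>R y) = (1 - s * a) *\<^sub>R y - s *\<^sub>R x" for x
      by (simp add: algebra_simps)
    ultimately have "(\<lambda>x. \<Psi> (c *\<^sub>R x + s *\<^sub>R y, c *\<^sub>R y - s *\<^sub>R x)) =
        (\<lambda>x. (\<lambda>x. \<Psi> (c *\<^sub>R x + a *\<^sub>R y, y - s *\<^sub>R x)) (x + a *\<^sub>R y))"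
      by (simp add: sa fun_eq_iff)
    then show "(\<integral>\<^sup>+x. \<Psi> (c *\<^sub>R x + s *\<^sub>R y, c *\<^sub>R y - s *\<^sub>R x) \<partial>lborel) =
        (\<integral>\<^sup>+x. \<Psi> (c *\<^sub>R x + a *\<^sub>R y, y - s *\<^sub>R x) \<partial>lborel)"
      by (simp only:) (rule nn_integral_lborel_translate, measurable)
  qed
  also have "\<dots> = (\<integral>\<^sup>+x. \<integral>\<^sup>+y. \<Psi> (c *\<^sub>R x + a *\<^sub>R y, y - s *\<^sub>R x) \<partial>lborel \<partial>lborel)"
    by (rule swap[symmetric]) measurable
  also have "\<dots> = (\<integral>\<^sup>+x. \<integral>\<^sup>+y. \<Psi> (x + a *\<^sub>R y, y) \<partial>lborel \<partial>lborel)"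
  proof (rule nn_integral_cong)
    fix x :: 'a
    have "x + a *\<^sub>R (y + (- s) *\<^sub>R x) = (1 - s * a) *\<^sub>R x + a *\<^sub>R y" for y
      by (simp add: algebra_simps)
    then have "(\<lambda>y. \<Psi> (c *\<^sub>R x + a *\<^sub>R y, y - s *\<^sub>R x)) =
        (\<lambda>y. (\<lambda>y. \<Psi> (x + a *\<^sub>R y, y)) (y + (- s) *\<^sub>R x))"
      by (simp add: sa fun_eq_iff)
    then show "(\<integral>\<^sup>+y. \<Psi> (c *\<^sub>R x + a *\<^sub>R y, y - s *\<^sub>R x) \<partial>lborel) =
        (\<integral>\<^sup>+y. \<Psi> (x + a *\<^sub>R y, y) \<partial>lborel)"
      by (simp only:) (rule nn_integral_lborel_translate, measurable)
  qed
  also have "\<dots> = (\<integral>\<^sup>+y. \<integral>\<^sup>+x. \<Psi> (x + a *\<^sub>R y, y) \<partial>lborel \<partial>lborel)"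
    by (rule swap) measurable
  also have "\<dots> = (\<integral>\<^sup>+y. \<integral>\<^sup>+x. \<Psi> (x, y) \<partial>lborel \<partial>lborel)"
    by (intro nn_integral_cong nn_integral_lborel_translate) measurable
  also have "\<dots> = (\<integral>\<^sup>+x. \<integral>\<^sup>+y. \<Psi> (x, y) \<partial>lborel \<partial>lborel)"
    by (rule swap[symmetric]) measurable
  finally show ?thesis .
qed

lemma nn_integral_gauss_pair:
  fixes f :: "'a::euclidean_space \<times> 'b::euclidean_space \<Rightarrow> ennreal"
  assumes [measurable]: "f \<in> borel_measurable (borel \<Otimes>\<^sub>M borel)"
  shows "(\<integral>\<^sup>+z. f z \<partial>(gauss \<Otimes>\<^sub>M gauss)) =
    (\<integral>\<^sup>+x. \<integral>\<^sup>+y. ennreal (gauss_density x * gauss_density y) * f (x, y) \<partial>lborel \<partial>lborel)"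
proof -
  have "(\<integral>\<^sup>+z. f z \<partial>(gauss \<Otimes>\<^sub>M gauss)) = (\<integral>\<^sup>+x. \<integral>\<^sup>+y. f (x, y) \<partial>gauss \<partial>gauss)"
    by (subst gauss.nn_integral_fst[symmetric]) auto
  also have "\<dots> = (\<integral>\<^sup>+x. ennreal (gauss_density x) * (\<integral>\<^sup>+y. ennreal (gauss_density y) * f (x, y) \<partial>lborel) \<partial>lborel)"
    by (simp add: nn_integral_gauss)
  also have "\<dots> = (\<integral>\<^sup>+x. \<integral>\<^sup>+y. ennreal (gauss_density x * gauss_density y) * f (x, y) \<partial>lborel \<partial>lborel)"
    by (simp add: nn_integral_cmult[symmetric] ennreal_mult less_imp_le[OF gauss_density_pos] mult.assoc)
  finally show ?thesis .
qed

lemma nn_integral_gauss_rotation: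
  fixes f :: "'a::euclidean_space \<times> 'a \<Rightarrow> ennreal"
  assumes [measurable]: "f \<in> borel_measurable (borel \<Otimes>\<^sub>M borel)"
    and cs: "c\<^sup>2 + s\<^sup>2 = (1::real)"
  shows "(\<integral>\<^sup>+z. f (c *\<^sub>R fst z + s *\<^sub>R snd z, c *\<^sub>R snd z - s *\<^sub>R fst z) \<partial>(gauss \<Otimes>\<^sub>M gauss)) =
    (\<integral>\<^sup>+z. f z \<partial>(gauss \<Otimes>\<^sub>M gauss))"
proof -
  have norm_inv: "(norm (c *\<^sub>R x + s *\<^sub>R y))\<^sup>2 + (norm (c *\<^sub>R y - s *\<^sub>R x))\<^sup>2 = (norm x)\<^sup>2 + (norm y)\<^sup>2" for x y :: 'a
  proof -
    have "(norm (c *\<^sub>R x + s *\<^sub>R y))\<^sup>2 + (norm (c *\<^sub>R y - s *\<^sub>R x))\<^sup>2 =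
       (c\<^sup>2 + s\<^sup>2) * ((norm x)\<^sup>2 + (norm y)\<^sup>2)"
      unfolding power2_norm_eq_inner
      unfolding power2_eq_square inner_add_left inner_add_right
        inner_diff_left inner_diff_right inner_scaleR_left inner_scaleR_right
      by (simp add: inner_commute[of y x] algebra_simps)
    then show ?thesis using cs by simp
  qed
  have inv: "gauss_density x * gauss_density y =
      gauss_density (c *\<^sub>R x + s *\<^sub>R y) * gauss_density (c *\<^sub>R y - s *\<^sub>R x)" for x y :: 'a
  proof -
    have "exp (- (norm x)\<^sup>2 / 2) * exp (- (norm y)\<^sup>2 / 2) =
        exp (- (norm (c *\<^sub>R x + s *\<^sub>R y))\<^sup>2 / 2) * exp (- (norm (c *\<^sub>R y - s *\<^sub>R x))\<^sup>2 / 2)"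
      unfolding mult_exp_exp using norm_inv[of x y] by (intro arg_cong[where f = exp]) linarith
    then show ?thesis by (simp add: gauss_density_def)
  qed
  have "(\<integral>\<^sup>+z. f (c *\<^sub>R fst z + s *\<^sub>R snd z, c *\<^sub>R snd z - s *\<^sub>R fst z) \<partial>(gauss \<Otimes>\<^sub>M gauss)) =
    (\<integral>\<^sup>+x. \<integral>\<^sup>+y. ennreal (gauss_density x * gauss_density y) *
       f (c *\<^sub>R x + s *\<^sub>R y, c *\<^sub>R y - s *\<^sub>R x) \<partial>lborel \<partial>lborel)"
    by (subst nn_integral_gauss_pair) auto
  also have "\<dots> = (\<integral>\<^sup>+x. \<integral>\<^sup>+y. (\<lambda>z. ennreal (gauss_density (fst z) * gauss_density (snd z)) * f z)
       (c *\<^sub>R x + s *\<^sub>R y, c *\<^sub>R y - s *\<^sub>R x) \<partial>lborel \<partial>lborel)"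
    by (subst inv) simp
  also have "\<dots> = (\<integral>\<^sup>+x. \<integral>\<^sup>+y. (\<lambda>z. ennreal (gauss_density (fst z) * gauss_density (snd z)) * f z)
       (x, y) \<partial>lborel \<partial>lborel)"
    by (rule lborel_rotation[OF _ cs]) measurable
  finally show ?thesis by (subst nn_integral_gauss_pair) auto
qed

lemma gauss_rotation:
  assumes cs: "c\<^sup>2 + s\<^sup>2 = (1::real)"
  shows "distr (gauss \<Otimes>\<^sub>M gauss) (borel \<Otimes>\<^sub>M borel)
      (\<lambda>z. (c *\<^sub>R fst z + s *\<^sub>R snd z, c *\<^sub>R snd z - s *\<^sub>R fst z)) =
    (gauss \<Otimes>\<^sub>M gauss :: ('a::euclidean_space \<times> 'a) measure)" (is "?D = ?G")
proof (rule measure_eqI)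
  show "sets ?D = sets ?G" by (simp cong: sets_pair_measure_cong)
  fix A assume "A \<in> sets ?D"
  then have [measurable]: "A \<in> sets (borel \<Otimes>\<^sub>M borel)" by simp
  have "A \<in> sets ?G" using \<open>A \<in> sets ?D\<close> by (simp cong: sets_pair_measure_cong)
  have "emeasure ?D A = (\<integral>\<^sup>+z. indicator A z \<partial>?D)" by simp
  also have "\<dots> = (\<integral>\<^sup>+z. indicator A (c *\<^sub>R fst z + s *\<^sub>R snd z, c *\<^sub>R snd z - s *\<^sub>R fst z) \<partial>?G)"
    by (subst nn_integral_distr) auto
  also have "\<dots> = (\<integral>\<^sup>+z. indicator A z \<partial>?G)"
    by (rule nn_integral_gauss_rotation[OF _ cs]) measurable
  finally show "emeasure ?D A = emeasure ?G A" using \<open>A \<in> sets ?G\<close> by simp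
qed


section \<open>Inverse square moments of Gaussian vectors\<close>

lemma inverse_square_le_exp_integral:
  fixes w :: real
  shows "ennreal (1 / w\<^sup>2) \<le> (\<integral>\<^sup>+u. ennreal (exp (- u * w\<^sup>2 / 2) / 2) * indicator {0..} u \<partial>lborel)"
\<comment> \<open>For \<open>w = 0\<close> the left side is 0, division by zero being zero, while
  the integral is infinite. Hence an inequality; for all other \<open>w\<close> both sides
  agree.\<close>
proof (cases "w = 0")
  case False
  let ?F = "\<lambda>u. - exp (- u * w\<^sup>2 / 2) / w\<^sup>2"
  have "(\<integral>\<^sup>+u. ennreal (exp (- u * w\<^sup>2 / 2) / 2) * indicator {0..} u \<partial>lborel) = ennreal (0 - ?F 0)"
  proof (rule nn_integral_FTC_atLeast)
    show "DERIV ?F u :> exp (- u * w\<^sup>2 / 2) / 2" for u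
      using False by (auto intro!: derivative_eq_intros simp: field_simps)
    have "((\<lambda>u. exp (- (u * (w\<^sup>2 / 2)))) \<longlongrightarrow> 0) at_top"
      using False by (intro filterlim_compose[OF exp_at_bot] filterlim_uminus_at_bot_at_top
        filterlim_compose[OF filterlim_uminus_at_bot_at_top] filterlim_at_top_mult_tendsto_pos[OF tendsto_const] filterlim_ident) auto
    then have "((\<lambda>u. - exp (- (u * (w\<^sup>2 / 2))) / w\<^sup>2) \<longlongrightarrow> - 0 / w\<^sup>2) at_top"
      by (intro tendsto_intros) (use False in auto)
    then show "(?F \<longlongrightarrow> 0) at_top" by (simp add: field_simps)
  qed auto
  then show ?thesis using False by simp
qed simp

text \<open>The integrand decays like u^(-n/2), so convergence is exactly the condition
  \<open>n \<ge> 3\<close>. The value is the origin of every factor 1 / (n - 2) below.\<close>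

lemma nn_integral_powr_tail:
  fixes n :: nat
  assumes n: "n \<ge> 3"
  shows "(\<integral>\<^sup>+u. ennreal (1 / sqrt (1 + u) ^ n) * indicator {0..} u \<partial>lborel) = ennreal (2 / (real n - 2))"
proof -
  let ?F = "\<lambda>u. - 2 / (real n - 2) * (1 + u) powr (1 - real n / 2)"
  have eq: "1 / sqrt (1 + u) ^ n = (1 + u) powr (- (real n / 2))" if "u \<ge> 0" for u
    using that by (simp add: powr_half_sqrt[symmetric] powr_powr powr_realpow[symmetric] powr_minus_divide)
  have "(\<integral>\<^sup>+u. ennreal (1 / sqrt (1 + u) ^ n) * indicator {0..} u \<partial>lborel) = ennreal (0 - ?F 0)"
  proof (rule nn_integral_FTC_atLeast)
    fix u :: real assume u: "0 \<le> u"
    have "DERIV (\<lambda>u. (1 + u) powr (1 - real n / 2)) u :> (1 - real n / 2) * (1 + u) powr (1 - real n / 2 - 1)"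
      using u by (auto intro!: derivative_eq_intros)
    from DERIV_cmult[OF this, of "- 2 / (real n - 2)"]
    have "DERIV ?F u :> - 2 / (real n - 2) * (1 - real n / 2) * (1 + u) powr (1 - real n / 2 - 1)"
      by (simp only: mult.assoc)
    moreover have "- 2 / (real n - 2) * (1 - real n / 2) = 1"
      using n by (simp add: field_simps)
    ultimately have "DERIV ?F u :> (1 + u) powr (1 - real n / 2 - 1)"
      by (simp only: mult_1_left)
    then show "DERIV ?F u :> 1 / sqrt (1 + u) ^ n" using u by (simp add: eq)
  next
    have "((\<lambda>u. (1 + u) powr (1 - real n / 2)) \<longlongrightarrow> 0) at_top"
      using n by (intro tendsto_neg_powr filterlim_tendsto_add_at_top[OF tendsto_const] filterlim_ident) auto
    then have "(?F \<longlongrightarrow> - 2 / (real n - 2) * 0) at_top" by (intro tendsto_intros)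
    then show "(?F \<longlongrightarrow> 0) at_top" by simp
  qed auto
  also have "0 - ?F 0 = 2 / (real n - 2)" by simp
  finally show ?thesis .
qed

text \<open>As a quadratic form in (x, y) the exponent has determinant (1 + u c^2) (1 + u s^2) - (u
  c s)^2 = 1 + u. Completing the square in \<open>y\<close>, whose coefficient is \<open>a\<close>,
  therefore leaves the coefficient (1 + u) / a for \<open>x\<close>.\<close>

lemma gauss_complete_square:
  fixes x y :: "'a::euclidean_space"
  assumes cs: "c\<^sup>2 + s\<^sup>2 = (1::real)" and u: "u \<ge> 0"
  defines "a \<equiv> 1 + u * s\<^sup>2"
  shows "gauss_density x * gauss_density y * exp (- u * (norm (c *\<^sub>R x - s *\<^sub>R y))\<^sup>2 / 2) =
    gauss_density (sqrt ((1 + u) / a) *\<^sub>R x) * gauss_density (sqrt a *\<^sub>R (y + (- (u * c * s / a)) *\<^sub>R x))"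
proof -
  have a: "a > 0" using u by (simp add: a_def add_pos_nonneg)
  have "(norm x)\<^sup>2 + (norm y)\<^sup>2 + u * (norm (c *\<^sub>R x - s *\<^sub>R y))\<^sup>2 =
      (norm (sqrt ((1 + u) / a) *\<^sub>R x))\<^sup>2 + (norm (sqrt a *\<^sub>R (y + (- (u * c * s / a)) *\<^sub>R x)))\<^sup>2"
  proof -
    define X Y Z where "X = x \<bullet> x" and "Y = y \<bullet> y" and "Z = x \<bullet> y"
    have 1: "(norm (sqrt ((1 + u) / a) *\<^sub>R x))\<^sup>2 = (1 + u) / a * X"
      using a u by (simp add: power_mult_distrib X_def power2_norm_eq_inner[symmetric])
    have 2: "(norm (sqrt a *\<^sub>R (y + (- (u * c * s / a)) *\<^sub>R x)))\<^sup>2 =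
       a * (norm (y + (- (u * c * s / a)) *\<^sub>R x))\<^sup>2"
      using a by (simp add: power_mult_distrib)
    also have "(norm (y + (- (u * c * s / a)) *\<^sub>R x))\<^sup>2 = Y - 2 * (u * c * s / a) * Z + (u * c * s / a)\<^sup>2 * X"
      unfolding power2_norm_eq_inner
      unfolding power2_eq_square inner_add_left inner_add_right inner_scaleR_left inner_scaleR_right X_def Y_def Z_def
      by (simp add: inner_commute[of y x] algebra_simps)
    also have "a * (Y - 2 * (u * c * s / a) * Z + (u * c * s / a)\<^sup>2 * X) =
        a * Y - 2 * u * c * s * Z + (u * c * s)\<^sup>2 / a * X"
      using a by (simp add: field_simps power2_eq_square)
    finally have 3: "(norm (sqrt a *\<^sub>R (y + (- (u * c * s / a)) *\<^sub>R x)))\<^sup>2 =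
        a * Y - 2 * u * c * s * Z + (u * c * s)\<^sup>2 / a * X" .
    have 4: "(norm (c *\<^sub>R x - s *\<^sub>R y))\<^sup>2 = c\<^sup>2 * X - 2 * c * s * Z + s\<^sup>2 * Y"
      unfolding power2_norm_eq_inner
      unfolding power2_eq_square inner_diff_left inner_diff_right inner_scaleR_left inner_scaleR_right X_def Y_def Z_def
      by (simp add: inner_commute[of y x] algebra_simps)
    have "(1 + u * c\<^sup>2) * a = (1 + u) + (u * c * s)\<^sup>2"
    proof -
      have "(1 + u * c\<^sup>2) * a = 1 + u * (c\<^sup>2 + s\<^sup>2) + (u * c * s)\<^sup>2"
        by (simp add: a_def algebra_simps power2_eq_square)
      then show ?thesis using cs by simp
    qed
    then have 5: "(1 + u) / a + (u * c * s)\<^sup>2 / a = 1 + u * c\<^sup>2"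
      using a by (simp add: field_simps)
    have "(1 + u) / a * X + (a * Y - 2 * u * c * s * Z + (u * c * s)\<^sup>2 / a * X) =
       ((1 + u) / a + (u * c * s)\<^sup>2 / a) * X + a * Y - 2 * u * c * s * Z"
      by (simp add: distrib_right)
    also have "\<dots> = X + Y + u * (c\<^sup>2 * X - 2 * c * s * Z + s\<^sup>2 * Y)"
      unfolding 5 by (simp add: a_def algebra_simps)
    finally show ?thesis unfolding 1 3 4 by (simp add: X_def Y_def power2_norm_eq_inner)
  qed
  then have "exp (- (norm x)\<^sup>2 / 2) * exp (- (norm y)\<^sup>2 / 2) * exp (- u * (norm (c *\<^sub>R x - s *\<^sub>R y))\<^sup>2 / 2) =
    exp (- (norm (sqrt ((1 + u) / a) *\<^sub>R x))\<^sup>2 / 2) * exp (- (norm (sqrt a *\<^sub>R (y + (- (u * c * s / a)) *\<^sub>R x)))\<^sup>2 / 2)"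
    unfolding mult_exp_exp by (intro arg_cong[where f = exp]) (simp add: field_simps)
  then show ?thesis by (simp add: gauss_density_def)
qed

lemma nn_integral_polar_scaled_gauss:
  fixes A :: "real ^ 'n \<Rightarrow> ennreal"
  assumes [measurable]: "A \<in> borel_measurable borel" and b: "b > 0"
  shows "(\<integral>\<^sup>+x. A (sgn x) * ennreal (gauss_density (sqrt b *\<^sub>R x)) \<partial>lborel) =
     (\<integral>\<^sup>+x. A x \<partial>sphere_measure) * ennreal (1 / sqrt b ^ CARD('n))"
proof -
  define \<rho> where "\<rho> r = ennreal ((1 / sqrt (2 * pi)) ^ CARD('n) * exp (- b * r\<^sup>2 / 2))" for r :: real
  have \<rho>: "ennreal (gauss_density (sqrt b *\<^sub>R x)) = \<rho> (norm x)" for x :: "real ^ 'n"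
    using b by (simp add: gauss_density_def \<rho>_def power_mult_distrib)
  have [measurable]: "\<rho> \<in> borel_measurable borel" unfolding \<rho>_def[abs_def] by measurable
  show ?thesis
    using gauss_density_scaleR[OF b, of "0 :: real ^ 'n"]
    by (simp add: \<rho> nn_integral_polar)
qed

text \<open>Writing \<open>1 / r\<^sup>2 = \<integral> exp (- u r\<^sup>2 / 2) / 2 du\<close> reduces the claim to Gaussian integrals; the
  factor \<open>n - 2\<close> is the reason why the plane is treated separately.\<close>

lemma gauss_inverse_square_le:
  fixes A :: "real ^ 'n \<Rightarrow> ennreal"
  assumes [measurable]: "A \<in> borel_measurable borel" and cs: "c\<^sup>2 + s\<^sup>2 = (1::real)" and n: "CARD('n) \<ge> 3"
  shows "(\<integral>\<^sup>+z. A (sgn (fst z)) * ennreal (1 / (norm (c *\<^sub>R fst z - s *\<^sub>R snd z))\<^sup>2) \<partial>(gauss \<Otimes>\<^sub>M gauss))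
    \<le> (\<integral>\<^sup>+x. A x \<partial>sphere_measure) * ennreal (1 / (real CARD('n) - 2))"
proof -
  let ?E = "\<lambda>u x y. ennreal (exp (- u * (norm (c *\<^sub>R x - s *\<^sub>R y))\<^sup>2 / 2) / 2) * indicator {0..} u"
  let ?g = "\<lambda>x y. ennreal (gauss_density x * gauss_density (y :: real ^ 'n))"
  have "(\<integral>\<^sup>+z. A (sgn (fst z)) * ennreal (1 / (norm (c *\<^sub>R fst z - s *\<^sub>R snd z))\<^sup>2) \<partial>(gauss \<Otimes>\<^sub>M gauss))
     = (\<integral>\<^sup>+x. \<integral>\<^sup>+y. ?g x y * (A (sgn x) * ennreal (1 / (norm (c *\<^sub>R x - s *\<^sub>R y))\<^sup>2)) \<partial>lborel \<partial>lborel)"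
    by (subst nn_integral_gauss_pair) auto
  also have "\<dots> \<le> (\<integral>\<^sup>+x. \<integral>\<^sup>+y. ?g x y * (A (sgn x) * (\<integral>\<^sup>+u. ?E u x y \<partial>lborel)) \<partial>lborel \<partial>lborel)"
    by (intro nn_integral_mono mult_left_mono inverse_square_le_exp_integral) auto
  also have "\<dots> = (\<integral>\<^sup>+x. \<integral>\<^sup>+y. \<integral>\<^sup>+u. ?g x y * (A (sgn x) * ?E u x y) \<partial>lborel \<partial>lborel \<partial>lborel)"
    by (simp add: nn_integral_cmult)
  also have "\<dots> = (\<integral>\<^sup>+x. \<integral>\<^sup>+u. \<integral>\<^sup>+y. ?g x y * (A (sgn x) * ?E u x y) \<partial>lborel \<partial>lborel \<partial>lborel)"
    by (intro nn_integral_cong lborel_pair.Fubini') measurable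
  also have "\<dots> = (\<integral>\<^sup>+u. \<integral>\<^sup>+x. \<integral>\<^sup>+y. ?g x y * (A (sgn x) * ?E u x y) \<partial>lborel \<partial>lborel \<partial>lborel)"
    by (intro lborel_pair.Fubini') measurable
  also have "\<dots> = (\<integral>\<^sup>+u. (\<integral>\<^sup>+x. A x \<partial>sphere_measure) *
      (ennreal (1 / 2) * (ennreal (1 / sqrt (1 + u) ^ CARD('n)) * indicator {0..} u)) \<partial>lborel)"
  proof (rule nn_integral_cong)
    fix u :: real
    show "(\<integral>\<^sup>+x. \<integral>\<^sup>+y. ?g x y * (A (sgn x) * ?E u x y) \<partial>lborel \<partial>lborel) =
      (\<integral>\<^sup>+x. A x \<partial>sphere_measure) *
      (ennreal (1 / 2) * (ennreal (1 / sqrt (1 + u) ^ CARD('n)) * indicator {0..} u))"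
    proof (cases "u \<ge> 0")
      case u: True
      define a where "a = 1 + u * s\<^sup>2"
      define b where "b = (1 + u) / a"
      have a: "a > 0" using u by (simp add: a_def add_pos_nonneg)
      have b: "b > 0" using u a by (simp add: b_def)
      \<comment> \<open>In this form the \<open>y\<close>-integral is a shifted Gaussian whose value
        does not depend on \<open>x\<close>; afterwards the \<open>x\<close>-integral is
        polar.\<close>
      have "?g x y * (A (sgn x) * ?E u x y) = A (sgn x) * (ennreal (gauss_density (sqrt b *\<^sub>R x)) *
         (ennreal (gauss_density (sqrt a *\<^sub>R (y + (- (u * c * s / a)) *\<^sub>R x))) * ennreal (1/2)))" for x y :: "real ^ 'n"
      proof -
        have "?g x y * (A (sgn x) * ?E u x y) = A (sgn x) *
          ennreal (gauss_density x * gauss_density y * exp (- u * (norm (c *\<^sub>R x - s *\<^sub>R y))\<^sup>2 / 2) * (1/2))"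
          using u by (simp add: ennreal_mult[symmetric] less_imp_le[OF gauss_density_pos] mult.left_commute[of _ "A (sgn x)"])
        also have "\<dots> = A (sgn x) * ennreal (gauss_density (sqrt b *\<^sub>R x) *
         gauss_density (sqrt a *\<^sub>R (y + (- (u * c * s / a)) *\<^sub>R x)) * (1/2))"
          using gauss_complete_square[OF cs u, of x y] by (simp only: a_def b_def)
        finally show ?thesis
          by (simp only: mult.assoc ennreal_mult mult_nonneg_nonneg less_imp_le[OF gauss_density_pos]
              zero_le_divide_1_iff zero_le_numeral)
      qed
      then have "(\<integral>\<^sup>+x. \<integral>\<^sup>+y. ?g x y * (A (sgn x) * ?E u x y) \<partial>lborel \<partial>lborel) =
        (\<integral>\<^sup>+x. A (sgn x) * (ennreal (gauss_density (sqrt b *\<^sub>R x)) * (ennreal (1 / sqrt a ^ CARD('n)) * ennreal (1/2))) \<partial>lborel)"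
        using gauss_density_scaleR[OF a, of "- t" for t :: "real ^ 'n"]
        by (simp add: nn_integral_cmult nn_integral_multc)
      also have "\<dots> = (\<integral>\<^sup>+x. A (sgn x) * ennreal (gauss_density (sqrt b *\<^sub>R x)) \<partial>lborel) * (ennreal (1 / sqrt a ^ CARD('n)) * ennreal (1/2))"
        by (subst nn_integral_multc[symmetric]) (auto simp: mult.assoc)
      also have "\<dots> = (\<integral>\<^sup>+x. A x \<partial>sphere_measure) *
         (ennreal (1 / sqrt b ^ CARD('n)) * (ennreal (1 / sqrt a ^ CARD('n)) * ennreal (1/2)))"
        using b by (simp add: nn_integral_polar_scaled_gauss mult.assoc)
      also have "ennreal (1 / sqrt b ^ CARD('n)) * (ennreal (1 / sqrt a ^ CARD('n)) * ennreal (1/2)) =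
          ennreal (1 / 2) * (ennreal (1 / sqrt (1 + u) ^ CARD('n)) * indicator {0..} u)"
      proof -
        \<comment> \<open>Here the angle cancels: only 1 + u survives, so the bound is the same for
          every rotation.\<close>
        have "sqrt b * sqrt a = sqrt (1 + u)" using a by (simp add: b_def real_sqrt_divide)
        then have "1 / sqrt b ^ CARD('n) * (1 / sqrt a ^ CARD('n) * (1/2)) = 1 / 2 * (1 / sqrt (1 + u) ^ CARD('n))"
          by (simp add: power_mult_distrib[symmetric])
        moreover have "ennreal p * (ennreal q * ennreal (1 / 2)) = ennreal (p * (q * (1 / 2)))"
          "ennreal (1 / 2 * p) = ennreal (1 / 2) * ennreal p" if "p \<ge> 0" "q \<ge> 0" for p q :: real
          using that by (simp_all only: ennreal_mult mult_nonneg_nonneg zero_le_divide_1_iff zero_le_numeral)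
        moreover have "1 / sqrt b ^ CARD('n) \<ge> 0" "1 / sqrt a ^ CARD('n) \<ge> 0" "1 / sqrt (1 + u) ^ CARD('n) \<ge> 0"
          using a b u by simp_all
        ultimately have "ennreal (1 / sqrt b ^ CARD('n)) * (ennreal (1 / sqrt a ^ CARD('n)) * ennreal (1/2)) =
            ennreal (1 / 2) * ennreal (1 / sqrt (1 + u) ^ CARD('n))"
          by metis
        then show ?thesis using u by simp
      qed
      finally show ?thesis .
    qed simp
  qed
  also have "\<dots> = (\<integral>\<^sup>+x. A x \<partial>sphere_measure) * (ennreal (1 / 2) * ennreal (2 / (real CARD('n) - 2)))"
    by (simp add: nn_integral_cmult nn_integral_powr_tail[OF n])
  also have "ennreal (1 / 2) * ennreal (2 / (real CARD('n) - 2)) = ennreal (1 / (real CARD('n) - 2))"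
    using n by (subst ennreal_mult[symmetric]) auto
  finally show ?thesis .
qed

section \<open>Gaussian integration by parts\<close>

text \<open>Dominated convergence for the difference quotients along an arbitrary null sequence.
  Derivative and domination are required only almost everywhere, and the exceptional set of the
  domination may depend on \<open>t\<close>; this leaves room for functions that are singular at the
  origin.\<close>

lemma
  fixes f :: "real \<Rightarrow> 'a \<Rightarrow> real"
  assumes int: "\<And>t. \<bar>t\<bar> \<le> 1 \<Longrightarrow> integrable M (f t)" and [measurable]: "f' \<in> borel_measurable M"
    and deriv: "AE x in M. ((\<lambda>t. f t x) has_real_derivative f' x) (at 0)"
    and bound: "\<And>t. \<bar>t\<bar> \<le> 1 \<Longrightarrow> AE x in M. \<bar>f t x - f 0 x\<bar> \<le> \<bar>t\<bar> * w x"
    and w: "integrable M w"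
  shows integrable_deriv_dominated: "integrable M f'"
    and DERIV_integral_dominated: "((\<lambda>t. \<integral>x. f t x \<partial>M) has_real_derivative (\<integral>x. f' x \<partial>M)) (at 0)"
proof -
  have conv: "integrable M f' \<and> (\<lambda>k. ((\<integral>x. f (X k) x \<partial>M) - (\<integral>x. f 0 x \<partial>M)) / (X k)) \<longlonglongrightarrow> (\<integral>x. f' x \<partial>M)"
    if X: "X \<longlonglongrightarrow> 0" "\<And>k. X k \<noteq> 0" "\<And>k. \<bar>X k\<bar> \<le> 1" for X :: "nat \<Rightarrow> real"
  proof -
    have int': "integrable M (\<lambda>x. (f (X k) x - f 0 x) / X k)" for k
      using int[OF X(3)] int[of 0] by auto
    have lim: "AE x in M. (\<lambda>k. (f (X k) x - f 0 x) / X k) \<longlonglongrightarrow> f' x"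
      using deriv
    proof eventually_elim
      case (elim x)
      then have "((\<lambda>t. (f t x - f 0 x) / t) \<longlongrightarrow> f' x) (at 0)"
        by (simp add: has_field_derivative_iff)
      then show ?case
        by (rule filterlim_compose) (use X in \<open>simp add: filterlim_at\<close>)
    qed
    have bd: "AE x in M. norm ((f (X k) x - f 0 x) / X k) \<le> w x" for k
      using bound[OF X(3), of k] X(2)[of k] by (auto simp: field_simps)
    have "integrable M f'"
      by (rule integrable_dominated_convergence[OF _ _ w lim bd]) (use int' in auto)
    moreover have "(\<lambda>k. \<integral>x. (f (X k) x - f 0 x) / X k \<partial>M) \<longlonglongrightarrow> (\<integral>x. f' x \<partial>M)"
      by (rule integral_dominated_convergence[OF _ _ w lim bd]) (use int' in auto)
    moreover have "(\<integral>x. (f (X k) x - f 0 x) / X k \<partial>M) = ((\<integral>x. f (X k) x \<partial>M) - (\<integral>x. f 0 x \<partial>M)) / X k" for k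
      using int[OF X(3)] int[of 0] by simp
    ultimately show ?thesis by (simp only: simp_thms)
  qed
  have "(\<lambda>k. 1 / real (Suc k)) \<longlonglongrightarrow> 0" by (rule LIMSEQ_Suc) (rule lim_1_over_n)
  from conv[OF this] show "integrable M f'" by simp
  have "((\<lambda>t. ((\<integral>x. f t x \<partial>M) - (\<integral>x. f 0 x \<partial>M)) / t) \<longlongrightarrow> (\<integral>x. f' x \<partial>M)) (at 0)"
    unfolding tendsto_at_iff_sequentially comp_def
  proof (intro allI impI)
    fix X :: "nat \<Rightarrow> real" assume X: "\<forall>i. X i \<in> UNIV - {0}" "X \<longlonglongrightarrow> 0"
    then have "eventually (\<lambda>k. \<bar>X k\<bar> < 1) sequentially"
      by (auto dest!: tendstoD[of X 0 sequentially 1])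
    then obtain N where N: "\<And>k. k \<ge> N \<Longrightarrow> \<bar>X k\<bar> < 1" by (auto simp: eventually_sequentially)
    have "(\<lambda>k. X (k + N)) \<longlonglongrightarrow> 0" using X(2) by (rule LIMSEQ_ignore_initial_segment)
    with conv[of "\<lambda>k. X (k + N)"] X(1) N
    have "(\<lambda>k. ((\<integral>x. f (X (k + N)) x \<partial>M) - (\<integral>x. f 0 x \<partial>M)) / (X (k + N))) \<longlonglongrightarrow> (\<integral>x. f' x \<partial>M)"
      by (auto simp: less_imp_le)
    then show "(\<lambda>k. ((\<integral>x. f (X k) x \<partial>M) - (\<integral>x. f 0 x \<partial>M)) / X k) \<longlonglongrightarrow> (\<integral>x. f' x \<partial>M)"
      by (rule LIMSEQ_offset)
  qed
  then show "((\<lambda>t. \<integral>x. f t x \<partial>M) has_real_derivative (\<integral>x. f' x \<partial>M)) (at 0)"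
    by (simp add: has_field_derivative_iff)
qed

text \<open>A quarter stays below the half in the Gaussian exponent, and what remains is a wider
  Gaussian. This function then dominates everything of polynomial or exponential growth.\<close>

lemma integrable_gauss_exp_quarter:
  "integrable gauss (\<lambda>x::'a::euclidean_space. exp ((norm x)\<^sup>2 / 4))"
proof (rule integrableI_bounded)
  have eq: "gauss_density x * exp ((norm x)\<^sup>2 / 4) = gauss_density (sqrt (1/2) *\<^sub>R x)" for x :: 'a
    by (simp add: gauss_density_def power_mult_distrib power_divide mult_exp_exp)
  have "(\<integral>\<^sup>+x. ennreal (norm (exp ((norm (x::'a))\<^sup>2 / 4))) \<partial>gauss)
     = (\<integral>\<^sup>+x. ennreal (gauss_density (sqrt (1/2) *\<^sub>R (x + 0) :: 'a)) \<partial>lborel)"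
    by (subst nn_integral_gauss) (auto simp: eq[symmetric] ennreal_mult less_imp_le[OF gauss_density_pos])
  also have "\<dots> < \<infinity>" by (subst gauss_density_scaleR) auto
  finally show "(\<integral>\<^sup>+x. ennreal (norm (exp ((norm (x::'a))\<^sup>2 / 4))) \<partial>gauss) < \<infinity>" .
qed measurable

lemma integrable_gauss_norm: "integrable gauss (\<lambda>x::'a::euclidean_space. norm x)"
proof (rule Bochner_Integration.integrable_bound)
  show "integrable gauss (\<lambda>x::'a. 2 * exp ((norm x)\<^sup>2 / 4))"
    using integrable_gauss_exp_quarter by simp
  have "norm x \<le> 2 * exp ((norm x)\<^sup>2 / 4)" for x :: 'a
  proof -
    have "0 \<le> (norm x / 2 - 1)\<^sup>2" by simp
    then have "norm x \<le> 1 + (norm x)\<^sup>2 / 4" by (simp add: power2_eq_square field_simps)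
    also have "\<dots> \<le> exp ((norm x)\<^sup>2 / 4)" by (rule exp_ge_add_one_self)
    also have "\<dots> \<le> 2 * exp ((norm x)\<^sup>2 / 4)" by simp
    finally show ?thesis .
  qed
  then show "AE x in gauss. norm (norm (x::'a)) \<le> norm (2 * exp ((norm x)\<^sup>2 / 4))" by simp
qed measurable

text \<open>By Fubini the inverse distance is integrable in \<open>y\<close> for almost every
  \<open>x\<close>: this is the majorant for integrating by parts after a rotation. The inverse
  square moment suffices because 1 / a \<le> 1 + 1 / a^2.\<close>

lemma integrable_gauss_inverse_norm:
  fixes c s :: real
  assumes n: "CARD('n) \<ge> 3" and cs: "c\<^sup>2 + s\<^sup>2 = (1::real)"
  shows "integrable (gauss \<Otimes>\<^sub>M gauss) (\<lambda>z::(real^'n)\<times>(real^'n). 1 / norm (c *\<^sub>R fst z - s *\<^sub>R snd z))"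
proof (rule Bochner_Integration.integrable_bound)
  let ?G = "gauss \<Otimes>\<^sub>M gauss :: ((real^'n)\<times>(real^'n)) measure"
  let ?r = "\<lambda>z::(real^'n)\<times>(real^'n). norm (c *\<^sub>R fst z - s *\<^sub>R snd z)"
  interpret sphere: prob_space "sphere_measure :: (real ^ 'n) measure" by (rule prob_space_sphere_measure)
  have "integrable ?G (\<lambda>z. 1 / (?r z)\<^sup>2)"
  proof (rule integrableI_bounded)
    have "(\<integral>\<^sup>+z. ennreal (norm (1 / (?r z)\<^sup>2)) \<partial>?G) \<le> 1 * ennreal (1 / (real CARD('n) - 2))"
      using gauss_inverse_square_le[OF _ cs n, of "\<lambda>_. 1"] sphere.emeasure_space_1 by simp
    also have "\<dots> < \<infinity>" by (simp add: ennreal_mult_less_top)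
    finally show "(\<integral>\<^sup>+z. ennreal (norm (1 / (?r z)\<^sup>2)) \<partial>?G) < \<infinity>" .
  qed measurable
  then show "integrable ?G (\<lambda>z. 1 + 1 / (?r z)\<^sup>2)" by simp
  have "1 / a \<le> 1 + 1 / a\<^sup>2" if "a \<ge> 0" for a :: real
  proof -
    have "0 \<le> (1 / a - 1)\<^sup>2 + 1 / a" using that by simp
    then show ?thesis by (simp add: power2_eq_square algebra_simps)
  qed
  then show "AE z in ?G. norm (1 / ?r z) \<le> norm (1 + 1 / (?r z)\<^sup>2)" by simp
qed measurable

lemma exp_remainder_bound:
  fixes t :: real
  shows "\<bar>exp t - 1\<bar> \<le> \<bar>t\<bar> * exp \<bar>t\<bar>"
proof -
  have "\<bar>exp t - 1\<bar> \<le> exp \<bar>t\<bar> * \<bar>t - 0\<bar>"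
  proof (cases "t = 0")
    case False
    have "\<exists>z. \<bar>z\<bar> \<le> \<bar>t\<bar> \<and> exp t - exp 0 = t * exp z"
    proof (cases "t > 0")
      case True
      then obtain z where "0 < z" "z < t" "exp t - exp 0 = (t - 0) * exp z"
        using MVT2[of 0 t exp exp] by auto
      then show ?thesis by (intro exI[of _ z]) auto
    next
      case False
      with \<open>t \<noteq> 0\<close> obtain z where "t < z" "z < 0" "exp 0 - exp t = (0 - t) * exp z"
        using MVT2[of t 0 exp exp] by auto
      then show ?thesis by (intro exI[of _ z]) auto
    qed
    then obtain z where "\<bar>z\<bar> \<le> \<bar>t\<bar>" "exp t - 1 = t * exp z" by auto
    then show ?thesis by (simp add: abs_mult mult.commute mult_left_mono)
  qed simp
  then show ?thesis by (simp add: mult.commute)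
qed

text \<open>Cameron-Martin formula: the shift moves from the function onto the density.\<close>

lemma integral_gauss_translate:
  fixes u :: "'a::euclidean_space \<Rightarrow> real"
  assumes [measurable]: "u \<in> borel_measurable borel"
  shows "(\<integral>x. u (x + w) \<partial>gauss) = (\<integral>x. u x * exp (x \<bullet> w - (norm w)\<^sup>2 / 2) \<partial>gauss)"
proof -
  have *: "gauss_density (x - w) = gauss_density x * exp (x \<bullet> w - (norm w)\<^sup>2 / 2)" for x
  proof -
    have "(norm (x - w))\<^sup>2 = (norm x)\<^sup>2 - 2 * (x \<bullet> w) + (norm w)\<^sup>2"
      unfolding power2_norm_eq_inner by (simp add: inner_diff_left inner_diff_right inner_commute)
    then show ?thesis
      by (simp add: gauss_density_def mult_exp_exp field_simps)
  qed
  have "(\<integral>x. u (x + w) \<partial>gauss) = (\<integral>x. gauss_density x * u (x + w) \<partial>lborel)"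
    unfolding gauss_def by (subst integral_density) (auto simp: less_imp_le[OF gauss_density_pos])
  also have "\<dots> = (\<integral>x. gauss_density (x - w) * u x \<partial>distr lborel borel ((+) w))"
    by (subst integral_distr) (auto simp: add.commute)
  also have "\<dots> = (\<integral>x. gauss_density x * (u x * exp (x \<bullet> w - (norm w)\<^sup>2 / 2)) \<partial>lborel)"
    by (simp add: lborel_distr_plus * mult_ac)
  also have "\<dots> = (\<integral>x. u x * exp (x \<bullet> w - (norm w)\<^sup>2 / 2) \<partial>gauss)"
    unfolding gauss_def by (subst integral_density) (auto simp: less_imp_le[OF gauss_density_pos])
  finally show ?thesis .
qed

text \<open>Both integrals are the derivative at t = 0 of the Gaussian mean of u (x + t v): once by
  differentiating \<open>u\<close>, once after the Cameron-Martin formula has moved the shift onto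
  the density. Differentiability is asked for almost everywhere only, so \<open>u\<close> may be
  singular at the origin.\<close>

lemma gauss_integral_by_parts:
  fixes u :: "'a::euclidean_space \<Rightarrow> real" and U :: "'a \<Rightarrow> 'a"
  assumes [measurable]: "u \<in> borel_measurable borel" "U \<in> borel_measurable borel"
    and growth: "\<And>x. \<bar>u x\<bar> \<le> K * (1 + norm x)"
    and deriv: "AE x in gauss. (u has_derivative (\<lambda>h. U x \<bullet> h)) (at x)"
    and dom: "\<And>t. \<bar>t\<bar> \<le> 1 \<Longrightarrow> AE x in gauss. \<bar>u (x + t *\<^sub>R v) - u x\<bar> \<le> \<bar>t\<bar> * D x"
    and D: "integrable gauss D"
  shows "integrable gauss (\<lambda>x. U x \<bullet> v)" "(\<integral>x. U x \<bullet> v \<partial>gauss) = (\<integral>x. u x * (x \<bullet> v) \<partial>gauss)"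
proof -
  have K: "K \<ge> 0" using growth[of 0] by simp
  define L where "L = norm v"
  have L: "L \<ge> 0" by (simp add: L_def)
  \<comment> \<open>Bounding 1 + norm x by exp (norm x), and twice using exp of |x| L + L^2, gives
    the exponent |x| + 2 (|x| L + L^2). Since (|x| / 2 - (1 + 2 L))^2 is nonnegative, a quarter of
    |x|^2 plus the constants shown here suffices.\<close>
  define W where "W x = K * exp ((1 + 2 * L)\<^sup>2 + 2 * L\<^sup>2) * exp ((norm x)\<^sup>2 / 4)" for x :: 'a
  have W: "integrable gauss W" using integrable_gauss_exp_quarter[where 'a = 'a] by (simp add: W_def[abs_def])
  have u_int: "integrable gauss u"
    by (rule Bochner_Integration.integrable_bound[of _ "\<lambda>x. K * (1 + norm x)"])
       (use integrable_gauss_norm growth K in \<open>auto simp: intro!: AE_I2\<close>)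
  have bound: "\<bar>u x * exp (x \<bullet> (t *\<^sub>R v) - (norm (t *\<^sub>R v))\<^sup>2 / 2) - u x\<bar> \<le> \<bar>t\<bar> * W x"
    if t: "\<bar>t\<bar> \<le> 1" for t x
  proof -
    let ?e = "x \<bullet> (t *\<^sub>R v) - (norm (t *\<^sub>R v))\<^sup>2 / 2" and ?w = "norm x * L + L\<^sup>2"
    have w: "?w \<ge> 0" using L by simp
    have "\<bar>?e\<bar> \<le> \<bar>t\<bar> * \<bar>x \<bullet> v\<bar> + (\<bar>t\<bar> * L)\<^sup>2 / 2"
      by (simp add: abs_mult L_def order_trans[OF abs_triangle_ineq4])
    also have "\<dots> \<le> \<bar>t\<bar> * (norm x * L) + \<bar>t\<bar> * L\<^sup>2"
    proof (rule add_mono)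
      show "\<bar>t\<bar> * \<bar>x \<bullet> v\<bar> \<le> \<bar>t\<bar> * (norm x * L)"
        using Cauchy_Schwarz_ineq2[of x v] by (simp add: mult_left_mono L_def)
      have "\<bar>t\<bar> * \<bar>t\<bar> \<le> 2 * \<bar>t\<bar>" using mult_right_mono[OF t, of "\<bar>t\<bar>"] by simp
      then have "\<bar>t\<bar> * \<bar>t\<bar> * L\<^sup>2 \<le> 2 * \<bar>t\<bar> * L\<^sup>2" by (rule mult_right_mono) simp
      then show "(\<bar>t\<bar> * L)\<^sup>2 / 2 \<le> \<bar>t\<bar> * L\<^sup>2" by (simp add: power2_eq_square mult_ac)
    qed
    finally have e: "\<bar>?e\<bar> \<le> \<bar>t\<bar> * ?w" by (simp add: distrib_left)
    also have "\<dots> \<le> ?w" using mult_right_mono[OF t w] by simp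
    finally have e': "\<bar>?e\<bar> \<le> ?w" .
    have "\<bar>u x * exp ?e - u x\<bar> = \<bar>u x\<bar> * \<bar>exp ?e - 1\<bar>"
      by (simp add: abs_mult[symmetric] algebra_simps)
    also have "\<dots> \<le> (K * (1 + norm x)) * (\<bar>?e\<bar> * exp \<bar>?e\<bar>)"
      by (intro mult_mono growth exp_remainder_bound) (use K in auto)
    also have "\<dots> \<le> (K * exp (norm x)) * ((\<bar>t\<bar> * ?w) * exp ?w)"
      using K e e' w by (intro mult_mono mult_left_mono) (auto simp: exp_ge_add_one_self)
    also have "\<dots> \<le> (K * exp (norm x)) * ((\<bar>t\<bar> * exp ?w) * exp ?w)"
    proof -
      have "?w \<le> exp ?w" using exp_ge_add_one_self[of ?w] by linarith
      then show ?thesis using K by (intro mult_left_mono mult_right_mono) auto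
    qed
    also have "\<dots> = \<bar>t\<bar> * (K * exp (norm x + 2 * ?w))"
      by (simp add: exp_add mult_ac flip: exp_double)
         (simp add: exp_add[symmetric] mult_ac)
    also have "\<dots> \<le> \<bar>t\<bar> * (K * exp ((norm x)\<^sup>2 / 4 + (1 + 2 * L)\<^sup>2 + 2 * L\<^sup>2))"
    proof -
      have "0 \<le> (norm x / 2 - (1 + 2 * L))\<^sup>2" by simp
      then have "norm x * (1 + 2 * L) \<le> (norm x)\<^sup>2 / 4 + (1 + 2 * L)\<^sup>2"
        by (simp add: power2_eq_square algebra_simps)
      then have "norm x + 2 * ?w \<le> (norm x)\<^sup>2 / 4 + (1 + 2 * L)\<^sup>2 + 2 * L\<^sup>2"
        by (simp add: algebra_simps)
      then show ?thesis using K by (intro mult_left_mono) auto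
    qed
    also have "\<dots> = \<bar>t\<bar> * W x" by (simp add: W_def exp_add mult_ac)
    finally show ?thesis .
  qed
  define f where "f t x = u x * exp (x \<bullet> (t *\<^sub>R v) - (norm (t *\<^sub>R v))\<^sup>2 / 2)" for t x
  have [measurable]: "f t \<in> borel_measurable borel" for t unfolding f_def[abs_def] by measurable
  have f0: "f 0 x = u x" for x by (simp add: f_def)
  have f_int: "integrable gauss (f t)" if "\<bar>t\<bar> \<le> 1" for t
  proof -
    have "integrable gauss (\<lambda>x. f t x - u x)"
      by (rule Bochner_Integration.integrable_bound[of _ "\<lambda>x. \<bar>t\<bar> * W x"])
         (use W order_trans[OF bound[OF that] abs_ge_self] in \<open>auto simp: f_def intro!: AE_I2\<close>)
    from Bochner_Integration.integrable_add[OF this u_int] show ?thesis by simp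
  qed
  have 1: "((\<lambda>t. \<integral>x. f t x \<partial>gauss) has_real_derivative (\<integral>x. u x * (x \<bullet> v) \<partial>gauss)) (at 0)"
  proof (rule DERIV_integral_dominated[where w = W])
    show "AE x in gauss. ((\<lambda>t. f t x) has_real_derivative u x * (x \<bullet> v)) (at 0)"
      unfolding f_def by (auto intro!: AE_I2 derivative_eq_intros simp: power_mult_distrib)
    show "AE x in gauss. \<bar>f t x - f 0 x\<bar> \<le> \<bar>t\<bar> * W x" if "\<bar>t\<bar> \<le> 1" for t
      using bound[OF that] by (simp add: f_def)
  qed (use f_int W in auto)
  have tr: "(\<integral>x. f t x \<partial>gauss) = (\<integral>x. u (x + t *\<^sub>R v) \<partial>gauss)" for t
    by (simp add: integral_gauss_translate f_def)
  have u_int': "integrable gauss (\<lambda>x. u (x + t *\<^sub>R v))" for t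
  proof (rule Bochner_Integration.integrable_bound)
    show "integrable gauss (\<lambda>x. K * (1 + norm x + norm (t *\<^sub>R v)))" using integrable_gauss_norm by auto
    have "\<bar>u (x + t *\<^sub>R v)\<bar> \<le> K * (1 + norm x + norm (t *\<^sub>R v))" for x
      using growth[of "x + t *\<^sub>R v"] norm_triangle_ineq[of x "t *\<^sub>R v"] K
      by (smt (verit) mult_left_mono)
    then show "AE x in gauss. norm (u (x + t *\<^sub>R v)) \<le> norm (K * (1 + norm x + norm (t *\<^sub>R v)))"
      using K by (auto intro!: AE_I2)
  qed measurable
  have der: "AE x in gauss. ((\<lambda>t. u (x + t *\<^sub>R v)) has_real_derivative U x \<bullet> v) (at 0)"
    using deriv
  proof eventually_elim
    case (elim x)
    have "((\<lambda>t. x + t *\<^sub>R v) has_derivative (\<lambda>t. t *\<^sub>R v)) (at 0)"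
      by (auto intro!: derivative_eq_intros)
    from has_derivative_compose[OF this, of u "\<lambda>h. U x \<bullet> h"] elim
    have "((\<lambda>t. u (x + t *\<^sub>R v)) has_derivative (\<lambda>t. U x \<bullet> (t *\<^sub>R v))) (at 0)" by simp
    then show ?case by (simp add: has_field_derivative_def mult.commute[of _ "U x \<bullet> v"] mult_commute_abs)
  qed
  have 2: "((\<lambda>t. \<integral>x. u (x + t *\<^sub>R v) \<partial>gauss) has_real_derivative (\<integral>x. U x \<bullet> v \<partial>gauss)) (at 0)"
    by (rule DERIV_integral_dominated[where w = D]) (use u_int' der D dom in auto)
  show "integrable gauss (\<lambda>x. U x \<bullet> v)"
    by (rule integrable_deriv_dominated[where w = D and f = "\<lambda>t x. u (x + t *\<^sub>R v)"]) (use u_int' der D dom in auto)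
  show "(\<integral>x. U x \<bullet> v \<partial>gauss) = (\<integral>x. u x * (x \<bullet> v) \<partial>gauss)"
    using DERIV_unique[OF 2] 1 by (simp add: tr)
qed

section \<open>Radial extensions of functions on the sphere\<close>

interpretation sphere: prob_space "sphere_measure :: (real ^ 'n) measure"
  by (rule prob_space_sphere_measure)

lemma borel_measurable_sphere_measure:
  "f \<in> borel_measurable borel \<Longrightarrow> f \<in> borel_measurable sphere_measure"
  using measurable_cong_sets[OF sets_sphere_measure refl] measurable_restrict_space1 by blast

lemma integrable_sphere_continuous:
  fixes f :: "real ^ 'n \<Rightarrow> real"
  assumes f: "continuous_on (sphere 0 1) f"
  shows "integrable sphere_measure f"
proof -
  have "bounded (f ` sphere 0 1)" using f by (intro compact_imp_bounded compact_continuous_image) auto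
  then obtain B where "\<forall>y \<in> f ` sphere 0 1. norm y \<le> B" unfolding bounded_iff by blast
  then have B: "\<And>x. norm x = 1 \<Longrightarrow> norm (f x) \<le> B" by simp
  have "f \<in> borel_measurable sphere_measure"
    using borel_measurable_continuous_on_restrict[OF f] measurable_cong_sets[OF sets_sphere_measure refl]
    by blast
  then show ?thesis
    by (rule sphere.integrable_const_bound[rotated]) (use B in \<open>auto intro!: AE_I2\<close>)
qed

text \<open>The direction of a Gaussian vector is uniformly distributed; all Gaussian computations
  reach the sphere through this identity.\<close>

lemma nn_integral_gauss_sgn:
  fixes A :: "real ^ 'n \<Rightarrow> ennreal"
  assumes "A \<in> borel_measurable borel"
  shows "(\<integral>\<^sup>+x. A (sgn x) \<partial>gauss) = (\<integral>\<^sup>+x. A x \<partial>sphere_measure)"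
  using nn_integral_polar_scaled_gauss[OF assms, of 1] assms
  by (subst nn_integral_gauss) (auto simp: mult.commute)

lemma
  fixes A :: "real ^ 'n \<Rightarrow> real"
  assumes A [measurable]: "A \<in> borel_measurable borel" and int: "integrable sphere_measure A"
  shows integrable_gauss_sgn: "integrable gauss (\<lambda>x. A (sgn x))"
    and integral_gauss_sgn: "(\<integral>x. A (sgn x) \<partial>gauss) = (\<integral>x. A x \<partial>sphere_measure)"
proof -
  show 1: "integrable gauss (\<lambda>x. A (sgn x))"
    using int nn_integral_gauss_sgn[of "\<lambda>x. ennreal (norm (A x))"]
    by (auto simp: integrable_iff_bounded)
  show "(\<integral>x. A (sgn x) \<partial>gauss) = (\<integral>x. A x \<partial>sphere_measure)"
    unfolding real_lebesgue_integral_def[OF 1] real_lebesgue_integral_def[OF int]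
    using nn_integral_gauss_sgn[of "\<lambda>x. ennreal (A x)"] nn_integral_gauss_sgn[of "\<lambda>x. ennreal (- A x)"]
    by simp
qed

text \<open>The gradient is an explicit argument so that the rules of calculus act on pairs. Nothing
  is demanded of either function at the origin.\<close>

definition C1_punctured :: "('a::euclidean_space \<Rightarrow> real) \<Rightarrow> ('a \<Rightarrow> 'a) \<Rightarrow> bool" where
  "C1_punctured g g' \<longleftrightarrow>
     (\<forall>x. x \<noteq> 0 \<longrightarrow> (g has_derivative (\<lambda>h. g' x \<bullet> h)) (at x)) \<and> continuous_on (- {0}) g'"

lemma C1_puncturedD: "C1_punctured g g' \<Longrightarrow> x \<noteq> 0 \<Longrightarrow> (g has_derivative (\<lambda>h. g' x \<bullet> h)) (at x)"
  by (simp add: C1_punctured_def)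

lemma C1_punctured_continuous:
  assumes "C1_punctured g g'"
  shows "continuous_on (- {0}) g" "continuous_on (- {0}) g'"
proof -
  show "continuous_on (- {0}) g"
    by (intro continuous_at_imp_continuous_on ballI has_derivative_continuous[OF C1_puncturedD[OF assms]]) auto
qed (use assms in \<open>simp add: C1_punctured_def\<close>)

lemma borel_measurable_punctured:
  fixes f :: "'a::euclidean_space \<Rightarrow> 'b::topological_space"
  shows "continuous_on (- {0}) f \<Longrightarrow> f \<in> borel_measurable borel"
  by (rule borel_measurable_continuous_countable_exceptions[of "{0}"]) auto

lemma sphere_subset_punctured: "sphere 0 1 \<subseteq> - {0 :: 'a::real_normed_vector}"
  by auto

lemma sgn_in_sphere: "x \<noteq> 0 \<Longrightarrow> sgn x \<in> sphere (0 :: 'a::real_normed_vector) 1"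
  by (simp add: norm_sgn)

lemma bounded_on_sphere:
  fixes f :: "'a::euclidean_space \<Rightarrow> 'b::real_normed_vector"
  assumes "continuous_on (- {0}) f"
  obtains B where "B \<ge> 0" "\<And>x. norm (f (sgn x)) \<le> B"
proof -
  have "compact (f ` sphere 0 1)"
    by (intro compact_continuous_image continuous_on_subset[OF assms] sphere_subset_punctured) auto
  then have "bounded (f ` sphere 0 1)" by (rule compact_imp_bounded)
  then obtain B where "\<forall>y \<in> f ` sphere 0 1. norm y \<le> B" unfolding bounded_iff by blast
  then have B: "\<And>x. x \<in> sphere 0 1 \<Longrightarrow> norm (f x) \<le> B" by blast
  \<comment> \<open>\<open>sgn 0 = 0\<close> lies off the sphere, so the value of \<open>f\<close>
    at 0 has to enter the bound.\<close>
  have "norm (f (sgn x)) \<le> max (norm (f 0)) B" for x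
    by (cases "x = 0") (simp_all add: le_max_iff_disj B sgn_in_sphere del: mem_sphere mem_sphere_0)
  then show ?thesis by (intro that[of "max (norm (f 0)) B"]) (simp_all add: le_max_iff_disj)
qed

text \<open>The tangential part of \<open>g'\<close> at the direction of \<open>x\<close>, divided
  by the distance to the origin: the gradient of the 0-homogeneous extension of
  \<open>g\<close>.\<close>

definition radial_grad :: "('a::euclidean_space \<Rightarrow> 'a) \<Rightarrow> 'a \<Rightarrow> 'a" where
  "radial_grad g' x = (1 / norm x) *\<^sub>R (g' (sgn x) - (g' (sgn x) \<bullet> sgn x) *\<^sub>R sgn x)"

lemma has_derivative_sgn:
  assumes x: "(x :: 'a::euclidean_space) \<noteq> 0"
  shows "(sgn has_derivative (\<lambda>h. (1 / norm x) *\<^sub>R (h - (sgn x \<bullet> h) *\<^sub>R sgn x))) (at x)"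
proof -
  have "((\<lambda>x::'a. inverse (norm x)) has_derivative
     (\<lambda>h. - (inverse (norm x) * (sgn x \<bullet> h) * inverse (norm x)))) (at x)"
    using x GDERIV_norm[OF x] by (intro Deriv.has_derivative_inverse) (auto simp: gderiv_def inner_commute)
  from has_derivative_scaleR[OF this has_derivative_ident]
  have "((\<lambda>x::'a. inverse (norm x) *\<^sub>R x) has_derivative
     (\<lambda>h. inverse (norm x) *\<^sub>R h + (- (inverse (norm x) * (sgn x \<bullet> h) * inverse (norm x))) *\<^sub>R x)) (at x)"
    .
  also have "(\<lambda>h. inverse (norm x) *\<^sub>R h + (- (inverse (norm x) * (sgn x \<bullet> h) * inverse (norm x))) *\<^sub>R x) =
    (\<lambda>h. (1 / norm x) *\<^sub>R (h - (sgn x \<bullet> h) *\<^sub>R sgn x))"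
    by (simp add: fun_eq_iff sgn_div_norm algebra_simps divide_inverse)
  finally show ?thesis by (simp add: sgn_div_norm[abs_def])
qed

lemma radial_ext_has_derivative:
  assumes g: "C1_punctured g g'" and x: "x \<noteq> 0"
  shows "((\<lambda>x. g (sgn x)) has_derivative (\<lambda>h. radial_grad g' x \<bullet> h)) (at x)"
proof -
  have "sgn x \<noteq> 0" using x by (simp add: sgn_zero_iff)
  from has_derivative_compose[OF has_derivative_sgn[OF x] C1_puncturedD[OF g this]]
  show ?thesis
    by (simp add: radial_grad_def inner_diff_right inner_diff_left mult.commute inner_commute[of "sgn x"])
qed

lemma norm_radial_grad_le: "norm (radial_grad g' x) \<le> norm (g' (sgn x)) / norm x"
proof (cases "x = 0")
  case False
  let ?w = "g' (sgn x)" and ?e = "sgn x"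
  have e: "?e \<bullet> ?e = 1" using False by (simp add: dot_square_norm norm_sgn)
  have "(norm (?w - (?w \<bullet> ?e) *\<^sub>R ?e))\<^sup>2 = (norm ?w)\<^sup>2 - (?w \<bullet> ?e)\<^sup>2"
    unfolding power2_norm_eq_inner
    unfolding inner_diff_left inner_diff_right inner_scaleR_left inner_scaleR_right e
    by (simp add: inner_commute[of ?e] power2_eq_square)
  then have "(norm (?w - (?w \<bullet> ?e) *\<^sub>R ?e))\<^sup>2 \<le> (norm ?w)\<^sup>2" by simp
  then have "norm (?w - (?w \<bullet> ?e) *\<^sub>R ?e) \<le> norm ?w" by (rule power2_le_imp_le) simp
  then show ?thesis by (simp add: radial_grad_def divide_right_mono)
qed (simp add: radial_grad_def)

lemma continuous_on_radial_grad:
  assumes "continuous_on (- {0}) g'"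
  shows "continuous_on (- {0}) (radial_grad g')"
proof -
  have s: "continuous_on (- {0}) (sgn :: 'a \<Rightarrow> 'a)"
    by (intro continuous_at_imp_continuous_on ballI has_derivative_continuous[OF has_derivative_sgn]) auto
  have "continuous_on (- {0}) (\<lambda>x. g' (sgn x))"
    by (rule continuous_on_compose2[OF assms s]) (auto simp: sgn_zero_iff)
  with s show ?thesis unfolding radial_grad_def[abs_def]
    by (auto intro!: continuous_intros)
qed

text \<open>If \<open>y\<close> is within half of \<open>norm x\<close>, the segment keeps at least
  that distance from the origin and the mean value theorem applies. Otherwise
  \<open>norm (y - x) / norm x\<close> exceeds 1/2 and the total oscillation is absorbed. Only
  \<open>x\<close> has to be nonzero, which is what a fixed base point with arbitrary increments
  requires.\<close>

lemma radial_ext_lipschitz: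
  assumes g: "C1_punctured g g'"
  obtains C where "C \<ge> 0" "\<And>x y. x \<noteq> 0 \<Longrightarrow> \<bar>g (sgn y) - g (sgn x)\<bar> \<le> C * norm (y - x) / norm x"
proof -
  obtain B where B: "B \<ge> 0" "\<And>x. norm (g (sgn x)) \<le> B"
    using bounded_on_sphere[OF C1_punctured_continuous(1)[OF g]] by blast
  obtain L where L: "L \<ge> 0" "\<And>x. norm (g' (sgn x)) \<le> L"
    using bounded_on_sphere[OF C1_punctured_continuous(2)[OF g]] by blast
  have "\<bar>g (sgn y) - g (sgn x)\<bar> \<le> (4 * B + 2 * L) * norm (y - x) / norm x" if x: "x \<noteq> 0" for x y
  proof (cases "norm (y - x) \<le> norm x / 2")
    case True
    have seg: "norm z \<ge> norm x / 2" if "z \<in> closed_segment x y" for z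
    proof -
      have "norm (z - x) \<le> norm (y - x)" using segment_bound1[OF that] .
      with True norm_triangle_ineq2[of x "x - z"] show ?thesis
        by (simp add: norm_minus_commute)
    qed
    have "norm (g (sgn y) - g (sgn x)) \<le> (2 * L / norm x) * norm (y - x)"
    proof (rule differentiable_bound[where f = "\<lambda>x. g (sgn x)" and f' = "\<lambda>x h. radial_grad g' x \<bullet> h" and S = "closed_segment x y"])
      fix z assume z: "z \<in> closed_segment x y"
      then have z0: "z \<noteq> 0" using seg[OF z] x by auto
      show "((\<lambda>x. g (sgn x)) has_derivative (\<lambda>h. radial_grad g' z \<bullet> h)) (at z within closed_segment x y)"
        by (rule has_derivative_at_withinI[OF radial_ext_has_derivative[OF g z0]])
      have "norm (radial_grad g' z) \<le> L / norm z"
        using norm_radial_grad_le[of g' z] L(2)[of z] by (meson divide_right_mono norm_ge_zero order_trans)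
      also have "\<dots> \<le> L / (norm x / 2)"
        using seg[OF z] x L z0 by (intro divide_left_mono) (auto simp: zero_less_mult_iff)
      finally have "norm (radial_grad g' z) \<le> 2 * L / norm x" by (simp add: mult.commute)
      moreover have "onorm (\<lambda>h. radial_grad g' z \<bullet> h) \<le> norm (radial_grad g' z)"
        by (rule onorm_le) (auto simp: Cauchy_Schwarz_ineq2)
      ultimately show "onorm (\<lambda>h. radial_grad g' z \<bullet> h) \<le> 2 * L / norm x" by simp
    qed auto
    also have "\<dots> \<le> (4 * B + 2 * L) / norm x * norm (y - x)"
      using B by (intro mult_right_mono divide_right_mono) auto
    finally show ?thesis by simp
  next
    case False
    have "\<bar>g (sgn y) - g (sgn x)\<bar> \<le> 2 * B"
      using B(2)[of x] B(2)[of y] abs_triangle_ineq4[of "g (sgn y)" "g (sgn x)"] by simp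
    also have "\<dots> \<le> (4 * B) * (norm (y - x) / norm x)"
    proof -
      have "1 / 2 \<le> norm (y - x) / norm x" using False x by (simp add: field_simps)
      from mult_left_mono[OF this, of "4 * B"] B show ?thesis by simp
    qed
    also have "\<dots> \<le> (4 * B + 2 * L) * (norm (y - x) / norm x)"
      using L by (intro mult_right_mono) auto
    finally show ?thesis by simp
  qed
  then show ?thesis using that[of "4 * B + 2 * L"] B L by simp
qed

section \<open>A covariance inequality on the sphere\<close>

lemma measure_gauss_UNIV [simp]: "measure gauss UNIV = 1"
  using gauss.prob_space by simp

lemma AE_gauss_neq: "AE x in gauss. x \<noteq> (a::'a::euclidean_space)"
  unfolding gauss_def by (subst AE_density) (auto intro: AE_mp[OF AE_lborel_singleton[of a]])

text \<open>By 1 / (a b) \<le> (1 / a^2 + 1 / b^2) / 2 there remain four integrals, in each of which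
  one of the two rotated vectors supplies the direction and one of them the inverse square. Rotating
  the directional vector into the first coordinate brings every one of them under the inverse square
  bound.\<close>

lemma gauss_pair_weighted_le:
  fixes \<alpha> \<beta> :: "real ^ 'n \<Rightarrow> ennreal" and c s :: real
  assumes [measurable]: "\<alpha> \<in> borel_measurable borel" "\<beta> \<in> borel_measurable borel"
    and cs: "c\<^sup>2 + s\<^sup>2 = 1" and n: "CARD('n) \<ge> 3"
  shows "(\<integral>\<^sup>+z. (\<alpha> (sgn (c *\<^sub>R fst z - s *\<^sub>R snd z)) + \<beta> (sgn (fst z))) *
      ennreal (1 / (norm (c *\<^sub>R fst z - s *\<^sub>R snd z) * norm (fst z))) \<partial>(gauss \<Otimes>\<^sub>M gauss)) \<le>
    ((\<integral>\<^sup>+x. \<alpha> x \<partial>sphere_measure) + (\<integral>\<^sup>+x. \<beta> x \<partial>sphere_measure)) * ennreal (1 / (real CARD('n) - 2))"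
proof -
  let ?G = "gauss \<Otimes>\<^sub>M gauss :: ((real^'n) \<times> (real^'n)) measure"
  let ?N = "ennreal (1 / (real CARD('n) - 2))"
  let ?a = "\<lambda>z. \<alpha> (sgn (c *\<^sub>R fst z - s *\<^sub>R snd z))" and ?b = "\<lambda>z. \<beta> (sgn (fst z :: real ^ 'n))"
  let ?r = "\<lambda>z. ennreal (1 / (norm (c *\<^sub>R fst z - s *\<^sub>R snd z :: real ^ 'n))\<^sup>2)"
  let ?q = "\<lambda>z. ennreal (1 / (norm (fst z :: real ^ 'n))\<^sup>2)"
  have bq: "(\<integral>\<^sup>+z. ?b z * ?q z \<partial>?G) \<le> (\<integral>\<^sup>+x. \<beta> x \<partial>sphere_measure) * ?N"
    using gauss_inverse_square_le[of \<beta> 1 0] n by simp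
  have br: "(\<integral>\<^sup>+z. ?b z * ?r z \<partial>?G) \<le> (\<integral>\<^sup>+x. \<beta> x \<partial>sphere_measure) * ?N"
    by (rule gauss_inverse_square_le[OF _ cs n]) measurable
  have cs': "c\<^sup>2 + (- s)\<^sup>2 = 1" using cs by simp
  have rot: "(\<integral>\<^sup>+z. f (c *\<^sub>R fst z - s *\<^sub>R snd z, c *\<^sub>R snd z + s *\<^sub>R fst z) \<partial>?G) = (\<integral>\<^sup>+z. f z \<partial>?G)"
    if "f \<in> borel_measurable (borel \<Otimes>\<^sub>M borel)" for f
    using nn_integral_gauss_rotation[OF that cs'] by simp
  \<comment> \<open>Expresses \<open>fst z\<close> through the rotated pair, for the mixed term with
    direction \<open>?a\<close> and weight \<open>?q\<close>.\<close>
  have unrot: "c *\<^sub>R (c *\<^sub>R x - s *\<^sub>R y) + s *\<^sub>R (c *\<^sub>R y + s *\<^sub>R x) = x" for x y :: "real ^ 'n"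
  proof -
    have "c *\<^sub>R (c *\<^sub>R x - s *\<^sub>R y) + s *\<^sub>R (c *\<^sub>R y + s *\<^sub>R x) = (c\<^sup>2 + s\<^sup>2) *\<^sub>R x"
      by (simp add: algebra_simps power2_eq_square)
    then show ?thesis using cs by simp
  qed
  have ar: "(\<integral>\<^sup>+z. ?a z * ?r z \<partial>?G) \<le> (\<integral>\<^sup>+x. \<alpha> x \<partial>sphere_measure) * ?N"
    using rot[of "\<lambda>z. \<alpha> (sgn (fst z)) * ennreal (1 / (norm (fst z))\<^sup>2)"] gauss_inverse_square_le[of \<alpha> 1 0] n by simp
  have aq: "(\<integral>\<^sup>+z. ?a z * ?q z \<partial>?G) \<le> (\<integral>\<^sup>+x. \<alpha> x \<partial>sphere_measure) * ?N"
    using rot[of "\<lambda>z. \<alpha> (sgn (fst z)) * ennreal (1 / (norm (c *\<^sub>R fst z + s *\<^sub>R snd z))\<^sup>2)"]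
      gauss_inverse_square_le[OF _ cs' n, of \<alpha>] by (simp add: unrot)
  have "ennreal (1 / (a * b)) \<le> ennreal (1 / 2) * (ennreal (1 / a\<^sup>2) + ennreal (1 / b\<^sup>2))" if "a \<ge> 0" "b \<ge> 0" for a b :: real
  proof -
    have "0 \<le> (1 / a - 1 / b)\<^sup>2" by simp
    then have "1 / (a * b) \<le> 1 / 2 * (1 / a\<^sup>2 + 1 / b\<^sup>2)"
      by (simp add: power2_diff power_divide)
    then show ?thesis
      by (subst ennreal_plus[symmetric], simp, simp, subst ennreal_mult[symmetric], simp, simp) (rule ennreal_leI)
  qed
  then have "(\<integral>\<^sup>+z. (?a z + ?b z) * ennreal (1 / (norm (c *\<^sub>R fst z - s *\<^sub>R snd z) * norm (fst z))) \<partial>?G)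
    \<le> (\<integral>\<^sup>+z. (?a z + ?b z) * (ennreal (1 / 2) * (?r z + ?q z)) \<partial>?G)"
    by (intro nn_integral_mono mult_left_mono) auto
  also have "\<dots> = (\<integral>\<^sup>+z. ennreal (1 / 2) * ((?a z * ?r z + ?a z * ?q z) + (?b z * ?r z + ?b z * ?q z)) \<partial>?G)"
    by (intro nn_integral_cong) (simp add: algebra_simps)
  also have "\<dots> = ennreal (1 / 2) * (((\<integral>\<^sup>+z. ?a z * ?r z \<partial>?G) + (\<integral>\<^sup>+z. ?a z * ?q z \<partial>?G)) +
      ((\<integral>\<^sup>+z. ?b z * ?r z \<partial>?G) + (\<integral>\<^sup>+z. ?b z * ?q z \<partial>?G)))"
    by (subst nn_integral_cmult, measurable) (simp add: nn_integral_add)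
  also have "\<dots> \<le> ennreal (1 / 2) * (((\<integral>\<^sup>+x. \<alpha> x \<partial>sphere_measure) * ?N + (\<integral>\<^sup>+x. \<alpha> x \<partial>sphere_measure) * ?N) +
      ((\<integral>\<^sup>+x. \<beta> x \<partial>sphere_measure) * ?N + (\<integral>\<^sup>+x. \<beta> x \<partial>sphere_measure) * ?N))"
    by (intro mult_left_mono add_mono ar aq br bq) simp
  also have "\<dots> = (ennreal (1 / 2) * 2) * ((\<integral>\<^sup>+x. \<alpha> x \<partial>sphere_measure) * ?N + (\<integral>\<^sup>+x. \<beta> x \<partial>sphere_measure) * ?N)"
    by (simp only: mult_2[symmetric] distrib_left[symmetric] mult.assoc)
  also have "ennreal (1 / 2) * 2 = 1"
    by (metis ennreal_1 ennreal_mult ennreal_numeral divide_self half_gt_zero_iff less_eq_real_def nonzero_eq_divide_eq zero_less_one zero_le_numeral zero_neq_numeral)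
  finally show ?thesis by (simp add: distrib_right)
qed

text \<open>The two gradients are evaluated at different points, whose joint law depends on the
  angle. A bound that separates into \<open>\<alpha> x + \<beta> y\<close> integrates to spherical
  means at every angle; how to split the product is left to each application.\<close>

lemma sphere_covariance_le:
  fixes g h \<alpha> \<beta> :: "real ^ 'n \<Rightarrow> real"
  assumes n: "CARD('n) \<ge> 3"
    and g: "C1_punctured g g'" and h: "C1_punctured h h'"
    and \<alpha>: "continuous_on (- {0}) \<alpha>" "\<And>x. \<alpha> x \<ge> 0" and \<beta>: "continuous_on (- {0}) \<beta>" "\<And>x. \<beta> x \<ge> 0"
    and dom: "\<And>x y. norm x = 1 \<Longrightarrow> norm y = 1 \<Longrightarrow> norm (g' x) * norm (h' y) \<le> \<alpha> x + \<beta> y"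
  shows "(\<integral>x. g x * h x \<partial>sphere_measure) - (\<integral>x. g x \<partial>sphere_measure) * (\<integral>x. h x \<partial>sphere_measure) \<le>
    ((\<integral>x. \<alpha> x \<partial>sphere_measure) + (\<integral>x. \<beta> x \<partial>sphere_measure)) / (real CARD('n) - 2)"
proof -
  let ?G = "gauss \<Otimes>\<^sub>M gauss :: ((real^'n) \<times> (real^'n)) measure"
  have gc: "continuous_on (- {0}) g" "continuous_on (- {0}) g'" and hc: "continuous_on (- {0}) h" "continuous_on (- {0}) h'"
    using C1_punctured_continuous g h by auto
  have [measurable]: "g \<in> borel_measurable borel" "g' \<in> borel_measurable borel" "h \<in> borel_measurable borel"
      "h' \<in> borel_measurable borel" "\<alpha> \<in> borel_measurable borel" "\<beta> \<in> borel_measurable borel"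
    using gc hc \<alpha>(1) \<beta>(1) by (auto intro: borel_measurable_punctured)
  have [measurable]: "radial_grad g' \<in> borel_measurable borel" "radial_grad h' \<in> borel_measurable borel"
    using gc hc by (auto intro: borel_measurable_punctured continuous_on_radial_grad)
  have cont_int: "integrable sphere_measure f" if "continuous_on (- {0}) f" for f :: "real ^ 'n \<Rightarrow> real"
    using that by (intro integrable_sphere_continuous continuous_on_subset[OF that sphere_subset_punctured])
  define F where "F x = g (sgn x)" for x
  define H where "H x = h (sgn x)" for x
  define F' where "F' = radial_grad g'"
  define H' where "H' = radial_grad h'"
  have [measurable]: "F \<in> borel_measurable borel" "H \<in> borel_measurable borel" "F' \<in> borel_measurable borel" "H' \<in> borel_measurable borel"
    by (auto simp: F_def[abs_def] H_def[abs_def] F'_def H'_def)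
  have F': "(F has_derivative (\<lambda>h. F' x \<bullet> h)) (at x)" if "x \<noteq> 0" for x
    using radial_ext_has_derivative[OF g that] by (simp add: F_def[abs_def] F'_def)
  have H': "(H has_derivative (\<lambda>h. H' x \<bullet> h)) (at x)" if "x \<noteq> 0" for x
    using radial_ext_has_derivative[OF h that] by (simp add: H_def[abs_def] H'_def)
  obtain B where B: "B \<ge> 0" "\<And>x. norm (F x) \<le> B"
    using bounded_on_sphere[OF gc(1)] by (auto simp: F_def)
  obtain BH where BH: "BH \<ge> 0" "\<And>x. norm (H x) \<le> BH"
    using bounded_on_sphere[OF hc(1)] by (auto simp: H_def)
  obtain CF where CF: "CF \<ge> 0" "\<And>x y. x \<noteq> 0 \<Longrightarrow> \<bar>F y - F x\<bar> \<le> CF * norm (y - x) / norm x"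
    using radial_ext_lipschitz[OF g] by (auto simp: F_def)
  obtain CH where CH: "CH \<ge> 0" "\<And>x y. x \<noteq> 0 \<Longrightarrow> \<bar>H y - H x\<bar> \<le> CH * norm (y - x) / norm x"
    using radial_ext_lipschitz[OF h] by (auto simp: H_def)
  define K where "K = ((\<integral>x. \<alpha> x \<partial>sphere_measure) + (\<integral>x. \<beta> x \<partial>sphere_measure)) / (real CARD('n) - 2)"
  have K0: "K \<ge> 0" using \<alpha>(2) \<beta>(2) n by (simp add: K_def)
  \<comment> \<open>Interpolates between the mean of the product at angle 0 and the product of the
    means at pi / 2, where the two arguments are independent.\<close>
  define \<Phi> where "\<Phi> s = (\<integral>z. F (fst z) * H (cos s *\<^sub>R fst z + sin s *\<^sub>R snd z) \<partial>?G)" for s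

  have norm_pair: "\<bar>F a * H b\<bar> \<le> B * BH" for a b
    using B BH by (auto simp: abs_mult intro!: mult_mono)
  have AEz: "AE z in ?G. fst z \<noteq> 0"
  proof (rule gauss_pair.AE_pair_measure)
    show "{z \<in> space ?G. fst z \<noteq> 0} \<in> sets ?G" by measurable
    show "AE x::real^'n in gauss. AE y::real^'n in gauss. fst (x, y) \<noteq> 0" using AE_gauss_neq[of "0::real^'n"] by simp
  qed
  have deriv: "\<exists>D. (\<Phi> has_real_derivative D) (at s) \<and> D \<ge> - (sin s * K)"
    if s: "0 \<le> s" "s \<le> pi / 2" for s
  proof -
    have cs: "(cos s)\<^sup>2 + (sin s)\<^sup>2 = 1" by simp
    have s0: "sin s \<ge> 0" using s by (intro sin_ge_zero) auto
    define X where "X z = cos s *\<^sub>R fst z - sin s *\<^sub>R snd z" for z :: "(real^'n) \<times> (real^'n)"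
    have [measurable]: "X \<in> borel_measurable (borel \<Otimes>\<^sub>M borel)" unfolding X_def[abs_def] by measurable
    define f where "f t z = F (X z) * H (cos t *\<^sub>R fst z + sin t *\<^sub>R snd z)" for t z
    have [measurable]: "f t \<in> borel_measurable (borel \<Otimes>\<^sub>M borel)" for t unfolding f_def[abs_def] by measurable
    \<comment> \<open>Rotation invariance moves the base angle from \<open>H\<close> to
      \<open>F\<close>. The derivative at \<open>s\<close> becomes one at t = 0, where
      \<open>H\<close> depends on \<open>fst z\<close> alone and \<open>snd z\<close> enters its
      derivative linearly.\<close>
    have shift: "\<Phi> (s + t) = (\<integral>z. f t z \<partial>?G)" for t
    proof -
      have "(\<integral>z. f t z \<partial>?G) = (\<integral>z. f t z \<partial>distr ?G (borel \<Otimes>\<^sub>M borel)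
         (\<lambda>z. (cos s *\<^sub>R fst z + sin s *\<^sub>R snd z, cos s *\<^sub>R snd z - sin s *\<^sub>R fst z)))"
        by (simp only: gauss_rotation[OF cs])
      also have "\<dots> = (\<integral>z. f t (cos s *\<^sub>R fst z + sin s *\<^sub>R snd z, cos s *\<^sub>R snd z - sin s *\<^sub>R fst z) \<partial>?G)"
        by (rule integral_distr) measurable
      also have "\<dots> = \<Phi> (s + t)"
      proof -
        have "cos s *\<^sub>R (cos s *\<^sub>R x + sin s *\<^sub>R y) - sin s *\<^sub>R (cos s *\<^sub>R y - sin s *\<^sub>R x) = x" for x y :: "real ^ 'n"
        proof -
          have "cos s *\<^sub>R (cos s *\<^sub>R x + sin s *\<^sub>R y) - sin s *\<^sub>R (cos s *\<^sub>R y - sin s *\<^sub>R x) = ((cos s)\<^sup>2 + (sin s)\<^sup>2) *\<^sub>R x"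
            by (simp add: algebra_simps power2_eq_square
                del: sin_cos_squared_add sin_cos_squared_add2 sin_cos_squared_add3)
          then show ?thesis by simp
        qed
        moreover have "cos t *\<^sub>R (cos s *\<^sub>R x + sin s *\<^sub>R y) + sin t *\<^sub>R (cos s *\<^sub>R y - sin s *\<^sub>R x) =
            cos (s + t) *\<^sub>R x + sin (s + t) *\<^sub>R y" for x y :: "real ^ 'n"
          by (simp add: cos_add sin_add algebra_simps)
        ultimately show ?thesis by (simp add: f_def X_def \<Phi>_def)
      qed
      finally show ?thesis ..
    qed
    define f' where "f' z = F (X z) * (H' (fst z) \<bullet> snd z)" for z
    have [measurable]: "f' \<in> borel_measurable (borel \<Otimes>\<^sub>M borel)" unfolding f'_def[abs_def] by measurable
    \<comment> \<open>The point moves by at most |t| (norm x + norm y), and the Lipschitz bound for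
      \<open>H\<close> divides this by \<open>norm x\<close>.\<close>
    define w where "w z = B * CH * (1 + 1 / norm (fst z) * norm (snd z))" for z :: "(real^'n) \<times> (real^'n)"
    have f_int: "integrable ?G (f t)" for t
      by (rule gauss_pair.P.integrable_const_bound[where B = "B * BH"]) (auto simp: f_def norm_pair)
    have inv1: "integrable gauss (\<lambda>x::real^'n. 1 / norm x)"
      using gauss_pair.integrable_fst'[OF integrable_gauss_inverse_norm[OF n, of 1 0]]
      by (simp add: measure_gauss_UNIV)
    have "integrable ?G (\<lambda>z. 1 / norm (fst z) * norm (snd z))"
    proof (rule gauss_pair.Fubini_integrable)
      show "integrable gauss (\<lambda>x::real^'n. \<integral>y. norm (1 / norm (fst (x, y)) * norm (snd (x, y))) \<partial>(gauss :: (real^'n) measure))"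
        using integrable_mult_right[of "\<integral>y. norm y \<partial>(gauss :: (real^'n) measure)", OF inv1] by simp
      show "AE x::real^'n in gauss. integrable gauss (\<lambda>y::real^'n. 1 / norm (fst (x, y)) * norm (snd (x, y)))"
        using integrable_gauss_norm[where 'a = "real ^ 'n"] by simp
    qed measurable
    then have w_int: "integrable ?G w" unfolding w_def[abs_def] by simp
    have f_deriv: "AE z in ?G. ((\<lambda>t. f t z) has_real_derivative f' z) (at 0)"
      using AEz
    proof eventually_elim
      case (elim z)
      have "((\<lambda>t. cos t *\<^sub>R fst z + sin t *\<^sub>R snd z) has_derivative (\<lambda>t. t *\<^sub>R snd z)) (at 0)"
        by (auto intro!: derivative_eq_intros)
      from has_derivative_compose[OF this, of H "\<lambda>h. H' (fst z) \<bullet> h"] H'[OF elim]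
      have "((\<lambda>t. H (cos t *\<^sub>R fst z + sin t *\<^sub>R snd z)) has_real_derivative (H' (fst z) \<bullet> snd z)) (at 0)"
        by (simp add: has_field_derivative_def mult.commute[of _ "_ \<bullet> _"] mult_commute_abs)
      from DERIV_cmult[OF this] show ?case by (simp add: f_def f'_def)
    qed
    have f_dom: "AE z in ?G. \<bar>f t z - f 0 z\<bar> \<le> \<bar>t\<bar> * w z" for t
      using AEz
    proof eventually_elim
      case (elim z)
      let ?x = "fst z" and ?y = "snd z"
      have "\<bar>sin (t / 2)\<bar> * \<bar>sin (t / 2)\<bar> \<le> 1 * \<bar>t / 2\<bar>"
        by (intro mult_mono abs_sin_x_le_abs_x) auto
      then have 1: "\<bar>cos t - 1\<bar> \<le> \<bar>t\<bar>"
        using cos_double_sin[of "t / 2"] by (simp add: power2_eq_square)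
      have "norm (cos t *\<^sub>R ?x + sin t *\<^sub>R ?y - ?x) = norm ((cos t - 1) *\<^sub>R ?x + sin t *\<^sub>R ?y)"
        by (simp add: algebra_simps)
      also have "\<dots> \<le> \<bar>cos t - 1\<bar> * norm ?x + \<bar>sin t\<bar> * norm ?y"
        using norm_triangle_ineq[of "(cos t - 1) *\<^sub>R ?x" "sin t *\<^sub>R ?y"] by simp
      also have "\<dots> \<le> \<bar>t\<bar> * norm ?x + \<bar>t\<bar> * norm ?y"
        using 1 abs_sin_x_le_abs_x[of t] by (intro add_mono mult_right_mono) auto
      finally have 2: "norm (cos t *\<^sub>R ?x + sin t *\<^sub>R ?y - ?x) \<le> \<bar>t\<bar> * (norm ?x + norm ?y)"
        by (simp add: distrib_left)
      have "\<bar>f t z - f 0 z\<bar> = \<bar>F (X z)\<bar> * \<bar>H (cos t *\<^sub>R ?x + sin t *\<^sub>R ?y) - H ?x\<bar>"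
        by (simp add: f_def abs_mult[symmetric] right_diff_distrib)
      also have "\<dots> \<le> B * (CH * norm (cos t *\<^sub>R ?x + sin t *\<^sub>R ?y - ?x) / norm ?x)"
        using B CH(2)[OF elim] by (intro mult_mono) auto
      also have "\<dots> \<le> B * (CH * (\<bar>t\<bar> * (norm ?x + norm ?y)) / norm ?x)"
        using B CH(1) 2 by (intro mult_left_mono divide_right_mono) auto
      also have "\<dots> = \<bar>t\<bar> * w z" using elim by (simp add: w_def field_simps)
      finally show ?case .
    qed
    have f'_int: "integrable ?G f'"
      by (rule integrable_deriv_dominated[where f = f and w = w]) (use f_int w_int f_deriv f_dom in auto)
    have "((\<lambda>t. \<integral>z. f t z \<partial>?G) has_real_derivative (\<integral>z. f' z \<partial>?G)) (at 0)"
      by (rule DERIV_integral_dominated[where w = w]) (use f_int w_int f_deriv f_dom in auto)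
    then have "((\<lambda>t. \<Phi> (t + s)) has_real_derivative (\<integral>z. f' z \<partial>?G)) (at 0)"
      by (simp add: shift[symmetric] add.commute)
    then have D: "(\<Phi> has_real_derivative (\<integral>z. f' z \<partial>?G)) (at s)"
      using DERIV_shift[of \<Phi> _ 0 s] by simp
    \<comment> \<open>With \<open>x\<close> fixed, \<open>f'\<close> is \<open>F\<close> of an
      affine function of \<open>y\<close> times a linear form in \<open>y\<close>. Integration by
      parts trades the linear form for a derivative of \<open>F\<close>, whose inner derivative is
      the source of \<open>sin s\<close>.\<close>
    have J: "AE x in gauss. ennreal (norm (\<integral>y. f' (x, y) \<partial>gauss)) \<le>
        (\<integral>\<^sup>+y. ennreal (sin s * (norm (F' (X (x, y))) * norm (H' x))) \<partial>gauss)"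
      using gauss_pair.AE_integrable_fst'[OF integrable_gauss_inverse_norm[OF n cs]] AE_gauss_neq[of 0]
    proof eventually_elim
      case (elim x)
      have X0: "AE y in gauss. X (x, y) \<noteq> 0"
      proof (cases "sin s = 0")
        case True
        then have "cos s \<noteq> 0" using cs by auto
        with True elim(2) show ?thesis by (simp add: X_def)
      next
        case False
        have "X (x, y) \<noteq> 0" if "y \<noteq> (cos s / sin s) *\<^sub>R x" for y
        proof
          assume "X (x, y) = 0"
          then have "sin s *\<^sub>R y = cos s *\<^sub>R x" by (simp add: X_def)
          then have "(1 / sin s) *\<^sub>R (sin s *\<^sub>R y) = (1 / sin s) *\<^sub>R (cos s *\<^sub>R x)" by (rule arg_cong)
          with False that show False by simp
        qed
        then show ?thesis using AE_gauss_neq[of "(cos s / sin s) *\<^sub>R x"] by auto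
      qed
      let ?u = "\<lambda>y. F (X (x, y))" and ?U = "\<lambda>y. (- sin s) *\<^sub>R F' (X (x, y))"
      have u1: "?u \<in> borel_measurable borel" and u2: "?U \<in> borel_measurable borel" by measurable
      have u3: "\<bar>?u y\<bar> \<le> B * (1 + norm y)" for y
          using B(2)[of "X (x, y)"] mult_nonneg_nonneg[OF B(1) norm_ge_zero[of y]]
          unfolding distrib_left real_norm_def by linarith
      have u4: "AE y in gauss. (?u has_derivative (\<lambda>h. ?U y \<bullet> h)) (at y)"
          using X0
        proof eventually_elim
          case (elim y)
          have "((\<lambda>y. X (x, y)) has_derivative (\<lambda>h. (- sin s) *\<^sub>R h)) (at y)"
            unfolding X_def by (auto intro!: derivative_eq_intros)
          from has_derivative_compose[OF this F'[OF elim]] show ?case by simp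
        qed
      have u5: "AE y in gauss. \<bar>?u (y + t *\<^sub>R H' x) - ?u y\<bar> \<le> \<bar>t\<bar> * (CF * (sin s * norm (H' x)) * (1 / norm (X (x, y))))" for t
          using X0
        proof eventually_elim
          case (elim y)
          have "X (x, y + t *\<^sub>R H' x) - X (x, y) = (- sin s * t) *\<^sub>R H' x" by (simp add: X_def algebra_simps)
          then have "norm (X (x, y + t *\<^sub>R H' x) - X (x, y)) = \<bar>t\<bar> * (sin s * norm (H' x))"
            using s0 by (simp add: abs_mult)
          with CF(2)[OF elim, of "X (x, y + t *\<^sub>R H' x)"] show ?case by (simp add: mult_ac)
        qed
      have u6: "integrable gauss (\<lambda>y. CF * (sin s * norm (H' x)) * (1 / norm (X (x, y))))"
          using elim(1) by (intro integrable_mult_right) (simp add: X_def)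
      note ibp = gauss_integral_by_parts[OF u1 u2 u3 u4 u5 u6]
      have "(\<integral>y. f' (x, y) \<partial>gauss) = (\<integral>y. ?U y \<bullet> H' x \<partial>gauss)"
        unfolding ibp(2) by (simp add: f'_def inner_commute)
      then have "ennreal (norm (\<integral>y. f' (x, y) \<partial>gauss)) \<le> (\<integral>\<^sup>+y. ennreal (norm (?U y \<bullet> H' x)) \<partial>gauss)"
        using integral_norm_bound_ennreal[OF ibp(1)] by simp
      also have "\<dots> \<le> (\<integral>\<^sup>+y. ennreal (sin s * (norm (F' (X (x, y))) * norm (H' x))) \<partial>gauss)"
      proof (intro nn_integral_mono ennreal_leI)
        fix y
        have "norm (?U y \<bullet> H' x) = sin s * \<bar>F' (X (x, y)) \<bullet> H' x\<bar>" using s0 by (simp add: abs_mult)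
        also have "\<dots> \<le> sin s * (norm (F' (X (x, y))) * norm (H' x))"
          by (intro mult_left_mono Cauchy_Schwarz_ineq2 s0)
        finally show "norm (?U y \<bullet> H' x) \<le> sin s * (norm (F' (X (x, y))) * norm (H' x))" .
      qed
      finally show ?case .
    qed
    have pt: "norm (F' (X z)) * norm (H' (fst z)) \<le>
        (\<alpha> (sgn (X z)) + \<beta> (sgn (fst z))) * (1 / (norm (X z) * norm (fst z)))" for z
    proof (cases "X z = 0 \<or> fst z = 0")
      case True
      then show ?thesis by (auto simp: F'_def H'_def radial_grad_def)
    next
      case False
      have "norm (F' (X z)) * norm (H' (fst z)) \<le> (norm (g' (sgn (X z))) / norm (X z)) * (norm (h' (sgn (fst z))) / norm (fst z))"
        unfolding F'_def H'_def by (intro mult_mono norm_radial_grad_le) auto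
      also have "\<dots> = (norm (g' (sgn (X z))) * norm (h' (sgn (fst z)))) * (1 / (norm (X z) * norm (fst z)))"
        by simp
      also have "\<dots> \<le> (\<alpha> (sgn (X z)) + \<beta> (sgn (fst z))) * (1 / (norm (X z) * norm (fst z)))"
        using False by (intro mult_right_mono dom) (auto simp: norm_sgn)
      finally show ?thesis .
    qed
    have "ennreal (norm (\<integral>z. f' z \<partial>?G)) = ennreal (norm (\<integral>x. \<integral>y. f' (x, y) \<partial>gauss \<partial>gauss))"
      by (simp only: gauss_pair.integral_fst'[OF f'_int])
    also have "\<dots> \<le> (\<integral>\<^sup>+x. ennreal (norm (\<integral>y. f' (x, y) \<partial>gauss)) \<partial>gauss)"
      by (rule integral_norm_bound_ennreal[OF gauss_pair.integrable_fst'[OF f'_int]])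
    also have "\<dots> \<le> (\<integral>\<^sup>+x. \<integral>\<^sup>+y. ennreal (sin s * (norm (F' (X (x, y))) * norm (H' x))) \<partial>gauss \<partial>gauss)"
      by (rule nn_integral_mono_AE[OF J])
    also have "\<dots> = (\<integral>\<^sup>+z. ennreal (sin s * (norm (F' (X z)) * norm (H' (fst z)))) \<partial>?G)"
      by (subst gauss.nn_integral_fst[symmetric]) auto
    also have "\<dots> \<le> (\<integral>\<^sup>+z. ennreal (sin s) * ((ennreal (\<alpha> (sgn (X z))) + ennreal (\<beta> (sgn (fst z)))) *
         ennreal (1 / (norm (X z) * norm (fst z)))) \<partial>?G)"
    proof (rule nn_integral_mono)
      fix z
      have "ennreal (sin s * (norm (F' (X z)) * norm (H' (fst z)))) \<le>
         ennreal (sin s * ((\<alpha> (sgn (X z)) + \<beta> (sgn (fst z))) * (1 / (norm (X z) * norm (fst z)))))"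
        by (intro ennreal_leI mult_left_mono pt s0)
      also have "\<dots> = ennreal (sin s) * ((ennreal (\<alpha> (sgn (X z))) + ennreal (\<beta> (sgn (fst z)))) *
         ennreal (1 / (norm (X z) * norm (fst z))))"
        using s0 \<alpha>(2) \<beta>(2) by (subst ennreal_mult, simp, simp, subst ennreal_mult, simp, simp) simp
      finally show "ennreal (sin s * (norm (F' (X z)) * norm (H' (fst z)))) \<le> ennreal (sin s) *
         ((ennreal (\<alpha> (sgn (X z))) + ennreal (\<beta> (sgn (fst z)))) * ennreal (1 / (norm (X z) * norm (fst z))))" .
    qed
    also have "\<dots> = ennreal (sin s) * (\<integral>\<^sup>+z. (ennreal (\<alpha> (sgn (X z))) + ennreal (\<beta> (sgn (fst z)))) *
         ennreal (1 / (norm (X z) * norm (fst z))) \<partial>?G)"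
      by (rule nn_integral_cmult) measurable
    also have "\<dots> \<le> ennreal (sin s) * (((\<integral>\<^sup>+x. \<alpha> x \<partial>sphere_measure) + (\<integral>\<^sup>+x. \<beta> x \<partial>sphere_measure)) *
         ennreal (1 / (real CARD('n) - 2)))"
      unfolding X_def by (intro mult_left_mono gauss_pair_weighted_le cs n) auto
    also have "\<dots> = ennreal (sin s * K)"
    proof -
      have "(\<integral>\<^sup>+x. \<alpha> x \<partial>sphere_measure) = ennreal (\<integral>x. \<alpha> x \<partial>sphere_measure)"
        "(\<integral>\<^sup>+x. \<beta> x \<partial>sphere_measure) = ennreal (\<integral>x. \<beta> x \<partial>sphere_measure)"
        using \<alpha> \<beta> by (auto intro!: nn_integral_eq_integral cont_int)
      moreover have "(\<integral>x. \<alpha> x \<partial>sphere_measure) \<ge> 0" "(\<integral>x. \<beta> x \<partial>sphere_measure) \<ge> 0"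
        using \<alpha>(2) \<beta>(2) by simp_all
      ultimately show ?thesis using s0 n
        by (simp add: K_def ennreal_plus[symmetric] ennreal_mult[symmetric] del: ennreal_plus)
    qed
    finally have "norm (\<integral>z. f' z \<partial>?G) \<le> sin s * K"
      using s0 K0 by (simp add: ennreal_le_iff)
    with D show ?thesis by (intro exI[of _ "\<integral>z. f' z \<partial>?G"]) auto
  qed
  \<comment> \<open>The derivative of K cos s is - K sin s, so the lower bound on the derivative of
    \<open>\<Phi>\<close> makes the difference monotone. Over the quarter turn sin s integrates to
    1, hence \<open>K\<close> appears without a further factor.\<close>
  have "\<Phi> 0 - K * cos 0 \<le> \<Phi> (pi / 2) - K * cos (pi / 2)"
  proof (rule DERIV_nonneg_imp_nondecreasing[of 0 "pi / 2" "\<lambda>s. \<Phi> s - K * cos s"])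
    fix s :: real assume "0 \<le> s" "s \<le> pi / 2"
    then obtain D where D: "(\<Phi> has_real_derivative D) (at s)" "D \<ge> - (sin s * K)" using deriv by blast
    then have "((\<lambda>s. \<Phi> s - K * cos s) has_real_derivative (D + K * sin s)) (at s)"
      by (auto intro!: derivative_eq_intros)
    moreover have "0 \<le> D + K * sin s" using D(2) by (simp add: mult.commute)
    ultimately show "\<exists>y. ((\<lambda>s. \<Phi> s - K * cos s) has_real_derivative y) (at s) \<and> 0 \<le> y"
      by blast
  qed simp
  then have "\<Phi> 0 - \<Phi> (pi / 2) \<le> K" by simp
  moreover have "\<Phi> 0 = (\<integral>x. g x * h x \<partial>sphere_measure)"
  proof -
    have \<Phi>0: "\<Phi> 0 = (\<integral>x. \<integral>y. F x * H x \<partial>(gauss :: (real^'n) measure) \<partial>gauss)"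
    proof -
      have "integrable ?G (\<lambda>z. F (fst z) * H (fst z))"
        by (rule gauss_pair.P.integrable_const_bound[where B = "B * BH"]) (auto simp: norm_pair)
      from gauss_pair.integral_fst'[OF this] show ?thesis by (simp add: \<Phi>_def)
    qed
    also have "\<dots> = (\<integral>x. g (sgn x) * h (sgn x) \<partial>gauss)" by (simp add: F_def H_def measure_gauss_UNIV)
    also have "\<dots> = (\<integral>x. g x * h x \<partial>sphere_measure)"
      using gc hc by (intro integral_gauss_sgn[of "\<lambda>x. g x * h x"] cont_int continuous_intros) auto
    finally show ?thesis .
  qed
  moreover have "\<Phi> (pi / 2) = (\<integral>x. g x \<partial>sphere_measure) * (\<integral>x. h x \<partial>sphere_measure)"
  proof -
    have "\<Phi> (pi / 2) = (\<integral>x. \<integral>y. F x * H y \<partial>(gauss :: (real^'n) measure) \<partial>gauss)"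
    proof -
      have "integrable ?G (\<lambda>z. F (fst z) * H (snd z))"
        by (rule gauss_pair.P.integrable_const_bound[where B = "B * BH"]) (auto simp: norm_pair)
      from gauss_pair.integral_fst'[OF this] show ?thesis by (simp add: \<Phi>_def)
    qed
    also have "\<dots> = (\<integral>x. F x \<partial>gauss) * (\<integral>x. H x \<partial>gauss)" by simp
    also have "\<dots> = (\<integral>x. g x \<partial>sphere_measure) * (\<integral>x. h x \<partial>sphere_measure)"
      unfolding F_def H_def by (simp add: integral_gauss_sgn cont_int gc hc)
    finally show ?thesis .
  qed
  ultimately show ?thesis by (simp add: K_def)
qed

section \<open>Moment inequalities\<close>

lemma C1_punctured_compose:
  fixes \<phi> :: "real \<Rightarrow> real"
  assumes g: "C1_punctured g g'" and \<phi>: "\<And>t. (\<phi> has_real_derivative \<phi>' t) (at t)"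
    and cont: "continuous_on (- {0}) (\<lambda>x. \<phi>' (g x))"
  shows "C1_punctured (\<lambda>x. \<phi> (g x)) (\<lambda>x. \<phi>' (g x) *\<^sub>R g' x)"
proof -
  have "((\<lambda>x. \<phi> (g x)) has_derivative (\<lambda>h. (\<phi>' (g x) *\<^sub>R g' x) \<bullet> h)) (at x)" if "x \<noteq> 0" for x
    using has_derivative_compose[OF C1_puncturedD[OF g that] \<phi>[of "g x", unfolded has_field_derivative_def]]
    by simp
  moreover have "continuous_on (- {0}) (\<lambda>x. \<phi>' (g x) *\<^sub>R g' x)"
    by (intro continuous_intros cont C1_punctured_continuous(2)[OF g])
  ultimately show ?thesis by (simp add: C1_punctured_def)
qed

lemma integrable_sphere_punctured:
  fixes f :: "real ^ 'n \<Rightarrow> real"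
  shows "continuous_on (- {0}) f \<Longrightarrow> integrable sphere_measure f"
  by (rule integrable_sphere_continuous) (rule continuous_on_subset[OF _ sphere_subset_punctured])

lemma continuous_on_nonneg_powr:
  fixes f :: "'a::topological_space \<Rightarrow> real"
  assumes "continuous_on S f" "\<And>x. x \<in> S \<Longrightarrow> f x \<ge> 0" "r > 0"
  shows "continuous_on S (\<lambda>x. f x powr r)"
  using assms by (intro continuous_on_powr') auto

text \<open>The covariance inequality for \<open>g\<close> with itself, the product of gradients
  being split by a b \<le> (a^2 + b^2) / 2.\<close>

lemma sphere_poincare:
  fixes g :: "real ^ 'n \<Rightarrow> real"
  assumes n: "CARD('n) \<ge> 3" and g: "C1_punctured g g'" and mean: "(\<integral>x. g x \<partial>sphere_measure) = 0"
  shows "(\<integral>x. (g x)\<^sup>2 \<partial>sphere_measure) \<le> (\<integral>x. (norm (g' x))\<^sup>2 \<partial>sphere_measure) / (real CARD('n) - 2)"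
proof -
  note c = C1_punctured_continuous[OF g]
  have "(\<integral>x. g x * g x \<partial>sphere_measure) - (\<integral>x. g x \<partial>sphere_measure) * (\<integral>x. g x \<partial>sphere_measure) \<le>
    ((\<integral>x. (norm (g' x))\<^sup>2 / 2 \<partial>sphere_measure) + (\<integral>x. (norm (g' x))\<^sup>2 / 2 \<partial>sphere_measure)) / (real CARD('n) - 2)"
  proof (rule sphere_covariance_le[OF n g g])
    fix x y
    have "0 \<le> (norm (g' x) - norm (g' y))\<^sup>2" by simp
    then show "norm (g' x) * norm (g' y) \<le> (norm (g' x))\<^sup>2 / 2 + (norm (g' y))\<^sup>2 / 2"
      by (simp add: power2_diff)
  qed (auto intro!: continuous_intros c)
  then show ?thesis by (simp add: mean power2_eq_square)
qed

text \<open>Weights 1/q, 1/q and (q - 2)/q, obtained by averaging two instances of Young's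
  inequality with exponents q / 2 and q / (q - 2). The second exponent forces q > 2, so the case q =
  2 of the moment inequality is treated apart.\<close>

lemma weighted_AM_GM_three:
  fixes a b c q :: real
  assumes "a \<ge> 0" "b \<ge> 0" "c \<ge> 0" and q: "q > 2"
  shows "a * b * c powr (q - 2) \<le> (a powr q + (b powr q + (q - 2) * c powr q)) / q"
proof -
  have *: "d\<^sup>2 * c powr (q - 2) \<le> (2 * d powr q + (q - 2) * c powr q) / q" if d: "d \<ge> 0" for d
  proof -
    have "d\<^sup>2 * c powr (q - 2) \<le> d\<^sup>2 powr (q / 2) / (q / 2) + (c powr (q - 2)) powr (q / (q - 2)) / (q / (q - 2))"
      using q by (intro Youngs_inequality) (auto simp: field_simps)
    also have "d\<^sup>2 powr (q / 2) = d powr q"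
      using d q by (cases "d = 0") (simp_all add: powr_powr flip: powr_numeral)
    also have "(c powr (q - 2)) powr (q / (q - 2)) = c powr q"
      using q by (simp add: powr_powr)
    finally show ?thesis using q by (simp add: field_simps)
  qed
  have "0 \<le> (a - b)\<^sup>2" by simp
  then have "a * b \<le> (a\<^sup>2 + b\<^sup>2) / 2" by (simp add: power2_diff)
  then have "a * b * c powr (q - 2) \<le> (a\<^sup>2 + b\<^sup>2) / 2 * c powr (q - 2)" by (rule mult_right_mono) simp
  also have "\<dots> = (a\<^sup>2 * c powr (q - 2) + b\<^sup>2 * c powr (q - 2)) / 2" by (simp add: distrib_right)
  also have "\<dots> \<le> ((2 * a powr q + (q - 2) * c powr q) / q + (2 * b powr q + (q - 2) * c powr q) / q) / 2"
    by (intro divide_right_mono add_mono * assms) simp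
  also have "\<dots> = (a powr q + (b powr q + (q - 2) * c powr q)) / q"
    using q by (simp add: field_simps)
  finally show ?thesis .
qed

lemma DERIV_signed_powr:
  fixes t q :: real
  assumes q: "q > 2"
  shows "((\<lambda>t. t * \<bar>t\<bar> powr (q - 2)) has_real_derivative (q - 1) * \<bar>t\<bar> powr (q - 2)) (at t)"
proof (cases "t = 0")
  case True
  \<comment> \<open>At 0 the difference quotient is |h|^(q-2) itself, which vanishes in the limit
    because q > 2.\<close>
  have "((\<lambda>h::real. \<bar>h\<bar> powr (q - 2)) \<longlongrightarrow> \<bar>0\<bar> powr (q - 2)) (at 0)"
    using q by (intro tendsto_intros) auto
  then have "((\<lambda>h::real. \<bar>h\<bar> powr (q - 2)) \<longlongrightarrow> 0) (at 0)" by simp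
  then have "((\<lambda>h. (h * \<bar>h\<bar> powr (q - 2) - 0) / h) \<longlongrightarrow> 0) (at 0)"
    by (rule Lim_transform_eventually) (auto simp: eventually_at_filter)
  then show ?thesis using True q by (simp add: has_field_derivative_iff)
next
  case False
  have "((\<lambda>t. sgn t * \<bar>t\<bar> powr (q - 1)) has_real_derivative (q - 1) * \<bar>t\<bar> powr (q - 2)) (at t)"
  proof (cases "t > 0")
    case True
    have "((\<lambda>t. t powr (q - 1)) has_real_derivative (q - 1) * t powr (q - 2)) (at t)"
      using True by (auto intro!: derivative_eq_intros)
    then show ?thesis
      by (rule DERIV_cong_ev[THEN iffD1, rotated 3])
         (use True in \<open>auto simp: eventually_nhds_metric dist_real_def intro!: exI[of _ t]\<close>)
  next
    case neg: False
    have "((\<lambda>t. - ((- t) powr (q - 1))) has_real_derivative (q - 1) * (- t) powr (q - 2)) (at t)"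
      using neg False by (auto intro!: derivative_eq_intros)
    then show ?thesis
      by (rule DERIV_cong_ev[THEN iffD1, rotated 3])
         (use neg False in \<open>auto simp: eventually_nhds_metric dist_real_def intro!: exI[of _ "- t"]\<close>)
  qed
  moreover have "sgn t * \<bar>t\<bar> powr (q - 1) = t * \<bar>t\<bar> powr (q - 2)" for t
    using powr_mult_base[of "\<bar>t\<bar>" "q - 2"] by (cases "t = 0") (auto simp: sgn_if)
  ultimately show ?thesis by simp
qed

text \<open>The covariance of \<open>g\<close> with |g|^(q-2) g is the q-th absolute moment. Young's
  inequality returns the fraction (q - 2) / q of this moment to the right-hand side, where it is
  absorbed into the left.\<close>

lemma sphere_moment_le:
  fixes g :: "real ^ 'n \<Rightarrow> real" and q :: real
  assumes n: "CARD('n) \<ge> 3" and g: "C1_punctured g g'" and mean: "(\<integral>x. g x \<partial>sphere_measure) = 0" and q: "q \<ge> 2"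
  shows "(\<integral>x. \<bar>g x\<bar> powr q \<partial>sphere_measure) \<le>
    sqrt ((q - 1) / (real CARD('n) - 2)) powr q * (\<integral>x. norm (g' x) powr q \<partial>sphere_measure)"
proof (cases "q = 2")
  case True
  have "sqrt (1 / (real CARD('n) - 2)) powr 2 = 1 / (real CARD('n) - 2)"
    using n by simp
  with sphere_poincare[OF n g mean] True show ?thesis by simp
next
  case False
  with q have q: "q > 2" by simp
  note c = C1_punctured_continuous[OF g]
  \<comment> \<open>Chosen so that the factor q - 1 from the derivative of \<open>h\<close> equals
    (n - 2) k^2: each gradient takes one \<open>k\<close>, and n - 2 cancels the denominator of the
    covariance inequality.\<close>
  define k where "k = sqrt ((q - 1) / (real CARD('n) - 2))"
  have k: "k > 0" and kk: "(real CARD('n) - 2) * k * k = q - 1" using n q by (auto simp: k_def mult.assoc)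
  define h where "h x = g x * \<bar>g x\<bar> powr (q - 2)" for x
  define h' where "h' x = ((q - 1) * \<bar>g x\<bar> powr (q - 2)) *\<^sub>R g' x" for x
  have pc: "continuous_on (- {0}) (\<lambda>x. \<bar>g x\<bar> powr (q - 2))"
    "continuous_on (- {0}) (\<lambda>x. \<bar>g x\<bar> powr q)" "continuous_on (- {0}) (\<lambda>x. (k * norm (g' x)) powr q)"
    using q k by (intro continuous_on_nonneg_powr continuous_intros c; simp)+
  have h: "C1_punctured h h'"
    unfolding h_def[abs_def] h'_def[abs_def]
    by (rule C1_punctured_compose[OF g DERIV_signed_powr[OF q]]) (intro continuous_intros pc)
  let ?N = "real CARD('n) - 2"
  define \<alpha> where "\<alpha> x = ?N / q * (k * norm (g' x)) powr q" for x
  define \<beta> where "\<beta> x = ?N / q * ((k * norm (g' x)) powr q + (q - 2) * \<bar>g x\<bar> powr q)" for x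
  let ?U = "\<integral>x. \<bar>g x\<bar> powr q \<partial>sphere_measure" and ?V = "\<integral>x. (k * norm (g' x)) powr q \<partial>sphere_measure"
  have "(\<integral>x. g x * h x \<partial>sphere_measure) - (\<integral>x. g x \<partial>sphere_measure) * (\<integral>x. h x \<partial>sphere_measure) \<le>
    ((\<integral>x. \<alpha> x \<partial>sphere_measure) + (\<integral>x. \<beta> x \<partial>sphere_measure)) / ?N"
  proof (rule sphere_covariance_le[OF n g h])
    show "continuous_on (- {0}) \<alpha>" "continuous_on (- {0}) \<beta>"
      unfolding \<alpha>_def[abs_def] \<beta>_def[abs_def] by (intro continuous_intros pc)+
    show "\<alpha> x \<ge> 0" "\<beta> x \<ge> 0" for x using n q by (auto simp: \<alpha>_def \<beta>_def)
    fix x y :: "real ^ 'n"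
    have "norm (g' x) * norm (h' y) = norm (g' x) * ((?N * k * k) * \<bar>g y\<bar> powr (q - 2) * norm (g' y))"
      unfolding kk using q by (simp add: h'_def abs_mult)
    also have "\<dots> = ?N * ((k * norm (g' x)) * (k * norm (g' y)) * \<bar>g y\<bar> powr (q - 2))"
      by (simp add: mult_ac)
    also have "\<dots> \<le> ?N * (((k * norm (g' x)) powr q + ((k * norm (g' y)) powr q + (q - 2) * \<bar>g y\<bar> powr q)) / q)"
      using n k q by (intro mult_left_mono weighted_AM_GM_three) auto
    also have "?N * (((k * norm (g' x)) powr q + ((k * norm (g' y)) powr q + (q - 2) * \<bar>g y\<bar> powr q)) / q) =
        \<alpha> x + \<beta> y"
    proof -
      have "N * ((a + b) / q) = N / q * a + N / q * b" for N a b :: real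
        by (simp add: add_divide_distrib distrib_left)
      then show ?thesis unfolding \<alpha>_def \<beta>_def .
    qed
    finally show "norm (g' x) * norm (h' y) \<le> \<alpha> x + \<beta> y" .
  qed
  also have "(\<integral>x. g x * h x \<partial>sphere_measure) = ?U"
  proof (intro Bochner_Integration.integral_cong refl)
    fix x
    have "g x * h x = \<bar>g x\<bar> * (\<bar>g x\<bar> * \<bar>g x\<bar> powr (q - 2))" by (simp add: h_def abs_mult[symmetric])
    also have "\<dots> = \<bar>g x\<bar> powr q"
      using powr_mult_base[of "\<bar>g x\<bar>" "q - 2"] powr_mult_base[of "\<bar>g x\<bar>" "q - 1"] by simp
    finally show "g x * h x = \<bar>g x\<bar> powr q" .
  qed
  also have "(\<integral>x. \<alpha> x \<partial>sphere_measure) = ?N / q * ?V" by (simp add: \<alpha>_def)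
  also have "(\<integral>x. \<beta> x \<partial>sphere_measure) = ?N / q * (?V + (q - 2) * ?U)"
    by (simp add: \<beta>_def integrable_sphere_punctured pc)
  also have "(?N / q * ?V + ?N / q * (?V + (q - 2) * ?U)) / ?N = (2 * ?V + (q - 2) * ?U) / q"
    using n q by (simp add: field_simps)
  finally have "?U \<le> (2 * ?V + (q - 2) * ?U) / q" by (simp add: mean)
  then have "q * ?U \<le> 2 * ?V + (q - 2) * ?U" using q by (simp add: field_simps)
  then have "?U \<le> ?V" by (simp add: algebra_simps)
  also have "?V = k powr q * (\<integral>x. norm (g' x) powr q \<partial>sphere_measure)"
    using k by (simp add: powr_mult)
  finally show ?thesis by (simp add: k_def)
qed

section \<open>Homogeneous functions\<close>

text \<open>\<open>C_smooth_on\<close> speaks of partial derivatives only. Changing one coordinate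
  at a time, the mean value theorem controls each increment through the continuity of a single
  partial derivative.\<close>

lemma C1_punctured_partials:
  fixes g :: "real ^ 'n \<Rightarrow> real" and G :: "'n \<Rightarrow> real ^ 'n \<Rightarrow> real"
  assumes deriv: "\<And>i x. x \<noteq> 0 \<Longrightarrow> ((\<lambda>t. g (x + t *\<^sub>R axis i 1)) has_real_derivative G i x) (at 0)"
    and cont: "\<And>i. continuous_on (- {0}) (G i)"
  shows "C1_punctured g (\<lambda>x. \<chi> i. G i x)"
  unfolding C1_punctured_def
proof (intro conjI allI impI)
  show "continuous_on (- {0}) (\<lambda>x. \<chi> i. G i x)"
    by (intro continuous_on_vec_lambda cont)
  fix x :: "real ^ 'n" assume x: "x \<noteq> 0"
  show "(g has_derivative (\<lambda>h. (\<chi> i. G i x) \<bullet> h)) (at x)"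
    unfolding has_derivative_at_alt
  proof (intro conjI allI impI)
    show "bounded_linear (\<lambda>h. (\<chi> i. G i x) \<bullet> h)" by (rule bounded_linear_inner_right)
    fix e :: real assume "e > 0"
    define e' where "e' = e / real CARD('n)"
    have e': "e' > 0" using \<open>e > 0\<close> by (simp add: e'_def)
    have "\<exists>d>0. \<forall>y. dist y x < d \<longrightarrow> dist (G i y) (G i x) < e'" for i
    proof -
      have "isCont (G i) x" using cont[of i] x continuous_on_eq_continuous_at[of "- {0}" "G i"] by auto
      then show ?thesis using e' unfolding continuous_at_eps_delta by (metis dist_norm)
    qed
    then obtain d where d: "\<And>i. d i > 0" "\<And>i y. dist y x < d i \<Longrightarrow> dist (G i y) (G i x) < e'" by metis
    \<comment> \<open>A radius of at most \<open>norm x\<close> keeps the whole coordinate path away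
      from the origin.\<close>
    define r where "r = min (norm x) (Min (range d))"
    have r: "r > 0" using x d(1) by (simp add: r_def)
    have near: "y \<noteq> 0" "\<bar>G i y - G i x\<bar> \<le> e'" if "norm (y - x) < r" for y i
    proof -
      have "norm (y - x) < d i" using that by (auto simp: r_def)
      then show "\<bar>G i y - G i x\<bar> \<le> e'" using d(2)[of y i] by (simp add: dist_norm)
      show "y \<noteq> 0" using that by (auto simp: r_def)
    qed
    show "\<exists>r>0. \<forall>y. norm (y - x) < r \<longrightarrow> norm (g y - g x - (\<chi> i. G i x) \<bullet> (y - x)) \<le> e * norm (y - x)"
    proof (intro exI[of _ r] conjI allI impI r)
      fix y assume y: "norm (y - x) < r"
      define h where "h = y - x"
      \<comment> \<open>Exactly the coordinates in \<open>S\<close> have been moved. Induction over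
        finite sets dispenses with an order on the coordinates.\<close>
      define p where "p S = x + (\<Sum>i\<in>S. h $ i *\<^sub>R axis i 1)" for S
      have close: "norm (p S + t *\<^sub>R axis j 1 - x) < r" if "j \<notin> S" "\<bar>t\<bar> \<le> \<bar>h $ j\<bar>" for S j t
      proof -
        have "norm (p S + t *\<^sub>R axis j 1 - x) \<le> norm h"
        proof (rule norm_le_componentwise_cart)
          fix k
          have "(p S + t *\<^sub>R axis j 1 - x) $ k = (if k \<in> S then h $ k else 0) + (if k = j then t else 0)"
            by (auto simp: p_def axis_def if_distrib sum.delta cong: if_cong)
          then show "norm ((p S + t *\<^sub>R axis j 1 - x) $ k) \<le> norm (h $ k)" using that by auto
        qed
        with y show ?thesis by (simp add: h_def)
      qed
      have step: "\<bar>g (p S) - g x - (\<Sum>i\<in>S. G i x * h $ i)\<bar> \<le> (\<Sum>i\<in>S. e' * \<bar>h $ i\<bar>)" if "finite S" for S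
        using that
      proof induction
        case empty
        then show ?case by (simp add: p_def)
      next
        case (insert j S)
        have pj: "p (insert j S) = p S + h $ j *\<^sub>R axis j 1" using insert by (simp add: p_def)
        let ?\<psi> = "\<lambda>t. g (p S + t *\<^sub>R axis j 1) - t * G j x"
        have "norm (?\<psi> (h $ j) - ?\<psi> 0) \<le> e' * norm (h $ j - 0)"
        proof (rule field_differentiable_bound[where S = "closed_segment 0 (h $ j)" and f' = "\<lambda>t. G j (p S + t *\<^sub>R axis j 1) - G j x"])
          fix t assume "t \<in> closed_segment 0 (h $ j)"
          then have t: "\<bar>t\<bar> \<le> \<bar>h $ j\<bar>" using segment_bound1[of t 0 "h $ j"] by simp
          note c = near[OF close[OF insert(2) t]]
          show "norm (G j (p S + t *\<^sub>R axis j 1) - G j x) \<le> e'" using c(2) by simp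
          have "((\<lambda>s. g (p S + t *\<^sub>R axis j 1 + s *\<^sub>R axis j 1)) has_real_derivative G j (p S + t *\<^sub>R axis j 1)) (at 0)"
            by (rule deriv[OF c(1)])
          then have "((\<lambda>s. g (p S + (s + t) *\<^sub>R axis j 1)) has_real_derivative G j (p S + t *\<^sub>R axis j 1)) (at 0)"
            by (simp add: scaleR_add_left add_ac)
          then have 1: "((\<lambda>s. g (p S + s *\<^sub>R axis j 1)) has_real_derivative G j (p S + t *\<^sub>R axis j 1)) (at t)"
            using DERIV_shift[of "\<lambda>s. g (p S + s *\<^sub>R axis j 1)" _ 0 t] by simp
          have "((\<lambda>t. t * G j x) has_real_derivative G j x) (at t)"
            by (auto intro!: derivative_eq_intros)
          from DERIV_diff[OF 1 this]
          show "(?\<psi> has_real_derivative G j (p S + t *\<^sub>R axis j 1) - G j x) (at t within closed_segment 0 (h $ j))"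
            by (rule has_field_derivative_at_within)
        qed auto
        then have "\<bar>g (p (insert j S)) - g (p S) - G j x * h $ j\<bar> \<le> e' * \<bar>h $ j\<bar>"
          by (simp add: pj mult.commute)
        with insert show ?case by simp
      qed
      have "p UNIV = x + h"
        by (simp add: p_def vec_eq_iff axis_def if_distrib sum.delta cong: if_cong)
      then have "\<bar>g y - g x - (\<chi> i. G i x) \<bullet> h\<bar> \<le> (\<Sum>i\<in>UNIV. e' * \<bar>h $ i\<bar>)"
        using step[of UNIV] by (simp add: h_def inner_vec_def)
      also have "\<dots> \<le> (\<Sum>i\<in>(UNIV::'n set). e' * norm h)"
        using e' by (intro sum_mono mult_left_mono component_le_norm_cart) auto
      also have "\<dots> = e * norm h" by (simp add: e'_def)
      finally show "norm (g y - g x - (\<chi> i. G i x) \<bullet> (y - x)) \<le> e * norm (y - x)" by (simp add: h_def)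
    qed
  qed
qed

lemma C1_punctured_mult:
  assumes f: "C1_punctured f f'" and g: "C1_punctured g g'"
  shows "C1_punctured (\<lambda>x. f x * g x) (\<lambda>x. f x *\<^sub>R g' x + g x *\<^sub>R f' x)"
  unfolding C1_punctured_def
proof (intro conjI allI impI)
  show "continuous_on (- {0}) (\<lambda>x. f x *\<^sub>R g' x + g x *\<^sub>R f' x)"
    by (intro continuous_intros C1_punctured_continuous[OF f] C1_punctured_continuous[OF g])
  fix x :: 'a assume "x \<noteq> 0"
  from has_derivative_mult[OF C1_puncturedD[OF f this] C1_puncturedD[OF g this]]
  show "((\<lambda>x. f x * g x) has_derivative (\<lambda>h. (f x *\<^sub>R g' x + g x *\<^sub>R f' x) \<bullet> h)) (at x)"
    by (simp add: inner_add_left mult.commute)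
qed

lemma homogeneous_euler:
  assumes h: "C1_punctured h h'" and hom: "homogeneous m h" and x: "x \<noteq> 0"
  shows "h' x \<bullet> x = m * h x"
proof -
  have "((\<lambda>t. t *\<^sub>R x) has_derivative (\<lambda>t. t *\<^sub>R x)) (at 1)" by (auto intro!: derivative_eq_intros)
  from has_derivative_compose[OF this, of h "\<lambda>k. h' x \<bullet> k"] C1_puncturedD[OF h x]
  have "((\<lambda>t. h (t *\<^sub>R x)) has_real_derivative (h' x \<bullet> x)) (at 1)"
    by (simp add: has_field_derivative_def mult.commute[of _ "_ \<bullet> _"] mult_commute_abs)
  moreover have "((\<lambda>t. h (t *\<^sub>R x)) has_real_derivative (m * h x)) (at 1)"
  proof -
    have "((\<lambda>t. t powr m * h x) has_real_derivative (m * h x)) (at 1)"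
      by (auto intro!: derivative_eq_intros)
    then show ?thesis
      by (rule DERIV_cong_ev[THEN iffD1, rotated 3])
         (use hom x in \<open>auto simp: homogeneous_def eventually_nhds_metric dist_real_def intro!: exI[of _ 1]\<close>)
  qed
  ultimately show ?thesis by (rule DERIV_unique)
qed

lemma homogeneous_gradient:
  assumes h: "C1_punctured h h'" and hom: "homogeneous m h" and x: "x \<noteq> 0" and l: "l > 0"
  shows "h' (l *\<^sub>R x) = l powr (m - 1) *\<^sub>R h' x"
proof -
  have "l *\<^sub>R x \<noteq> 0" using x l by simp
  have "((\<lambda>y. l *\<^sub>R y) has_derivative (\<lambda>y. l *\<^sub>R y)) (at x)" by (auto intro!: derivative_eq_intros)
  from has_derivative_compose[OF this C1_puncturedD[OF h \<open>l *\<^sub>R x \<noteq> 0\<close>]]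
  have "((\<lambda>y. h (l *\<^sub>R y)) has_derivative (\<lambda>k. h' (l *\<^sub>R x) \<bullet> (l *\<^sub>R k))) (at x)" .
  then have 1: "((\<lambda>y. l powr m * h y) has_derivative (\<lambda>k. h' (l *\<^sub>R x) \<bullet> (l *\<^sub>R k))) (at x)"
    by (rule has_derivative_transform_within_open[where s = "- {0}"])
       (use hom x l in \<open>auto simp: homogeneous_def\<close>)
  have "((\<lambda>y. l powr m * h y) has_derivative (\<lambda>k. l powr m * (h' x \<bullet> k))) (at x)"
    by (intro derivative_intros C1_puncturedD[OF h x])
  from has_derivative_unique[OF 1 this]
  have "(l *\<^sub>R h' (l *\<^sub>R x)) \<bullet> k = (l powr m *\<^sub>R h' x) \<bullet> k" for k by (metis inner_scaleR_left inner_scaleR_right)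
  then have "l *\<^sub>R h' (l *\<^sub>R x) = l powr m *\<^sub>R h' x" by (metis vector_eq_rdot)
  then have "(1 / l) *\<^sub>R (l *\<^sub>R h' (l *\<^sub>R x)) = (1 / l) *\<^sub>R (l powr m *\<^sub>R h' x)" by (rule arg_cong)
  then show ?thesis using l by (simp add: powr_diff)
qed


text \<open>Direction and length of a Gaussian vector are independent.\<close>

lemma integral_gauss_sgn_norm2:
  fixes A :: "real ^ 'n \<Rightarrow> real"
  assumes A: "continuous_on (- {0}) A"
  shows "(\<integral>x. A (sgn x) * (norm x)\<^sup>2 \<partial>gauss) = (\<integral>x. A x \<partial>sphere_measure) * (\<integral>x. (norm x)\<^sup>2 \<partial>(gauss :: (real ^ 'n) measure))"
proof -
  have [measurable]: "A \<in> borel_measurable borel" using A by (rule borel_measurable_punctured)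
  have int: "integrable sphere_measure A" by (rule integrable_sphere_punctured[OF A])
  have n2: "integrable gauss (\<lambda>x::real^'n. (norm x)\<^sup>2)"
  proof (rule Bochner_Integration.integrable_bound)
    show "integrable gauss (\<lambda>x::real^'n. 4 * exp ((norm x)\<^sup>2 / 4))"
      using integrable_gauss_exp_quarter by simp
    have "t \<le> 4 * exp (t / 4)" for t :: real using exp_ge_add_one_self[of "t / 4"] by linarith
    then show "AE x in gauss. norm ((norm (x::real^'n))\<^sup>2) \<le> norm (4 * exp ((norm x)\<^sup>2 / 4))" by simp
  qed measurable
  define M where "M = (\<integral>x. (norm x)\<^sup>2 \<partial>(gauss :: (real ^ 'n) measure))"
  have M: "(\<integral>\<^sup>+x. ennreal ((norm x)\<^sup>2) \<partial>(gauss :: (real ^ 'n) measure)) = ennreal M" "M \<ge> 0"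
    unfolding M_def using n2 by (auto intro!: nn_integral_eq_integral)
  have nn: "(\<integral>\<^sup>+x. ennreal (B (sgn x) * (norm x)\<^sup>2) \<partial>gauss) = (\<integral>\<^sup>+x. ennreal (B x) \<partial>sphere_measure) * ennreal M"
    if [measurable]: "B \<in> borel_measurable borel" for B :: "real ^ 'n \<Rightarrow> real"
  proof -
    define \<rho> where "\<rho> r = ennreal ((1 / sqrt (2 * pi)) ^ CARD('n) * exp (- r\<^sup>2 / 2)) * ennreal (r\<^sup>2)" for r :: real
    have [measurable]: "\<rho> \<in> borel_measurable borel" unfolding \<rho>_def[abs_def] by measurable
    have \<rho>: "ennreal (gauss_density x) * ennreal ((norm x)\<^sup>2) = \<rho> (norm x)" for x :: "real ^ 'n"
      by (simp add: \<rho>_def gauss_density_def)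
    have e: "ennreal (B (sgn x) * (norm x)\<^sup>2) = ennreal (B (sgn x)) * ennreal ((norm x)\<^sup>2)" for x
      by (simp add: ennreal_mult'')
    have "(\<integral>\<^sup>+x. ennreal (B (sgn x) * (norm x)\<^sup>2) \<partial>gauss) = (\<integral>\<^sup>+x. ennreal (B (sgn x)) * \<rho> (norm x) \<partial>lborel)"
      by (subst nn_integral_gauss) (simp_all add: e \<rho>[symmetric] mult_ac)
    also have "\<dots> = (\<integral>\<^sup>+x. ennreal (B x) \<partial>sphere_measure) * (\<integral>\<^sup>+x. \<rho> (norm (x :: real ^ 'n)) \<partial>lborel)"
      by (rule nn_integral_polar) measurable
    also have "(\<integral>\<^sup>+x. \<rho> (norm (x :: real ^ 'n)) \<partial>lborel) = ennreal M"
      by (simp add: \<rho>[symmetric] M(1)[symmetric] nn_integral_gauss)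
    finally show ?thesis .
  qed
  have int2: "integrable gauss (\<lambda>x. A (sgn x) * (norm x)\<^sup>2)"
  proof (rule integrableI_bounded)
    have "(\<integral>\<^sup>+x. ennreal (norm (A (sgn x) * (norm x)\<^sup>2)) \<partial>gauss) = (\<integral>\<^sup>+x. ennreal (norm (A x)) \<partial>sphere_measure) * ennreal M"
      using nn[of "\<lambda>x. norm (A x)"] by (simp add: abs_mult)
    also have "\<dots> < \<infinity>" using int by (auto simp: integrable_iff_bounded ennreal_mult_less_top)
    finally show "(\<integral>\<^sup>+x. ennreal (norm (A (sgn x) * (norm x)\<^sup>2)) \<partial>gauss) < \<infinity>" .
  qed measurable
  have "(\<integral>x. A (sgn x) * (norm x)\<^sup>2 \<partial>gauss) = enn2real ((\<integral>\<^sup>+x. ennreal (A x) \<partial>sphere_measure) * ennreal M) -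
      enn2real ((\<integral>\<^sup>+x. ennreal (- A x) \<partial>sphere_measure) * ennreal M)"
    unfolding real_lebesgue_integral_def[OF int2] using nn[of A] nn[of "\<lambda>x. - A x"] by simp
  also have "\<dots> = (\<integral>x. A x \<partial>sphere_measure) * M"
    unfolding real_lebesgue_integral_def[OF int] using M(2) by (simp add: enn2real_mult left_diff_distrib)
  finally show ?thesis by (simp add: M_def)
qed

text \<open>Integrating the 1-homogeneous function \<open>x \<mapsto> norm x * h (sgn x)\<close> by parts against the Gaussian
  avoids any singularity at the origin, whatever the degree of \<open>h\<close>.\<close>

lemma sphere_integral_gradient_zero:
  fixes h :: "real ^ 'n \<Rightarrow> real"
  assumes h: "C1_punctured h h'" and hom: "homogeneous m h"
    and zero: "(\<integral>x. x $ i * h x \<partial>sphere_measure) = 0"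
  shows "(\<integral>x. h' x $ i \<partial>sphere_measure) = 0"
proof -
  note c = C1_punctured_continuous[OF h]
  define Q where "Q x = norm x * h (sgn x)" for x
  define U where "U x = norm x *\<^sub>R radial_grad h' x + h (sgn x) *\<^sub>R sgn x" for x
  \<comment> \<open>The i-th partial derivative of \<open>Q\<close> at a unit vector: tangential
    gradient plus radial term, where Euler's identity turns the radial derivative of
    \<open>h\<close> into m h.\<close>
  define A where "A x = h' x $ i + (1 - m) * (x $ i * h x)" for x
  obtain B where B: "B \<ge> 0" "\<And>x. norm (h (sgn x)) \<le> B" using bounded_on_sphere[OF c(1)] by blast
  obtain C where C: "C \<ge> 0" "\<And>x y. x \<noteq> 0 \<Longrightarrow> \<bar>h (sgn y) - h (sgn x)\<bar> \<le> C * norm (y - x) / norm x"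
    using radial_ext_lipschitz[OF h] by blast
  have [measurable]: "h \<in> borel_measurable borel" "h' \<in> borel_measurable borel"
    using c by (auto intro: borel_measurable_punctured)
  have [measurable]: "radial_grad h' \<in> borel_measurable borel"
    using c by (auto intro: borel_measurable_punctured continuous_on_radial_grad)
  have cA: "continuous_on (- {0}) A" unfolding A_def[abs_def] by (intro continuous_intros c)
  have [measurable]: "A \<in> borel_measurable borel" by (rule borel_measurable_punctured[OF cA])
  have Q: "Q \<in> borel_measurable borel" and U: "U \<in> borel_measurable borel"
    unfolding Q_def[abs_def] U_def[abs_def] by measurable
  have growth: "\<bar>Q x\<bar> \<le> B * (1 + norm x)" for x
  proof -
    have "\<bar>Q x\<bar> \<le> norm x * B" unfolding Q_def abs_mult using B by (intro mult_mono) auto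
    also have "\<dots> \<le> B * (1 + norm x)" using B(1) by (simp add: algebra_simps)
    finally show ?thesis .
  qed
  have deriv: "AE x in gauss. (Q has_derivative (\<lambda>k. U x \<bullet> k)) (at x)"
    using AE_gauss_neq[of 0]
  proof eventually_elim
    case (elim x)
    have "(norm has_derivative (\<lambda>k. sgn x \<bullet> k)) (at x)"
      using GDERIV_norm[OF elim] by (simp add: gderiv_def inner_commute)
    from has_derivative_mult[OF this radial_ext_has_derivative[OF h elim]]
    show ?case by (simp add: Q_def[abs_def] U_def inner_add_left mult.commute)
  qed
  \<comment> \<open>The factor \<open>norm x\<close> in \<open>Q\<close> cancels the 1 / norm x in
    the Lipschitz bound of the radial extension, so a constant majorant works.\<close>
  have dom: "AE x in gauss. \<bar>Q (x + t *\<^sub>R axis i 1) - Q x\<bar> \<le> \<bar>t\<bar> * (B + C)" for t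
    using AE_gauss_neq[of 0]
  proof eventually_elim
    case (elim x)
    let ?y = "x + t *\<^sub>R axis i 1"
    have d: "norm (?y - x) = \<bar>t\<bar>" by simp
    have "\<bar>Q ?y - Q x\<bar> = \<bar>(norm ?y - norm x) * h (sgn ?y) + norm x * (h (sgn ?y) - h (sgn x))\<bar>"
      by (simp add: Q_def algebra_simps)
    also have "\<dots> \<le> \<bar>norm ?y - norm x\<bar> * \<bar>h (sgn ?y)\<bar> + norm x * \<bar>h (sgn ?y) - h (sgn x)\<bar>"
      by (rule order_trans[OF abs_triangle_ineq]) (simp add: abs_mult)
    also have "\<dots> \<le> \<bar>t\<bar> * B + norm x * (C * \<bar>t\<bar> / norm x)"
      using norm_triangle_ineq3[of ?y x] C(2)[OF elim, of ?y] B(2)[of ?y] unfolding d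
      by (intro add_mono mult_mono) auto
    also have "\<dots> = \<bar>t\<bar> * (B + C)" using elim by (simp add: algebra_simps)
    finally show ?case .
  qed
  have UA: "U x \<bullet> axis i 1 = A (sgn x)" if x: "x \<noteq> 0" for x
  proof -
    have "h' (sgn x) \<bullet> sgn x = m * h (sgn x)"
      by (rule homogeneous_euler[OF h hom]) (use x in \<open>simp add: sgn_zero_iff\<close>)
    then show ?thesis using x
      by (simp add: U_def A_def radial_grad_def inner_axis inner_axis' inner_commute algebra_simps)
  qed
  have "(\<integral>x. A x \<partial>sphere_measure) = (\<integral>x. A (sgn x) \<partial>gauss)"
    by (simp add: integral_gauss_sgn integrable_sphere_punctured[OF cA])
  also have "\<dots> = (\<integral>x. U x \<bullet> axis i 1 \<partial>gauss)"
    using U by (intro integral_cong_AE) (use UA AE_gauss_neq[of "0::real^'n"] in auto)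
  also have "\<dots> = (\<integral>x. Q x * (x \<bullet> axis i 1) \<partial>gauss)"
    by (rule gauss_integral_by_parts(2)[OF Q U growth deriv dom]) simp_all
  also have "\<dots> = (\<integral>x. (sgn x $ i * h (sgn x)) * (norm x)\<^sup>2 \<partial>gauss)"
  proof (rule Bochner_Integration.integral_cong[OF refl])
    fix x :: "real ^ 'n"
    have "x $ i = norm x * (sgn x $ i)" by (cases "x = 0") (simp_all add: sgn_div_norm)
    then show "Q x * (x \<bullet> axis i 1) = (sgn x $ i * h (sgn x)) * (norm x)\<^sup>2"
      by (simp add: Q_def inner_axis power2_eq_square)
  qed
  also have "\<dots> = 0"
    using integral_gauss_sgn_norm2[of "\<lambda>x. x $ i * h x"] zero by (simp add: continuous_intros c)
  finally show ?thesis
    using zero by (simp add: A_def integrable_sphere_punctured continuous_intros c)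
qed

section \<open>Orthogonality to polynomials passes to derivatives\<close>

lemma C1_punctured_iter_partial_deriv:
  assumes f: "C_smooth_on d (UNIV - {0}) f" and "length is < d"
  shows "C1_punctured (iter_partial_deriv is f) (\<lambda>x. \<chi> i. iter_partial_deriv (i # is) f x)"
proof (rule C1_punctured_partials)
  show "((\<lambda>t. iter_partial_deriv is f (x + t *\<^sub>R axis i 1)) has_real_derivative iter_partial_deriv (i # is) f x) (at 0)"
    if "x \<noteq> 0" for i x
  proof -
    have "(\<lambda>t. iter_partial_deriv is f (x + t *\<^sub>R axis i 1)) differentiable (at 0)"
      using f assms(2) that by (auto simp: C_smooth_on_def)
    then show ?thesis by (simp add: partial_deriv_def DERIV_deriv_iff_real_differentiable)
  qed
  have "length (i # is) \<le> d" for i using assms(2) by simp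
  then show "continuous_on (- {0}) (iter_partial_deriv (i # is) f)" for i
    using f unfolding C_smooth_on_def Compl_eq_Diff_UNIV by blast
qed

lemma continuous_on_iter_partial_deriv:
  "C_smooth_on d (UNIV - {0}) f \<Longrightarrow> length is \<le> d \<Longrightarrow> continuous_on (- {0}) (iter_partial_deriv is f)"
  unfolding C_smooth_on_def Compl_eq_Diff_UNIV by blast

lemma homogeneous_iter_partial_deriv:
  assumes f: "C_smooth_on d (UNIV - {0}) f" and hom: "homogeneous p f"
  shows "length is \<le> d \<Longrightarrow> homogeneous (p - real (length is)) (iter_partial_deriv is f)"
proof (induction "is")
  case Nil
  then show ?case using hom by simp
next
  case (Cons i js)
  then have "length js < d" by simp
  note c1 = C1_punctured_iter_partial_deriv[OF f this]
  have IH: "homogeneous (p - real (length js)) (iter_partial_deriv js f)" using Cons by simp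
  show ?case
    unfolding homogeneous_def
  proof (intro allI impI)
    fix x :: "real ^ 'a" and l :: real assume "x \<noteq> 0" "l > 0"
    from arg_cong[OF homogeneous_gradient[OF c1 IH this], of "\<lambda>v. v $ i"]
    show "iter_partial_deriv (i # js) f (l *\<^sub>R x) = l powr (p - real (length (i # js))) * iter_partial_deriv (i # js) f x"
      by (simp add: diff_diff_eq add.commute)
  qed
qed

text \<open>Monomials are indexed by lists, as iterated partial derivatives are: multiplying by a
  coordinate is prepending, so an index can move from one list to the other in an induction.\<close>

definition coord_monomial :: "'n list \<Rightarrow> real ^ 'n \<Rightarrow> real" where
  "coord_monomial js x = (\<Prod>j\<leftarrow>js. x $ j)"

lemma coord_monomial_simps [simp]:
  "coord_monomial [] x = 1" "coord_monomial (j # js) x = x $ j * coord_monomial js x"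
  by (simp_all add: coord_monomial_def)

fun coord_monomial_partial :: "'n \<Rightarrow> 'n list \<Rightarrow> real ^ 'n \<Rightarrow> real" where
  "coord_monomial_partial i [] x = 0"
| "coord_monomial_partial i (j # js) x =
     (if i = j then coord_monomial js x else 0) + x $ j * coord_monomial_partial i js x"

lemma C1_punctured_coord_monomial:
  "C1_punctured (coord_monomial js) (\<lambda>x. \<chi> i. coord_monomial_partial i js x)"
proof (induction js)
  case Nil
  have "coord_monomial [] = (\<lambda>x. 1)" by (simp add: fun_eq_iff)
  moreover have "(\<chi> i. 0) = (0 :: real ^ 'a)" by (simp add: vec_eq_iff)
  ultimately show ?case by (simp add: C1_punctured_def)
next
  case (Cons j js)
  have "C1_punctured (\<lambda>x. x $ j) (\<lambda>x. axis j 1)"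
    by (auto simp: C1_punctured_def inner_axis' intro!: bounded_linear_imp_has_derivative bounded_linear_vec_nth)
  from C1_punctured_mult[OF this Cons]
  have "C1_punctured (coord_monomial (j # js)) (\<lambda>x. x $ j *\<^sub>R (\<chi> i. coord_monomial_partial i js x) + coord_monomial js x *\<^sub>R axis j 1)"
    unfolding coord_monomial_simps(2)[abs_def] .
  also have "(\<lambda>x. x $ j *\<^sub>R (\<chi> i. coord_monomial_partial i js x) + coord_monomial js x *\<^sub>R axis j 1) =
      (\<lambda>x. \<chi> i. coord_monomial_partial i (j # js) x)"
    by (auto simp: fun_eq_iff vec_eq_iff axis_def)
  finally show ?case .
qed

lemma continuous_on_coord_monomial:
  "continuous_on S (coord_monomial js)" "continuous_on S (coord_monomial_partial i js)"
proof -
  show *: "continuous_on S (coord_monomial js)" for js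
    by (induction js) (auto simp: coord_monomial_def[abs_def] intro!: continuous_intros)
  show "continuous_on S (coord_monomial_partial i js)"
  proof (induction js)
    case (Cons j js)
    have "coord_monomial_partial i (j # js) =
        (\<lambda>x. (if i = j then 1 else 0) * coord_monomial js x + x $ j * coord_monomial_partial i js x)"
      by (auto simp: fun_eq_iff)
    then show ?case using Cons * by (auto intro!: continuous_intros)
  qed (simp add: coord_monomial_partial.simps(1)[abs_def])
qed

lemma homogeneous_coord_monomial: "homogeneous (real (length js)) (coord_monomial js)"
proof (induction js)
  case (Cons j js)
  then show ?case by (auto simp: homogeneous_def powr_add algebra_simps)
qed (simp add: homogeneous_def)

lemma coord_monomial_poly_fun_le:
  fixes js :: "'n::finite list"
  assumes "length js \<le> k"
  shows "coord_monomial js \<in> poly_fun_le k"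
proof -
  let ?A = "{\<alpha> :: 'n \<Rightarrow> nat. (\<Sum>i\<in>UNIV. \<alpha> i) \<le> k}"
  \<comment> \<open>The finiteness derived from this matters: over an infinite index set the sum in
    \<open>poly_fun_le\<close> would be 0.\<close>
  have "?A \<subseteq> Pi\<^sub>E UNIV (\<lambda>_. {..k})"
  proof
    fix \<alpha> assume "\<alpha> \<in> ?A"
    then have "\<alpha> i \<le> k" for i using member_le_sum[of i UNIV \<alpha>] by simp
    then show "\<alpha> \<in> Pi\<^sub>E UNIV (\<lambda>_. {..k})" by auto
  qed
  then have fin: "finite ?A" by (rule finite_subset) (auto intro: finite_PiE)
  have len: "(\<Sum>i\<in>UNIV. count_list js i) = length js"
  proof (induction js)
    case (Cons j js)
    have "(\<Sum>i\<in>UNIV. count_list (j # js) i) = (\<Sum>i\<in>UNIV. count_list js i + (if i = j then 1 else 0))"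
      by (intro sum.cong) auto
    also have "\<dots> = Suc (\<Sum>i\<in>UNIV. count_list js i)" by (simp add: sum.distrib)
    finally show ?case using Cons by simp
  qed simp
  have eval: "(\<Prod>i\<in>UNIV. (x $ i) ^ count_list js i) = coord_monomial js x" for x :: "real ^ 'n"
  proof (induction js)
    case (Cons j js)
    have "(\<Prod>i\<in>UNIV. (x $ i) ^ count_list (j # js) i) = (\<Prod>i\<in>UNIV. (if i = j then x $ i else 1) * (x $ i) ^ count_list js i)"
      by (intro prod.cong) auto
    also have "\<dots> = x $ j * (\<Prod>i\<in>UNIV. (x $ i) ^ count_list js i)"
      by (simp add: prod.distrib)
    finally show ?case using Cons by simp
  qed simp
  show ?thesis
    unfolding poly_fun_le_def
  proof (intro CollectI exI[of _ "\<lambda>\<alpha>. if \<alpha> = count_list js then 1 else 0"] ext)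
    fix x :: "real ^ 'n"
    show "coord_monomial js x = (\<Sum>\<alpha> | (\<Sum>i\<in>UNIV. \<alpha> i) \<le> k. (if \<alpha> = count_list js then 1 else 0) * (\<Prod>i\<in>UNIV. (x $ i) ^ \<alpha> i))"
      using fin len assms by (simp add: if_distrib[of "\<lambda>c. c * _"] sum.delta' eval cong: if_cong)
  qed
qed

text \<open>By the product rule the derivative of a monomial of degree k + 1 is a sum of monomials
  of degree k. The factor \<open>ks\<close> collects the coordinates already passed, which is what
  makes the induction over \<open>js\<close> go through.\<close>

lemma integral_mult_monomial_partial_zero:
  fixes g :: "real ^ 'n \<Rightarrow> real"
  assumes g: "continuous_on (- {0}) g"
    and zero: "\<And>ks. length ks \<le> k \<Longrightarrow> (\<integral>x. g x * coord_monomial ks x \<partial>sphere_measure) = 0"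
  shows "length js + length ks \<le> Suc k \<Longrightarrow>
    (\<integral>x. g x * (coord_monomial_partial i js x * coord_monomial ks x) \<partial>sphere_measure) = 0"
proof (induction js arbitrary: ks)
  case (Cons j js)
  have int: "integrable sphere_measure (\<lambda>x. g x * h x)" if "continuous_on (- {0}) h" for h
    by (intro integrable_sphere_punctured continuous_intros g that)
  have m: "coord_monomial (js @ ks) x = coord_monomial js x * coord_monomial ks x" for x :: "real ^ 'n"
    by (simp add: coord_monomial_def)
  have "(\<integral>x. g x * (coord_monomial_partial i (j # js) x * coord_monomial ks x) \<partial>sphere_measure) =
     (\<integral>x. (if i = j then 1 else 0) * (g x * coord_monomial (js @ ks) x) +
        g x * (coord_monomial_partial i js x * coord_monomial (j # ks) x) \<partial>sphere_measure)"
    by (intro Bochner_Integration.integral_cong) (auto simp: m algebra_simps)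
  also have "\<dots> = (if i = j then 1 else 0) * (\<integral>x. g x * coord_monomial (js @ ks) x \<partial>sphere_measure) +
     (\<integral>x. g x * (coord_monomial_partial i js x * coord_monomial (j # ks) x) \<partial>sphere_measure)"
    by (subst Bochner_Integration.integral_add)
       (auto intro!: int continuous_intros continuous_on_coord_monomial integrable_mult_right simp del: coord_monomial_simps)
  also have "\<dots> = 0" using Cons.prems zero[of "js @ ks"] Cons.IH[of "j # ks"] by simp
  finally show ?case .
qed simp

text \<open>The i-th partial derivative of the product of \<open>iter_partial_deriv is f\<close> and
  a monomial has mean zero once the product itself is orthogonal to the i-th coordinate. This is the
  induction hypothesis with \<open>i\<close> prepended to \<open>js\<close>, so each derivative uses
  up one degree of orthogonality. The product rule leaves a second term, with a monomial of lower
  degree, which vanishes by induction as well.\<close>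

lemma iter_partial_deriv_orthogonal:
  fixes f :: "real ^ 'n \<Rightarrow> real"
  assumes f: "C_smooth_on d (UNIV - {0}) f" and hom: "homogeneous p f"
    and orth: "\<And>q. q \<in> poly_fun_le (d - 1) \<Longrightarrow> (\<integral>x. f x * q x \<partial>sphere_measure) = 0"
  shows "length is + length js < d \<Longrightarrow> (\<integral>x. iter_partial_deriv is f x * coord_monomial js x \<partial>sphere_measure) = 0"
proof (induction "is" arbitrary: js)
  case Nil
  then show ?case using orth coord_monomial_poly_fun_le[of js "d - 1"] by simp
next
  case (Cons i "is")
  let ?g = "iter_partial_deriv is f"
  have l: "length is < d" using Cons.prems by simp
  note c1 = C1_punctured_iter_partial_deriv[OF f l]
  have g: "continuous_on (- {0}) ?g" and g': "continuous_on (- {0}) (iter_partial_deriv (i # is) f)"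
    using l by (auto intro!: continuous_on_iter_partial_deriv[OF f] simp del: iter_partial_deriv.simps)
  have "homogeneous (p - real (length is) + real (length js)) (\<lambda>x. ?g x * coord_monomial js x)"
    using homogeneous_iter_partial_deriv[OF f hom, of "is"] homogeneous_coord_monomial[of js] l
    by (auto simp: homogeneous_def powr_add)
  moreover have "(\<integral>x. x $ i * (?g x * coord_monomial js x) \<partial>sphere_measure) = 0"
    using Cons.IH[of "i # js"] Cons.prems by (simp add: mult_ac)
  ultimately have "(\<integral>x. (?g x *\<^sub>R (\<chi> i. coord_monomial_partial i js x) +
       coord_monomial js x *\<^sub>R (\<chi> i. iter_partial_deriv (i # is) f x)) $ i \<partial>sphere_measure) = 0"
    by (rule sphere_integral_gradient_zero[OF C1_punctured_mult[OF c1 C1_punctured_coord_monomial]])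
  then have "(\<integral>x. ?g x * (coord_monomial_partial i js x * coord_monomial [] x) +
      iter_partial_deriv (i # is) f x * coord_monomial js x \<partial>sphere_measure) = 0"
    by (simp add: mult.commute[of "coord_monomial js _"])
  then have "(\<integral>x. ?g x * (coord_monomial_partial i js x * coord_monomial [] x) \<partial>sphere_measure) +
      (\<integral>x. iter_partial_deriv (i # is) f x * coord_monomial js x \<partial>sphere_measure) = 0"
    by (subst (asm) Bochner_Integration.integral_add)
       (auto intro!: integrable_sphere_punctured continuous_intros g g' continuous_on_coord_monomial
         simp del: iter_partial_deriv.simps coord_monomial_simps)
  moreover have "(\<integral>x. ?g x * (coord_monomial_partial i js x * coord_monomial [] x) \<partial>sphere_measure) = 0"
    by (rule integral_mult_monomial_partial_zero[OF g, of "length js"]) (use Cons in auto)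
  ultimately show ?case by simp
qed

lemma sum_lists_Suc:
  fixes F :: "'n::finite list \<Rightarrow> real"
  shows "(\<Sum>is | length is = Suc k. F is) = (\<Sum>is | length is = k. \<Sum>i\<in>UNIV. F (i # is))"
proof -
  have "(\<Sum>is | length is = k. \<Sum>i\<in>UNIV. F (i # is)) = (\<Sum>(is, i)\<in>{is. length is = k} \<times> UNIV. F (i # is))"
    by (rule sum.cartesian_product)
  also have "\<dots> = (\<Sum>is | length is = Suc k. F is)"
    by (rule sum.reindex_bij_witness[of _ "\<lambda>is. (tl is, hd is)" "\<lambda>(is, i). i # is"])
       (auto simp: length_Suc_conv)
  finally show ?thesis ..
qed

text \<open>Below order \<open>d\<close> every entry of the derivative has mean zero, and the
  squared gradients of the entries of order k add up to the squared Hilbert-Schmidt norm of order k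
  + 1. The Poincare constant is a parameter because the circle uses pi^2 in place of 1 / (n -
  2).\<close>

lemma sphere_HS_chain:
  fixes f :: "real ^ 'n \<Rightarrow> real"
  assumes f: "C_smooth_on d (UNIV - {0}) f" and hom: "homogeneous p f"
    and orth: "\<And>q. q \<in> poly_fun_le (d - 1) \<Longrightarrow> (\<integral>x. f x * q x \<partial>sphere_measure) = 0"
    and poincare: "\<And>(g :: real ^ 'n \<Rightarrow> real) g'. C1_punctured g g' \<Longrightarrow> (\<integral>x. g x \<partial>sphere_measure) = 0 \<Longrightarrow>
       (\<integral>x. (g x)\<^sup>2 \<partial>sphere_measure) \<le> \<Lambda> * (\<integral>x. (norm (g' x))\<^sup>2 \<partial>sphere_measure)"
    and HS: "deriv_HS_L2 d f \<le> 1" and \<Lambda>: "\<Lambda> \<ge> 0"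
  shows "k \<le> d \<Longrightarrow> (\<integral>x. (deriv_HS k f x)\<^sup>2 \<partial>sphere_measure) \<le> \<Lambda> ^ (d - k)"
proof (induction "d - k" arbitrary: k)
  case 0
  then have "k = d" by simp
  then show ?case using HS by (simp add: deriv_HS_L2_def real_sqrt_le_1_iff)
next
  case (Suc m)
  then have k: "k < d" by simp
  have HS2: "(deriv_HS k f x)\<^sup>2 = (\<Sum>is | length is = k. (iter_partial_deriv is f x)\<^sup>2)" for k x
    by (simp add: deriv_HS_def sum_nonneg)
  have int: "integrable sphere_measure (\<lambda>x. (iter_partial_deriv is f x)\<^sup>2)" if "length is \<le> d" for "is"
    by (intro integrable_sphere_punctured continuous_intros continuous_on_iter_partial_deriv[OF f that])
  have "(\<integral>x. (deriv_HS k f x)\<^sup>2 \<partial>sphere_measure) =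
      (\<Sum>is | length is = k. \<integral>x. (iter_partial_deriv is f x)\<^sup>2 \<partial>sphere_measure)"
    unfolding HS2 using k by (intro Bochner_Integration.integral_sum int) simp
  also have "\<dots> \<le> (\<Sum>is | length is = k. \<Lambda> * (\<Sum>i\<in>UNIV. \<integral>x. (iter_partial_deriv (i # is) f x)\<^sup>2 \<partial>sphere_measure))"
  proof (rule sum_mono)
    fix "is" :: "'n list" assume "is \<in> {is. length is = k}"
    then have l: "length is < d" using k by simp
    have "(\<integral>x. iter_partial_deriv is f x \<partial>sphere_measure) = 0"
      using iter_partial_deriv_orthogonal[OF f hom orth, of "is" "[]"] l by simp
    from poincare[OF C1_punctured_iter_partial_deriv[OF f l] this]
    have "(\<integral>x. (iter_partial_deriv is f x)\<^sup>2 \<partial>sphere_measure) \<le>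
       \<Lambda> * (\<integral>x. (norm (\<chi> i. iter_partial_deriv (i # is) f x))\<^sup>2 \<partial>sphere_measure)" .
    also have "(\<integral>x. (norm (\<chi> i. iter_partial_deriv (i # is) f x))\<^sup>2 \<partial>sphere_measure) =
       (\<integral>x. (\<Sum>i\<in>UNIV. (iter_partial_deriv (i # is) f x)\<^sup>2) \<partial>sphere_measure)"
      by (simp add: norm_vec_def L2_set_def sum_nonneg del: iter_partial_deriv.simps)
    also have "\<dots> = (\<Sum>i\<in>UNIV. \<integral>x. (iter_partial_deriv (i # is) f x)\<^sup>2 \<partial>sphere_measure)"
      using l by (intro Bochner_Integration.integral_sum int) simp
    finally show "(\<integral>x. (iter_partial_deriv is f x)\<^sup>2 \<partial>sphere_measure) \<le>
       \<Lambda> * (\<Sum>i\<in>UNIV. \<integral>x. (iter_partial_deriv (i # is) f x)\<^sup>2 \<partial>sphere_measure)" .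
  qed
  also have "\<dots> = \<Lambda> * (\<Sum>is | length is = Suc k. \<integral>x. (iter_partial_deriv is f x)\<^sup>2 \<partial>sphere_measure)"
    unfolding sum_lists_Suc by (rule sum_distrib_left[symmetric])
  also have "(\<Sum>is | length is = Suc k. \<integral>x. (iter_partial_deriv is f x)\<^sup>2 \<partial>sphere_measure) =
     (\<integral>x. (deriv_HS (Suc k) f x)\<^sup>2 \<partial>sphere_measure)"
    unfolding HS2 using k by (intro Bochner_Integration.integral_sum[symmetric] int) simp
  also have "\<Lambda> * \<dots> \<le> \<Lambda> * \<Lambda> ^ (d - Suc k)"
    using Suc k \<Lambda> by (intro mult_left_mono) auto
  also have "\<dots> = \<Lambda> ^ (d - k)" using k by (simp flip: power_Suc add: Suc_diff_Suc)
  finally show ?case .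
qed

section \<open>Operator norms of derivatives\<close>

definition unit_lists :: "nat \<Rightarrow> (real ^ 'n) list set" where
  "unit_lists k = {vs. length vs = k \<and> (\<forall>v \<in> set vs. norm v = 1)}"

text \<open>The derivative of order k + 1 with its first slot left open, read as a vector. It is
  also the gradient in \<open>x\<close> of the k-th derivative at fixed vectors
  \<open>vs\<close>.\<close>

definition deriv_form_grad :: "nat \<Rightarrow> (real ^ 'n \<Rightarrow> real) \<Rightarrow> (real ^ 'n) list \<Rightarrow> real ^ 'n \<Rightarrow> real ^ 'n" where
  "deriv_form_grad k f vs x =
     (\<Sum>is | length is = k. (\<Prod>j<k. (vs ! j) $ (is ! j)) *\<^sub>R (\<chi> i. iter_partial_deriv (i # is) f x))"

lemma deriv_form_Suc:
  "deriv_form (Suc k) f x (w # vs) = deriv_form_grad k f vs x \<bullet> w"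
proof -
  have "deriv_form (Suc k) f x (w # vs) =
     (\<Sum>is | length is = k. \<Sum>i\<in>UNIV. iter_partial_deriv (i # is) f x * (w $ i * (\<Prod>j<k. (vs ! j) $ (is ! j))))"
    unfolding deriv_form_def sum_lists_Suc by (simp add: prod.lessThan_Suc_shift del: prod.lessThan_Suc)
  also have "\<dots> = deriv_form_grad k f vs x \<bullet> w"
    by (simp add: deriv_form_grad_def inner_sum_left inner_vec_def sum_distrib_left mult_ac del: iter_partial_deriv.simps)
       (rule sum.swap)
  finally show ?thesis .
qed

lemma C1_punctured_deriv_form:
  assumes f: "C_smooth_on d (UNIV - {0}) f" and k: "k < d"
  shows "C1_punctured (\<lambda>x. deriv_form k f x vs) (deriv_form_grad k f vs)"
proof -
  have c1: "C1_punctured (iter_partial_deriv is f) (\<lambda>x. \<chi> i. iter_partial_deriv (i # is) f x)" if "length is = k" for "is"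
    using C1_punctured_iter_partial_deriv[OF f] k that by simp
  show ?thesis
    unfolding C1_punctured_def
  proof (intro conjI allI impI)
    show "continuous_on (- {0}) (deriv_form_grad k f vs)"
      unfolding deriv_form_grad_def[abs_def]
      by (intro continuous_on_sum continuous_on_scaleR continuous_on_const C1_punctured_continuous(2)[OF c1]) simp
    fix x :: "real ^ 'a" assume x: "x \<noteq> 0"
    have "((\<lambda>x. \<Sum>is | length is = k. iter_partial_deriv is f x * (\<Prod>j<k. (vs ! j) $ (is ! j))) has_derivative
       (\<lambda>h. \<Sum>is | length is = k. ((\<chi> i. iter_partial_deriv (i # is) f x) \<bullet> h) * (\<Prod>j<k. (vs ! j) $ (is ! j)))) (at x)"
      by (intro has_derivative_sum has_derivative_mult_left C1_puncturedD[OF c1 x]) simp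
    then show "((\<lambda>x. deriv_form k f x vs) has_derivative (\<lambda>h. deriv_form_grad k f vs x \<bullet> h)) (at x)"
      by (simp add: deriv_form_def deriv_form_grad_def inner_sum_left mult.commute del: iter_partial_deriv.simps)
  qed
qed

lemma sum_tensor_squares:
  fixes vs :: "(real ^ 'n) list"
  shows "length vs = k \<Longrightarrow>
    (\<Sum>is | length is = k. (\<Prod>j<k. (vs ! j) $ (is ! j))\<^sup>2) = (\<Prod>v\<leftarrow>vs. (norm v)\<^sup>2)"
proof (induction vs arbitrary: k)
  case (Cons v vs)
  then obtain m where k: "k = Suc m" "length vs = m" by auto
  have "(\<Sum>is | length is = k. (\<Prod>j<k. ((v # vs) ! j) $ (is ! j))\<^sup>2) =
      (\<Sum>is | length is = m. \<Sum>i\<in>UNIV. (v $ i)\<^sup>2 * (\<Prod>j<m. (vs ! j) $ (is ! j))\<^sup>2)"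
    unfolding k(1) sum_lists_Suc by (simp add: prod.lessThan_Suc_shift power_mult_distrib del: prod.lessThan_Suc)
  also have "\<dots> = (\<Sum>i\<in>UNIV. (v $ i)\<^sup>2) * (\<Sum>is | length is = m. (\<Prod>j<m. (vs ! j) $ (is ! j))\<^sup>2)"
    by (simp add: sum_distrib_left sum_distrib_right)
  also have "(\<Sum>i\<in>UNIV. (v $ i)\<^sup>2) = (norm v)\<^sup>2"
    by (simp add: norm_vec_def L2_set_def sum_nonneg)
  finally show ?case using Cons.IH[OF k(2)] by simp
qed simp

text \<open>Cauchy-Schwarz against a rank one tensor, whose Euclidean norm is the product of the
  norms of its factors. The coefficients are arbitrary so that differences of derivatives at two
  points are covered too.\<close>

lemma abs_tensor_le:
  fixes vs :: "(real ^ 'n) list"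
  assumes "vs \<in> unit_lists k"
  shows "\<bar>\<Sum>is | length is = k. a is * (\<Prod>j<k. (vs ! j) $ (is ! j))\<bar> \<le> sqrt (\<Sum>is | length is = k. (a is)\<^sup>2)"
proof -
  have "\<forall>v\<in>set us. norm v = 1 \<Longrightarrow> (\<Prod>v\<leftarrow>us. (norm v)\<^sup>2) = 1" for us :: "(real ^ 'n) list"
    by (induction us) auto
  then have "(\<Prod>v\<leftarrow>vs. (norm v)\<^sup>2) = 1"
    using assms by (simp add: unit_lists_def)
  with sum_tensor_squares[of vs k] assms
  have "(\<Sum>is | length is = k. (\<Prod>j<k. (vs ! j) $ (is ! j))\<^sup>2) = 1" by (simp add: unit_lists_def)
  with Cauchy_Schwarz_ineq_sum[of a "\<lambda>is. \<Prod>j<k. (vs ! j) $ (is ! j)" "{is. length is = k}"]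
  have "(\<Sum>is | length is = k. a is * (\<Prod>j<k. (vs ! j) $ (is ! j)))\<^sup>2 \<le> (\<Sum>is | length is = k. (a is)\<^sup>2)" by simp
  from real_sqrt_le_mono[OF this] show ?thesis by simp
qed

lemma abs_deriv_form_le_HS:
  "vs \<in> unit_lists k \<Longrightarrow> \<bar>deriv_form k f x vs\<bar> \<le> deriv_HS k f x"
  unfolding deriv_form_def deriv_HS_def by (rule abs_tensor_le)

lemma unit_lists_nonempty: "(unit_lists k :: (real ^ 'n) list set) \<noteq> {}"
proof -
  have "replicate k (axis undefined 1 :: real ^ 'n) \<in> unit_lists k" by (auto simp: unit_lists_def)
  then show ?thesis by blast
qed

lemma deriv_Op_eq: "deriv_Op k f x = (SUP vs \<in> unit_lists k. deriv_form k f x vs)"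
  by (simp add: deriv_Op_def unit_lists_def)

lemma deriv_form_le_Op:
  fixes vs :: "(real ^ 'n) list"
  assumes "vs \<in> unit_lists k"
  shows "deriv_form k f x vs \<le> deriv_Op k f x"
  unfolding deriv_Op_eq
proof (rule cSUP_upper[OF assms])
  show "bdd_above (deriv_form k f x ` unit_lists k)"
    using abs_deriv_form_le_HS[of _ k f x] by (intro bdd_aboveI2[of _ _ "deriv_HS k f x"]) (fastforce dest: abs_le_D1)
qed

lemma deriv_Op_le:
  "(\<And>vs. vs \<in> unit_lists k \<Longrightarrow> deriv_form k f x vs \<le> b) \<Longrightarrow> deriv_Op k f x \<le> b"
  unfolding deriv_Op_eq by (intro cSUP_least unit_lists_nonempty)

lemma deriv_Op_le_HS: "deriv_Op k f x \<le> deriv_HS k f x"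
  using abs_deriv_form_le_HS[of _ k f x] by (intro deriv_Op_le) (fastforce dest: abs_le_D1)

text \<open>Reversing the first vector reverses the sign of the form. This takes at least one slot:
  at order 0 the supremum is \<open>f x\<close>, which may be negative.\<close>

lemma abs_deriv_form_le_Op:
  assumes "vs \<in> unit_lists (Suc k)"
  shows "\<bar>deriv_form (Suc k) f x vs\<bar> \<le> deriv_Op (Suc k) f x"
proof -
  obtain w ws where vs: "vs = w # ws" using assms by (cases vs) (auto simp: unit_lists_def)
  have "(- w) # ws \<in> unit_lists (Suc k)" using assms by (auto simp: vs unit_lists_def)
  from deriv_form_le_Op[OF this, of f x] deriv_form_le_Op[OF assms, of f x]
  show ?thesis by (simp add: vs deriv_form_Suc abs_le_iff)
qed

lemma deriv_Op_nonneg: "deriv_Op (Suc k) f (x :: real ^ 'n) \<ge> 0"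
proof -
  obtain vs :: "(real ^ 'n) list" where "vs \<in> unit_lists (Suc k)" using unit_lists_nonempty by blast
  from abs_deriv_form_le_Op[OF this, of f x] show ?thesis by simp
qed

text \<open>A supremum of forms changes by no more than the forms do, uniformly over unit vectors;
  \<open>\<delta>\<close>, the Hilbert-Schmidt distance of the coefficients, bounds that
  change.\<close>

lemma continuous_on_deriv_Op:
  assumes f: "C_smooth_on d (UNIV - {0}) f" and k: "k \<le> d"
  shows "continuous_on (- {0}) (deriv_Op k f)"
proof -
  define \<delta> where "\<delta> x y = sqrt (\<Sum>is | length is = k. (iter_partial_deriv is f x - iter_partial_deriv is f y)\<^sup>2)" for x y
  have le: "deriv_Op k f x \<le> deriv_Op k f y + \<delta> x y" for x y
  proof (rule deriv_Op_le)
    fix vs :: "(real ^ 'a) list" assume vs: "vs \<in> unit_lists k"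
    have "deriv_form k f x vs - deriv_form k f y vs \<le> \<delta> x y"
      using abs_tensor_le[OF vs, of "\<lambda>is. iter_partial_deriv is f x - iter_partial_deriv is f y"]
      by (simp add: deriv_form_def \<delta>_def left_diff_distrib sum_subtractf abs_le_iff)
    with deriv_form_le_Op[OF vs, of f y] show "deriv_form k f x vs \<le> deriv_Op k f y + \<delta> x y" by simp
  qed
  have sym: "\<delta> x y = \<delta> y x" for x y by (simp add: \<delta>_def power2_commute)
  show ?thesis
    unfolding continuous_on_def
  proof
    fix x :: "real ^ 'a" assume x: "x \<in> - {0}"
    have lim: "(iter_partial_deriv is f \<longlongrightarrow> iter_partial_deriv is f x) (at x within - {0})" if "is \<in> {is. length is = k}" for "is"
    proof -
      have "length is \<le> d" using that k by simp
      from continuous_on_iter_partial_deriv[OF f this] show ?thesis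
        unfolding continuous_on_def by (rule bspec[OF _ x])
    qed
    have "((\<lambda>y. \<delta> y x) \<longlongrightarrow> \<delta> x x) (at x within - {0})"
      unfolding \<delta>_def by (intro tendsto_real_sqrt tendsto_sum tendsto_power tendsto_diff tendsto_const lim)
    then have "((\<lambda>y. \<delta> y x) \<longlongrightarrow> 0) (at x within - {0})" by (simp add: \<delta>_def)
    moreover have "norm (deriv_Op k f y - deriv_Op k f x) \<le> \<delta> y x" for y
      using le[of x y] le[of y x] unfolding sym[of x y] real_norm_def by linarith
    ultimately have "((\<lambda>y. deriv_Op k f y - deriv_Op k f x) \<longlongrightarrow> 0) (at x within - {0})"
      by (metis (no_types, lifting) Lim_null_comparison always_eventually)
    then show "(deriv_Op k f \<longlongrightarrow> deriv_Op k f x) (at x within - {0})"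
      by (rule LIM_zero_cancel)
  qed
qed

lemma norm_deriv_form_grad_le:
  fixes G :: "real ^ 'n"
  assumes "\<And>w. norm w = 1 \<Longrightarrow> G \<bullet> w \<le> deriv_Op (Suc k) f x"
  shows "norm G \<le> deriv_Op (Suc k) f x"
proof (cases "G = 0")
  case False
  have "norm G = G \<bullet> sgn G" using False by (simp add: sgn_div_norm dot_square_norm power2_eq_square)
  also have "\<dots> \<le> deriv_Op (Suc k) f x" using False by (intro assms) (simp add: norm_sgn)
  finally show ?thesis .
qed (simp add: deriv_Op_nonneg)

section \<open>Smooth approximation of the operator norm by log-sum-exp\<close>

lemma soft_max_bounds:
  fixes a :: "'a \<Rightarrow> real"
  assumes V: "finite V" "V \<noteq> {}" and \<beta>: "\<beta> > 0"
  defines "u \<equiv> ln (\<Sum>v\<in>V. exp (\<beta> * a v)) / \<beta>"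
  shows "v \<in> V \<Longrightarrow> a v \<le> u" and "(\<And>v. v \<in> V \<Longrightarrow> a v \<le> b) \<Longrightarrow> u \<le> b + ln (card V) / \<beta>"
proof -
  have pos: "(\<Sum>v\<in>V. exp (\<beta> * a v)) > 0" using V by (intro sum_pos) auto
  show "a v \<le> u" if "v \<in> V"
  proof -
    have "exp (\<beta> * a v) \<le> (\<Sum>v\<in>V. exp (\<beta> * a v))" using V that by (intro member_le_sum) auto
    then have "\<beta> * a v \<le> ln (\<Sum>v\<in>V. exp (\<beta> * a v))" using pos by (simp add: ln_ge_iff)
    then show ?thesis using \<beta> by (simp add: u_def field_simps)
  qed
  show "u \<le> b + ln (card V) / \<beta>" if "\<And>v. v \<in> V \<Longrightarrow> a v \<le> b"
  proof -
    have "(\<Sum>v\<in>V. exp (\<beta> * a v)) \<le> real (card V) * exp (\<beta> * b)"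
      using that \<beta> sum_bounded_above[of V "\<lambda>v. exp (\<beta> * a v)" "exp (\<beta> * b)"] by simp
    then have "ln (\<Sum>v\<in>V. exp (\<beta> * a v)) \<le> ln (real (card V) * exp (\<beta> * b))"
      using pos by (simp add: ln_mono)
    also have "\<dots> = ln (card V) + \<beta> * b" using V by (simp add: ln_mult card_gt_0_iff)
    finally show ?thesis using \<beta> by (simp add: u_def field_simps)
  qed
qed

text \<open>The gradient of log-sum-exp is an average of the gradients of the forms, with positive
  weights of total mass 1. Hence the operator norm of the next order bounds it, whatever
  \<open>V\<close> and \<open>\<beta>\<close> are.\<close>

lemma soft_max_deriv_form:
  fixes f :: "real ^ 'n \<Rightarrow> real"
  assumes f: "C_smooth_on d (UNIV - {0}) f" and k: "k < d"
    and V: "finite V" "V \<noteq> {}" "V \<subseteq> unit_lists k" and \<beta>: "\<beta> > 0"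
  obtains u' where "C1_punctured (\<lambda>x. ln (\<Sum>v\<in>V. exp (\<beta> * deriv_form k f x v)) / \<beta>) u'"
    "\<And>x. norm (u' x) \<le> deriv_Op (Suc k) f x"
proof -
  let ?E = "\<lambda>v x. exp (\<beta> * deriv_form k f x v)"
  have pos: "(\<Sum>v\<in>V. ?E v x) > 0" for x using V by (intro sum_pos) auto
  note c1 = C1_punctured_deriv_form[OF f k]
  define u' where "u' x = (1 / (\<Sum>v\<in>V. ?E v x)) *\<^sub>R (\<Sum>v\<in>V. ?E v x *\<^sub>R deriv_form_grad k f v x)" for x
  show ?thesis
  proof (rule that[of u'])
    show "C1_punctured (\<lambda>x. ln (\<Sum>v\<in>V. ?E v x) / \<beta>) u'"
      unfolding C1_punctured_def
    proof (intro conjI allI impI)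
      have cE: "continuous_on (- {0}) (?E v)" for v
        by (intro continuous_on_exp continuous_on_mult continuous_on_const C1_punctured_continuous(1)[OF c1])
      have "\<forall>x\<in>- {0}. (\<Sum>v\<in>V. ?E v x) \<noteq> 0" using pos by (metis less_irrefl)
      then show "continuous_on (- {0}) u'" unfolding u'_def[abs_def]
        by (intro continuous_on_scaleR continuous_on_divide continuous_on_sum continuous_on_const cE
            C1_punctured_continuous(2)[OF c1])
      fix x :: "real ^ 'n" assume x: "x \<noteq> 0"
      have "(?E v has_derivative (\<lambda>h. ?E v x * (\<beta> * (deriv_form_grad k f v x \<bullet> h)))) (at x)" for v
        using C1_puncturedD[OF c1 x, of v] by (auto intro!: derivative_eq_intros)
      then have "((\<lambda>x. \<Sum>v\<in>V. ?E v x) has_derivative (\<lambda>h. \<Sum>v\<in>V. ?E v x * (\<beta> * (deriv_form_grad k f v x \<bullet> h)))) (at x)"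
        by (rule has_derivative_sum)
      from has_derivative_ln[OF pos this]
      have "((\<lambda>x. ln (\<Sum>v\<in>V. ?E v x)) has_derivative
         (\<lambda>h. (\<Sum>v\<in>V. ?E v x * (\<beta> * (deriv_form_grad k f v x \<bullet> h))) * inverse (\<Sum>v\<in>V. ?E v x))) (at x)" .
      from has_derivative_divide'[OF this has_derivative_const[of \<beta>]] \<beta>
      have "((\<lambda>x. ln (\<Sum>v\<in>V. ?E v x) / \<beta>) has_derivative
         (\<lambda>h. (\<Sum>v\<in>V. ?E v x * (\<beta> * (deriv_form_grad k f v x \<bullet> h))) * inverse (\<Sum>v\<in>V. ?E v x) / \<beta>)) (at x)"
        by simp
      also have "(\<lambda>h. (\<Sum>v\<in>V. ?E v x * (\<beta> * (deriv_form_grad k f v x \<bullet> h))) * inverse (\<Sum>v\<in>V. ?E v x) / \<beta>) =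
          (\<lambda>h. u' x \<bullet> h)"
      proof
        fix h
        have "(\<Sum>v\<in>V. ?E v x * (\<beta> * (deriv_form_grad k f v x \<bullet> h))) = \<beta> * (\<Sum>v\<in>V. ?E v x * (deriv_form_grad k f v x \<bullet> h))"
          by (simp add: sum_distrib_left mult_ac)
        then show "(\<Sum>v\<in>V. ?E v x * (\<beta> * (deriv_form_grad k f v x \<bullet> h))) * inverse (\<Sum>v\<in>V. ?E v x) / \<beta> = u' x \<bullet> h"
          using \<beta> by (simp add: u'_def inner_sum_left divide_inverse)
      qed
      finally show "((\<lambda>x. ln (\<Sum>v\<in>V. ?E v x) / \<beta>) has_derivative (\<lambda>h. u' x \<bullet> h)) (at x)" .
    qed
    fix x
    show "norm (u' x) \<le> deriv_Op (Suc k) f x"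
    proof (rule norm_deriv_form_grad_le)
      fix w :: "real ^ 'n" assume w: "norm w = 1"
      have "(\<Sum>v\<in>V. ?E v x * (deriv_form_grad k f v x \<bullet> w)) \<le> (\<Sum>v\<in>V. ?E v x * deriv_Op (Suc k) f x)"
      proof (intro sum_mono mult_left_mono)
        fix v assume "v \<in> V"
        with V w have "w # v \<in> unit_lists (Suc k)" by (auto simp: unit_lists_def)
        from deriv_form_le_Op[OF this, of f x] show "deriv_form_grad k f v x \<bullet> w \<le> deriv_Op (Suc k) f x"
          by (simp add: deriv_form_Suc)
      qed simp
      also have "\<dots> = (\<Sum>v\<in>V. ?E v x) * deriv_Op (Suc k) f x" by (simp add: sum_distrib_right)
      finally show "u' x \<bullet> w \<le> deriv_Op (Suc k) f x"
        using pos[of x] by (simp add: u'_def inner_sum_left pos_divide_le_eq mult.commute)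
    qed
  qed
qed

text \<open>Directions of the nonzero points of a countable dense set are dense in the sphere.
  \<open>T\<close> is chosen before \<open>f\<close>, \<open>x\<close> and \<open>e\<close>, so its
  finite parts serve all points \<open>x\<close> at once.\<close>

lemma countable_dense_unit_lists:
  obtains T :: "(real ^ 'n) list set" where "countable T" "T \<noteq> {}" "T \<subseteq> unit_lists k"
    "\<And>f x vs e. vs \<in> unit_lists k \<Longrightarrow> e > 0 \<Longrightarrow> \<exists>ws \<in> T. deriv_form k f x vs - e < deriv_form k f x ws"
proof -
  obtain D :: "(real ^ 'n) set" where D: "countable D" "\<And>X. open X \<Longrightarrow> X \<noteq> {} \<Longrightarrow> \<exists>d\<in>D. d \<in> X"
    using countable_dense_exists by metis
  define S where "S = sgn ` (D - {0})"
  define T where "T = {vs. length vs = k \<and> set vs \<subseteq> S}"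
  have "countable (lists S)" using D(1) by (intro countable_lists) (auto simp: S_def)
  then have 1: "countable T" by (rule countable_subset[rotated]) (auto simp: T_def lists_eq_set)
  have 2: "T \<subseteq> unit_lists k" by (auto simp: T_def unit_lists_def S_def norm_sgn subset_iff image_iff Ball_def Bex_def)
  have approx: "\<exists>s. (\<forall>m. s m \<in> S) \<and> s \<longlonglongrightarrow> v" if v: "norm v = 1" for v
  proof -
    \<comment> \<open>Radii below 1 keep the approximating points away from 0, which has no
      direction.\<close>
    have "\<exists>d\<in>D. d \<in> ball v (1 / real (Suc (Suc m)))" for m by (rule D(2)) auto
    then obtain s where s: "\<And>m. s m \<in> D" "\<And>m. dist v (s m) < 1 / real (Suc (Suc m))" by (auto simp: Bex_def) metis
    have "s m \<noteq> 0" for m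
    proof
      assume "s m = 0"
      then have "1 < 1 / real (Suc (Suc m))" using s(2)[of m] v by simp
      then show False by simp
    qed
    then have "sgn (s m) \<in> S" for m using s(1) by (auto simp: S_def)
    moreover have "s \<longlonglongrightarrow> v"
    proof (rule metric_LIMSEQ_I)
      fix e :: real assume "e > 0"
      then obtain N where N: "1 / real (Suc N) < e" using nat_approx_posE by blast
      have "dist (s m) v < e" if "m \<ge> N" for m
      proof -
        have "dist (s m) v < 1 / real (Suc (Suc m))" using s(2)[of m] by (simp add: dist_commute)
        also have "\<dots> \<le> 1 / real (Suc N)" using that by (intro divide_left_mono) auto
        finally show ?thesis using N by simp
      qed
      then show "\<exists>N. \<forall>m\<ge>N. dist (s m) v < e" by blast
    qed
    then have "(\<lambda>m. sgn (s m)) \<longlonglongrightarrow> sgn v" by (rule tendsto_sgn) (use v in auto)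
    moreover have "sgn v = v" using v by (simp add: sgn_div_norm)
    ultimately show ?thesis by (intro exI[of _ "\<lambda>m. sgn (s m)"]) simp
  qed
  have 3: "\<exists>ws \<in> T. deriv_form k f x vs - e < deriv_form k f x ws" if vs: "vs \<in> unit_lists k" and e: "e > 0" for f x vs e
  proof -
    have "\<forall>j. \<exists>s. j < k \<longrightarrow> (\<forall>m. s m \<in> S) \<and> s \<longlonglongrightarrow> vs ! j"
      using approx vs by (auto simp: unit_lists_def)
    then obtain s where s: "\<And>j m. j < k \<Longrightarrow> s j m \<in> S" "\<And>j. j < k \<Longrightarrow> s j \<longlonglongrightarrow> vs ! j" by metis
    define ws where "ws m = map (\<lambda>j. s j m) [0..<k]" for m
    have T: "ws m \<in> T" for m using s(1) by (auto simp: ws_def T_def)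
    have "(\<lambda>m. deriv_form k f x (ws m)) \<longlonglongrightarrow> deriv_form k f x vs"
      unfolding deriv_form_def
    proof (intro tendsto_sum tendsto_mult tendsto_const tendsto_prod)
      fix "is" :: "'n list" and j assume "j \<in> {..<k}"
      then have "(\<lambda>m. s j m $ (is ! j)) \<longlonglongrightarrow> vs ! j $ (is ! j)" using s(2) by (intro tendsto_vec_nth) auto
      then show "(\<lambda>m. ws m ! j $ (is ! j)) \<longlonglongrightarrow> vs ! j $ (is ! j)" using \<open>j \<in> {..<k}\<close> by (simp add: ws_def)
    qed
    from order_tendstoD(1)[OF this, of "deriv_form k f x vs - e"] e
    obtain m where "deriv_form k f x vs - e < deriv_form k f x (ws m)" by (auto simp: eventually_sequentially)
    with T show ?thesis by blast
  qed
  obtain vs :: "(real ^ 'n) list" where "vs \<in> unit_lists k" using unit_lists_nonempty by blast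
  from 3[OF this zero_less_one] have "T \<noteq> {}" by blast
  from that[OF 1 this 2 3] show ?thesis .
qed

section \<open>Iterating the moment inequality\<close>

lemma measure_sphere_measure_sphere [simp]:
  "measure sphere_measure (sphere 0 1 :: (real ^ 'n) set) = 1"
  using sphere.prob_space[where 'n = 'n] by simp

text \<open>Convexity of the power with weights a / (a + b) and b / (a + b). Integrated over
  functions of q-norm at most \<open>a\<close> and \<open>b\<close>, this becomes Minkowski's
  inequality.\<close>

lemma powr_add_le_weighted:
  fixes a b x y q :: real
  assumes "a > 0" "b > 0" "x \<ge> 0" "y \<ge> 0" and q: "q \<ge> 1"
  shows "(x + y) powr q \<le> (a + b) powr q * (a / (a + b) * (x / a) powr q + b / (a + b) * (y / b) powr q)"
proof -
  let ?s = "a + b"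
  have s: "?s > 0" using assms by simp
  \<comment> \<open>For the case that one summand is zero: the other is then controlled alone,
    because its weight c / (a + b) is at most 1 and q \<ge> 1.\<close>
  have single: "(z / ?s) powr q \<le> c / ?s * (z / c) powr q" if "0 < c" "c \<le> ?s" "z \<ge> 0" for c z
  proof -
    have "(z / ?s) powr q = (c / ?s) powr q * (z / c) powr q"
      using that s by (simp flip: powr_mult)
    also have "(c / ?s) powr q \<le> (c / ?s) powr 1"
      using that s q by (intro powr_mono') auto
    finally show ?thesis using that s by (simp add: mult_right_mono)
  qed
  have "((x + y) / ?s) powr q \<le> a / ?s * (x / a) powr q + b / ?s * (y / b) powr q"
  proof (cases "x = 0 \<or> y = 0")
    case True
    then show ?thesis using single[of a x] single[of b y] assms by auto
  next
    case False
    have "a / ?s + b / ?s = 1" using s by (simp flip: add_divide_distrib)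
    from convex_onD[OF powr_convex[OF q], of "b / ?s" "x / a" "y / b"] this
    have "((1 - b / ?s) *\<^sub>R (x / a) + (b / ?s) *\<^sub>R (y / b)) powr q \<le> (1 - b / ?s) * (x / a) powr q + b / ?s * (y / b) powr q"
      using False assms by simp
    moreover have "1 - b / ?s = a / ?s" using s by (simp add: field_simps)
    moreover have "(a / ?s) * (x / a) + (b / ?s) * (y / b) = (x + y) / ?s"
      using assms by (simp add: add_divide_distrib)
    ultimately show ?thesis by simp
  qed
  then have "?s powr q * ((x + y) / ?s) powr q \<le> ?s powr q * (a / ?s * (x / a) powr q + b / ?s * (y / b) powr q)"
    by (rule mult_left_mono) simp
  also have "?s powr q * ((x + y) / ?s) powr q = (x + y) powr q"
    using s assms by (simp flip: powr_mult)
  finally show ?thesis .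
qed

text \<open>Minkowski's inequality for a constant plus a function, phrased through bounds
  \<open>a\<close> and \<open>b\<close> on the two norms. Both bounds are divisors and thus
  positive, whereas the constant \<open>c\<close> may be 0.\<close>

lemma (in prob_space) integral_powr_add_const_le:
  fixes X Y :: "'a \<Rightarrow> real"
  assumes ab: "a > 0" "b > 0" and c: "0 \<le> c" "c \<le> a" and q: "q \<ge> 1"
    and X: "\<And>x. \<bar>X x\<bar> \<le> c + Y x" and Y: "\<And>x. Y x \<ge> 0"
    and int: "integrable M (\<lambda>x. Y x powr q)" and le: "(\<integral>x. Y x powr q \<partial>M) \<le> b powr q"
  shows "(\<integral>x. \<bar>X x\<bar> powr q \<partial>M) \<le> (a + b) powr q"
proof -
  let ?s = "a + b"
  let ?Z = "\<lambda>x. ?s powr q * (a / ?s + b / ?s * (Y x powr q / b powr q))"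
  have intZ: "integrable M ?Z" using int by simp
  have "(\<integral>x. \<bar>X x\<bar> powr q \<partial>M) \<le> (\<integral>x. ?Z x \<partial>M)"
  proof (rule integral_mono'[OF intZ])
    fix x
    have "\<bar>X x\<bar> powr q \<le> (a + Y x) powr q"
      using X[of x] c q by (intro powr_mono2) auto
    also have "\<dots> \<le> ?s powr q * (a / ?s * (a / a) powr q + b / ?s * (Y x / b) powr q)"
      by (rule powr_add_le_weighted) (use ab Y q in auto)
    also have "\<dots> = ?Z x" using ab Y by (simp add: powr_divide)
    finally show "\<bar>X x\<bar> powr q \<le> ?Z x" .
    then show "0 \<le> ?Z x" by (rule order_trans[rotated]) simp
  qed
  also have "(\<integral>x. ?Z x \<partial>M) = ?s powr q * (a / ?s + b / ?s * ((\<integral>x. Y x powr q \<partial>M) / b powr q))"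
    using int by (simp add: prob_space)
  also have "\<dots> \<le> ?s powr q * (a / ?s + b / ?s * 1)"
    using ab le by (intro mult_left_mono add_left_mono) (auto simp: pos_divide_le_eq)
  also have "\<dots> = ?s powr q" using ab by (simp flip: add_divide_distrib)
  finally show ?thesis .
qed

lemma sphere_integral_le_sqrt:
  fixes h :: "real ^ 'n \<Rightarrow> real"
  assumes h: "integrable sphere_measure h" and h2: "integrable sphere_measure (\<lambda>x. (h x)\<^sup>2)"
  shows "(\<integral>x. h x \<partial>sphere_measure) \<le> sqrt (\<integral>x. (h x)\<^sup>2 \<partial>sphere_measure)"
proof -
  have "0 \<le> sphere.variance h" by (rule sphere.variance_positive)
  then have "(\<integral>x. h x \<partial>sphere_measure)\<^sup>2 \<le> (\<integral>x. (h x)\<^sup>2 \<partial>sphere_measure)"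
    by (simp add: sphere.variance_eq[OF h h2])
  then show ?thesis by (rule real_le_rsqrt)
qed

lemma powr_tendsto_nonneg:
  fixes X :: "nat \<Rightarrow> real"
  assumes "X \<longlonglongrightarrow> a" "q > 0"
  shows "(\<lambda>m. \<bar>X m\<bar> powr q) \<longlonglongrightarrow> \<bar>a\<bar> powr q"
  by (intro tendsto_powr' tendsto_rabs tendsto_const assms) (use assms(2) in auto)

text \<open>Soft maxima over growing finite parts of a countable dense set: density gives the limit
  from below, the growth of \<open>\<beta>\<close> the limit from above.\<close>

lemma deriv_Op_soft_max_approx:
  fixes f :: "real ^ 'n \<Rightarrow> real"
  assumes f: "C_smooth_on d (UNIV - {0}) f" and k: "Suc k < d"
  obtains u u' where "\<And>m. C1_punctured (u m) (u' m)" "\<And>m x. norm (u' m x) \<le> deriv_Op (Suc (Suc k)) f x"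
    "\<And>m x. \<bar>u m x\<bar> \<le> deriv_Op (Suc k) f x + 1 / real (Suc m)" "\<And>x. (\<lambda>m. u m x) \<longlonglongrightarrow> deriv_Op (Suc k) f x"
proof -
  obtain T :: "(real ^ 'n) list set" where T: "countable T" "T \<noteq> {}" "T \<subseteq> unit_lists (Suc k)"
    "\<And>f x vs e. vs \<in> unit_lists (Suc k) \<Longrightarrow> e > 0 \<Longrightarrow> \<exists>ws \<in> T. deriv_form (Suc k) f x vs - e < deriv_form (Suc k) f x ws"
    by (rule countable_dense_unit_lists[of "Suc k"]) blast
  define V where "V m = from_nat_into T ` {..m}" for m
  have "V m \<subseteq> T" for m using from_nat_into[OF T(2)] by (auto simp: V_def)
  then have V: "finite (V m)" "V m \<noteq> {}" "V m \<subseteq> unit_lists (Suc k)" for m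
    using T(3) by (auto simp: V_def)
  \<comment> \<open>The logarithm of the number of vectors is at most m + 1, so this square leaves
    the error 1 / (m + 1).\<close>
  define \<beta> where "\<beta> m = (real (Suc m))\<^sup>2" for m
  have \<beta>: "\<beta> m > 0" for m by (simp add: \<beta>_def)
  define u where "u m x = ln (\<Sum>v\<in>V m. exp (\<beta> m * deriv_form (Suc k) f x v)) / \<beta> m" for m x
  have "\<exists>w. C1_punctured (u m) w \<and> (\<forall>x. norm (w x) \<le> deriv_Op (Suc (Suc k)) f x)" for m
    unfolding u_def[abs_def] by (rule soft_max_deriv_form[OF f k V \<beta>]) blast
  then obtain u' where u': "\<And>m. C1_punctured (u m) (u' m)" "\<And>m x. norm (u' m x) \<le> deriv_Op (Suc (Suc k)) f x" by metis
  have up: "u m x \<le> deriv_Op (Suc k) f x + 1 / real (Suc m)" for m x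
  proof -
    have "u m x \<le> deriv_Op (Suc k) f x + ln (card (V m)) / \<beta> m"
      unfolding u_def using V(3) by (intro soft_max_bounds V \<beta> deriv_form_le_Op) auto
    also have "ln (card (V m)) / \<beta> m \<le> real (Suc m) / \<beta> m"
    proof (rule divide_right_mono)
      have "card (V m) \<le> Suc m" unfolding V_def using card_image_le[of "{..m}"] by simp
      moreover have "card (V m) > 0" using V by (simp add: card_gt_0_iff)
      ultimately have "ln (card (V m)) \<le> ln (Suc m)" by simp
      also have "\<dots> \<le> real (Suc m)" by (rule ln_bound) simp
      finally show "ln (card (V m)) \<le> real (Suc m)" .
    qed (simp add: \<beta>_def)
    also have "real (Suc m) / \<beta> m = 1 / real (Suc m)" by (simp add: \<beta>_def power2_eq_square)
    finally show ?thesis by simp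
  qed
  have low: "deriv_form (Suc k) f x v \<le> u m x" if "v \<in> V m" for v m x
    unfolding u_def by (rule soft_max_bounds(1)[OF V(1,2) \<beta> that])
  \<comment> \<open>One form in the finite set is enough for a lower bound; it makes the estimate
    two-sided, as dominated convergence demands.\<close>
  have "- deriv_Op (Suc k) f x \<le> u m x" for m x
  proof -
    obtain v where v: "v \<in> V m" using V by blast
    then have "v \<in> unit_lists (Suc k)" using V by blast
    from abs_deriv_form_le_Op[OF this, of f x] low[OF v, of x] show ?thesis by linarith
  qed
  then have bd: "\<bar>u m x\<bar> \<le> deriv_Op (Suc k) f x + 1 / real (Suc m)" for m x
    using up[of m x] by (smt (verit) divide_nonneg_nonneg of_nat_0_le_iff zero_le_one)
  have "(\<lambda>m. u m x) \<longlonglongrightarrow> deriv_Op (Suc k) f x" for x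
  proof (rule LIMSEQ_I)
    fix e :: real assume e: "e > 0"
    then obtain N where N: "1 / real (Suc N) < e" using nat_approx_posE by blast
    have "\<exists>vs \<in> unit_lists (Suc k). deriv_Op (Suc k) f x - e / 2 < deriv_form (Suc k) f x vs"
    proof (rule ccontr)
      assume "\<not> ?thesis"
      then have "deriv_Op (Suc k) f x \<le> deriv_Op (Suc k) f x - e / 2"
        by (intro deriv_Op_le) (auto simp: not_less)
      with e show False by simp
    qed
    then obtain vs where vs: "vs \<in> unit_lists (Suc k)" "deriv_Op (Suc k) f x - e / 2 < deriv_form (Suc k) f x vs" by blast
    from T(4)[OF vs(1), of "e / 2" f x] e obtain ws where ws: "ws \<in> T" "deriv_form (Suc k) f x vs - e / 2 < deriv_form (Suc k) f x ws"
      by auto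
    obtain N' where N': "ws = from_nat_into T N'" using from_nat_into_surj[OF T(1) ws(1)] by blast
    have "norm (u m x - deriv_Op (Suc k) f x) < e" if m: "m \<ge> max N N'" for m
    proof -
      have "ws \<in> V m" using m by (auto simp: V_def N')
      from low[OF this, of x] ws(2) vs(2) have "deriv_Op (Suc k) f x - e < u m x" by simp
      moreover have "1 / real (Suc m) \<le> 1 / real (Suc N)" using m by (intro divide_left_mono) auto
      ultimately show ?thesis using up[of m x] N by (simp add: abs_less_iff)
    qed
    then show "\<exists>no. \<forall>m\<ge>no. norm (u m x - deriv_Op (Suc k) f x) < e" by blast
  qed
  then show ?thesis using that u' bd by blast
qed

lemma geometric_step:
  fixes K P :: real
  assumes "K \<ge> 0" "P \<ge> 0"
  shows "P ^ Suc m + K * (K + P) ^ m \<le> (K + P) ^ Suc m"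
proof -
  have "P ^ m \<le> (K + P) ^ m" using assms by (intro power_mono) auto
  then have "P * P ^ m \<le> P * (K + P) ^ m" using assms by (intro mult_left_mono) auto
  then show ?thesis by (simp add: algebra_simps)
qed

text \<open>Downward induction from the hypothesis at order \<open>d\<close>. Since the operator
  norm need not be differentiable, the moment inequality is applied to the centred soft maxima and
  the limit is taken afterwards.\<close>

lemma sphere_deriv_Op_moment:
  fixes f :: "real ^ 'n \<Rightarrow> real" and q :: real
  assumes n: "CARD('n) \<ge> 3" and f: "C_smooth_on d (UNIV - {0}) f" and hom: "homogeneous p f"
    and orth: "\<And>q. q \<in> poly_fun_le (d - 1) \<Longrightarrow> (\<integral>x. f x * q x \<partial>sphere_measure) = 0"
    and HS: "deriv_HS_L2 d f \<le> 1" and Op: "deriv_Op_Linf d f \<le> 1" and q: "q \<ge> 2"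
  defines "K \<equiv> sqrt ((q - 1) / (real CARD('n) - 2))" and "P \<equiv> sqrt (1 / (real CARD('n) - 2))"
  shows "Suc k \<le> d \<Longrightarrow> (\<integral>x. deriv_Op (Suc k) f x powr q \<partial>sphere_measure) \<le> ((K + P) ^ (d - Suc k)) powr q"
proof (induction "d - Suc k" arbitrary: k)
  case 0
  then have k: "d = Suc k" by simp
  have "AE x in sphere_measure. ereal \<bar>deriv_Op d f x\<bar> \<le> 1"
    using esssup_AE[of "\<lambda>x. ereal \<bar>deriv_Op d f x\<bar>" "sphere_measure :: (real ^ 'n) measure"]
    by eventually_elim (rule order_trans[OF _ Op[unfolded deriv_Op_Linf_def]])
  then have AE: "AE x in sphere_measure. deriv_Op (Suc k) f x powr q \<le> 1"
    using q deriv_Op_nonneg[of k f] by (auto simp: k elim!: eventually_mono intro!: powr_le1)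
  have "(\<integral>x. deriv_Op (Suc k) f x powr q \<partial>sphere_measure) \<le> (\<integral>x. 1 \<partial>(sphere_measure :: (real ^ 'n) measure))"
    using q deriv_Op_nonneg continuous_on_deriv_Op[OF f, of d]
    by (intro integral_mono_AE AE integrable_sphere_punctured continuous_on_nonneg_powr) (auto simp: k)
  then show ?case by (simp add: k)
next
  case (Suc m)
  then have k: "Suc k < d" and m: "d - Suc (Suc k) = m" "d - Suc k = Suc m" by auto
  have KP: "K > 0" "P > 0" using n q by (auto simp: K_def P_def)
  have q0: "q > 0" using q by simp
  define B where "B = K * (K + P) ^ m"
  have B: "B > 0" using KP by (simp add: B_def)
  let ?O = "deriv_Op (Suc k) f"
  have cO: "continuous_on (- {0}) ?O" and cO2: "continuous_on (- {0}) (deriv_Op (Suc (Suc k)) f)"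
    using k by (auto intro!: continuous_on_deriv_Op[OF f])
  obtain u u' where u: "\<And>m. C1_punctured (u m) (u' m)" "\<And>m x. norm (u' m x) \<le> deriv_Op (Suc (Suc k)) f x"
    "\<And>m x. \<bar>u m x\<bar> \<le> ?O x + 1 / real (Suc m)" "\<And>x. (\<lambda>m. u m x) \<longlonglongrightarrow> ?O x"
    by (rule deriv_Op_soft_max_approx[OF f k]) blast
  note cu = C1_punctured_continuous[OF u(1)]
  \<comment> \<open>Cauchy-Schwarz and the chain of Poincare inequalities: m + 1 levels separate
    this order from \<open>d\<close>, each worth a factor \<open>P\<close>.\<close>
  have mean_O: "(\<integral>x. ?O x \<partial>sphere_measure) \<le> P ^ Suc m"
  proof -
    have c: "continuous_on (- {0}) (deriv_HS (Suc k) f)"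
      unfolding deriv_HS_def[abs_def] using k
      by (intro continuous_intros continuous_on_iter_partial_deriv[OF f]) auto
    have "(\<integral>x. ?O x \<partial>sphere_measure) \<le> (\<integral>x. deriv_HS (Suc k) f x \<partial>sphere_measure)"
      by (intro integral_mono integrable_sphere_punctured cO c deriv_Op_le_HS)
    also have "\<dots> \<le> sqrt (\<integral>x. (deriv_HS (Suc k) f x)\<^sup>2 \<partial>sphere_measure)"
      by (intro sphere_integral_le_sqrt integrable_sphere_punctured continuous_intros c)
    also have "\<dots> \<le> sqrt ((1 / (real CARD('n) - 2)) ^ (d - Suc k))"
    proof (rule real_sqrt_le_mono, rule sphere_HS_chain[OF f hom orth _ HS])
      show "(\<integral>x. (g x)\<^sup>2 \<partial>sphere_measure) \<le> 1 / (real CARD('n) - 2) * (\<integral>x. (norm (g' x))\<^sup>2 \<partial>sphere_measure)"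
        if "C1_punctured g g'" "(\<integral>x. g x \<partial>sphere_measure) = 0" for g :: "real ^ 'n \<Rightarrow> real" and g'
        using sphere_poincare[OF n that] by simp
    qed (use n k in auto)
    also have "\<dots> = P ^ Suc m" unfolding m P_def by (rule real_sqrt_power)
    finally show ?thesis .
  qed
  \<comment> \<open>The mean of the soft maximum costs P^(m+1) plus the approximation error, its
    centred part costs \<open>B\<close>.\<close>
  have bound: "(\<integral>x. \<bar>u j x\<bar> powr q \<partial>sphere_measure) \<le> (P ^ Suc m + 1 / real (Suc j) + B) powr q" for j
  proof -
    define c where "c = (\<integral>x. u j x \<partial>sphere_measure)"
    have intu: "integrable sphere_measure (u j)" by (rule integrable_sphere_punctured[OF cu(1)])
    have c: "\<bar>c\<bar> \<le> P ^ Suc m + 1 / real (Suc j)"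
    proof -
      have "\<bar>c\<bar> \<le> (\<integral>x. \<bar>u j x\<bar> \<partial>sphere_measure)" unfolding c_def by (rule integral_abs_bound)
      also have "\<dots> \<le> (\<integral>x. ?O x + 1 / real (Suc j) \<partial>sphere_measure)"
        by (intro integral_mono integrable_sphere_punctured continuous_intros cO cu(1) u(3))
      also have "\<dots> = (\<integral>x. ?O x \<partial>sphere_measure) + 1 / real (Suc j)"
        by (subst Bochner_Integration.integral_add) (auto intro: integrable_sphere_punctured cO)
      finally show ?thesis using mean_O by simp
    qed
    have g: "C1_punctured (\<lambda>x. u j x - c) (u' j)"
    proof -
      have "((\<lambda>t. t - c) has_real_derivative 1) (at t)" for t by (auto intro!: derivative_eq_intros)
      from C1_punctured_compose[OF u(1)[of j] this] show ?thesis by simp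
    qed
    have "(\<integral>x. u j x - c \<partial>sphere_measure) = 0"
      using intu by (simp add: c_def)
    from sphere_moment_le[OF n g this q]
    have "(\<integral>x. \<bar>u j x - c\<bar> powr q \<partial>sphere_measure) \<le> K powr q * (\<integral>x. norm (u' j x) powr q \<partial>sphere_measure)"
      by (simp add: K_def)
    also have "(\<integral>x. norm (u' j x) powr q \<partial>sphere_measure) \<le> (\<integral>x. deriv_Op (Suc (Suc k)) f x powr q \<partial>sphere_measure)"
      using q0 deriv_Op_nonneg
      by (intro integral_mono integrable_sphere_punctured continuous_on_nonneg_powr continuous_on_norm cu(2) cO2 powr_mono2 u(2)) auto
    also have "\<dots> \<le> ((K + P) ^ m) powr q" using Suc.hyps(1)[of "Suc k"] k m by simp
    also have "K powr q * ((K + P) ^ m) powr q = B powr q" using KP by (simp add: B_def powr_mult)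
    finally have le: "(\<integral>x. \<bar>u j x - c\<bar> powr q \<partial>sphere_measure) \<le> B powr q" by (simp add: mult_left_mono)
    show ?thesis
    proof (rule sphere.integral_powr_add_const_le[where c = "\<bar>c\<bar>" and Y = "\<lambda>x. \<bar>u j x - c\<bar>"])
      show "integrable sphere_measure (\<lambda>x. \<bar>u j x - c\<bar> powr q)"
        using q0 by (intro integrable_sphere_punctured continuous_on_nonneg_powr continuous_intros cu(1)) auto
    qed (use KP B c q le in \<open>auto intro!: add_pos_pos\<close>)
  qed
  \<comment> \<open>The approximation error 1 / (j + 1) never exceeds 1, whence the
    majorant.\<close>
  have lim1: "(\<lambda>j. \<integral>x. \<bar>u j x\<bar> powr q \<partial>sphere_measure) \<longlonglongrightarrow> (\<integral>x. \<bar>?O x\<bar> powr q \<partial>sphere_measure)"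
  proof (rule integral_dominated_convergence[where w = "\<lambda>x. (?O x + 1) powr q"])
    have cp: "continuous_on (- {0}) (\<lambda>x. \<bar>u j x\<bar> powr q)" for j
      using q0 by (intro continuous_on_nonneg_powr continuous_intros cu(1)) auto
    show "(\<lambda>x. \<bar>u j x\<bar> powr q) \<in> borel_measurable sphere_measure" for j
      by (rule borel_measurable_sphere_measure[OF borel_measurable_punctured[OF cp]])
    have "continuous_on (- {0}) (\<lambda>x. \<bar>?O x\<bar> powr q)"
      using q0 by (intro continuous_on_nonneg_powr continuous_intros cO) auto
    then show "(\<lambda>x. \<bar>?O x\<bar> powr q) \<in> borel_measurable sphere_measure"
      by (rule borel_measurable_sphere_measure[OF borel_measurable_punctured])
    show "integrable sphere_measure (\<lambda>x. (?O x + 1) powr q)"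
      using q0 deriv_Op_nonneg[of k f] by (intro integrable_sphere_punctured continuous_on_nonneg_powr continuous_intros cO) (auto intro: add_nonneg_nonneg)
    show "AE x in sphere_measure. (\<lambda>j. \<bar>u j x\<bar> powr q) \<longlonglongrightarrow> \<bar>?O x\<bar> powr q"
      by (intro AE_I2 powr_tendsto_nonneg u(4) q0)
    show "AE x in sphere_measure. norm (\<bar>u j x\<bar> powr q) \<le> (?O x + 1) powr q" for j
    proof (intro AE_I2)
      fix x
      have "1 / real (Suc j) \<le> 1" by simp
      then have "\<bar>u j x\<bar> \<le> ?O x + 1" using u(3)[of j x] by linarith
      then show "norm (\<bar>u j x\<bar> powr q) \<le> (?O x + 1) powr q" using q0 by (simp add: powr_mono2)
    qed
  qed
  have "(\<lambda>j. 1 / real (Suc j)) \<longlonglongrightarrow> 0" by (rule LIMSEQ_Suc) (rule lim_1_over_n)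
  then have "(\<lambda>j. (P ^ Suc m + 1 / real (Suc j) + B) powr q) \<longlonglongrightarrow> (P ^ Suc m + 0 + B) powr q"
    using B KP by (intro tendsto_powr tendsto_add tendsto_const) (auto simp: add_pos_pos less_imp_neq[symmetric])
  from LIMSEQ_le[OF lim1 this] bound
  have "(\<integral>x. \<bar>?O x\<bar> powr q \<partial>sphere_measure) \<le> (P ^ Suc m + 0 + B) powr q" by blast
  also have "\<dots> \<le> ((K + P) ^ Suc m) powr q"
    using geometric_step[of K P m] KP B q0 by (intro powr_mono2) (auto simp: B_def)
  finally show ?case unfolding m using deriv_Op_nonneg[of k f] by simp
qed

text \<open>The last step concerns \<open>f\<close> itself, which has mean zero, hence one factor
  \<open>K\<close> without \<open>P\<close>. It stands apart from the induction because at order 0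
  the operator norm is the signed value of \<open>f\<close>.\<close>

lemma sphere_moment_iterated:
  fixes f :: "real ^ 'n \<Rightarrow> real" and q :: real
  assumes n: "CARD('n) \<ge> 3" and d: "d \<ge> 1" and f: "C_smooth_on d (UNIV - {0}) f" and hom: "homogeneous p f"
    and orth: "\<And>q. q \<in> poly_fun_le (d - 1) \<Longrightarrow> (\<integral>x. f x * q x \<partial>sphere_measure) = 0"
    and HS: "deriv_HS_L2 d f \<le> 1" and Op: "deriv_Op_Linf d f \<le> 1" and q: "q \<ge> 2"
  defines "K \<equiv> sqrt ((q - 1) / (real CARD('n) - 2))" and "P \<equiv> sqrt (1 / (real CARD('n) - 2))"
  shows "(\<integral>x. \<bar>f x\<bar> powr q \<partial>sphere_measure) \<le> (K * (K + P) ^ (d - 1)) powr q"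
proof -
  have KP: "K > 0" "P > 0" using n q by (auto simp: K_def P_def)
  have eq: "deriv_form 0 f x [] = f x" for x by (simp add: deriv_form_def)
  have c1: "C1_punctured f (deriv_form_grad 0 f [])"
    using C1_punctured_deriv_form[OF f, of 0 "[]"] d by (simp add: eq)
  have le: "norm (deriv_form_grad 0 f [] x) \<le> deriv_Op (Suc 0) f x" for x
    by (rule norm_deriv_form_grad_le) (auto simp flip: deriv_form_Suc intro!: deriv_form_le_Op simp: unit_lists_def)
  have cO: "continuous_on (- {0}) (deriv_Op (Suc 0) f)" using d by (intro continuous_on_deriv_Op[OF f]) simp
  have "(\<integral>x. f x \<partial>sphere_measure) = 0"
    using iter_partial_deriv_orthogonal[OF f hom orth, of "[]" "[]"] d by simp
  from sphere_moment_le[OF n c1 this q]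
  have "(\<integral>x. \<bar>f x\<bar> powr q \<partial>sphere_measure) \<le> K powr q * (\<integral>x. norm (deriv_form_grad 0 f [] x) powr q \<partial>sphere_measure)"
    by (simp add: K_def)
  also have "\<dots> \<le> K powr q * (\<integral>x. deriv_Op (Suc 0) f x powr q \<partial>sphere_measure)"
    using q deriv_Op_nonneg
    by (intro mult_left_mono integral_mono integrable_sphere_punctured continuous_on_nonneg_powr continuous_on_norm
        C1_punctured_continuous(2)[OF c1] cO powr_mono2 le) auto
  also have "\<dots> \<le> K powr q * ((K + P) ^ (d - 1)) powr q"
    using sphere_deriv_Op_moment[OF n f hom orth HS Op q, of 0] d
    by (intro mult_left_mono) (auto simp: K_def P_def)
  also have "\<dots> = (K * (K + P) ^ (d - 1)) powr q" using KP by (simp add: powr_mult)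
  finally show ?thesis .
qed

section \<open>The circle\<close>

context
  fixes a b :: "'n::finite"
  assumes ab: "a \<noteq> b" and univ: "(UNIV :: 'n set) = {a, b}"
begin

definition plane_point :: "real \<Rightarrow> real \<Rightarrow> real ^ 'n" where
  "plane_point p q = axis a p + axis b q"

definition plane_rotation :: "real \<Rightarrow> real ^ 'n \<Rightarrow> real ^ 'n" where
  "plane_rotation t x = plane_point (cos t * x $ a - sin t * x $ b) (sin t * x $ a + cos t * x $ b)"

lemma plane_point_nth [simp]: "plane_point p q $ a = p" "plane_point p q $ b = q"
  using ab by (auto simp: plane_point_def axis_def)

lemma plane_vec_eqI: "x $ a = y $ a \<Longrightarrow> x $ b = y $ b \<Longrightarrow> x = (y :: real ^ 'n)"
  unfolding vec_eq_iff using univ by (metis UNIV_I insertE singletonD)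

lemma plane_inner: "x \<bullet> y = x $ a * y $ a + x $ b * y $ b" for x y :: "real ^ 'n"
  unfolding inner_vec_def univ using ab by simp

lemma plane_norm: "(norm x)\<^sup>2 = (x $ a)\<^sup>2 + (x $ b)\<^sup>2" for x :: "real ^ 'n"
  unfolding power2_norm_eq_inner plane_inner by (simp add: power2_eq_square)

lemma norm_plane_rotation [simp]: "norm (plane_rotation t x) = norm x"
proof -
  have "(norm (plane_rotation t x))\<^sup>2 = ((cos t)\<^sup>2 + (sin t)\<^sup>2) * (norm x)\<^sup>2"
    unfolding plane_norm plane_rotation_def plane_point_nth
    by (simp add: power2_eq_square algebra_simps del: sin_cos_squared_add sin_cos_squared_add2 sin_cos_squared_add3)
  then show ?thesis by simp
qed

lemma plane_rotation_scaleR: "plane_rotation t (c *\<^sub>R x) = c *\<^sub>R plane_rotation t x"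
  by (rule plane_vec_eqI) (simp_all add: plane_rotation_def algebra_simps)

lemma sgn_plane_rotation: "sgn (plane_rotation t x) = plane_rotation t (sgn x)"
  by (simp add: sgn_div_norm plane_rotation_scaleR)

lemma plane_point_measurable [measurable]:
  assumes [measurable]: "f \<in> borel_measurable M" "g \<in> borel_measurable M"
  shows "(\<lambda>x. plane_point (f x) (g x)) \<in> borel_measurable M"
proof -
  have "plane_point p q = p *\<^sub>R axis a 1 + q *\<^sub>R axis b 1" for p q
    by (rule plane_vec_eqI) (use ab in \<open>auto simp: axis_def\<close>)
  then show ?thesis by simp
qed

lemma plane_rotation_measurable [measurable]:
  assumes [measurable]: "f \<in> borel_measurable M" "g \<in> borel_measurable M"
  shows "(\<lambda>x. plane_rotation (f x) (g x)) \<in> borel_measurable M"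
proof -
  have [measurable]: "(\<lambda>x. g x $ i) \<in> borel_measurable M" for i
    unfolding cart_eq_inner_axis by measurable
  show ?thesis unfolding plane_rotation_def
    by measurable
qed

text \<open>Makes \<open>lborel_rotation\<close>, which acts on pairs of points, available for
  vectors of the plane.\<close>

lemma nn_integral_plane:
  fixes f :: "real ^ 'n \<Rightarrow> ennreal"
  assumes [measurable]: "f \<in> borel_measurable borel"
  shows "(\<integral>\<^sup>+x. f x \<partial>lborel) = (\<integral>\<^sup>+p. \<integral>\<^sup>+q. f (plane_point p q) \<partial>lborel \<partial>lborel)"
proof -
  let ?M = "distr (lborel \<Otimes>\<^sub>M lborel) borel (\<lambda>z. plane_point (fst z) (snd z))"
  have Basis: "(Basis :: (real ^ 'n) set) = {axis a 1, axis b 1}"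
    unfolding Basis_vec_def using univ by auto
  have ne: "axis a 1 \<noteq> (axis b 1 :: real ^ 'n)" using ab by (simp add: axis_eq_axis)
  have "lborel = ?M"
  proof (rule lborel_eqI)
    fix l u :: "real ^ 'n" assume *: "\<And>b. b \<in> Basis \<Longrightarrow> l \<bullet> b \<le> u \<bullet> b"
    have le: "l $ a \<le> u $ a" "l $ b \<le> u $ b"
      using *[of "axis a 1"] *[of "axis b 1"] by (simp_all add: Basis inner_axis)
    have "(\<lambda>z. plane_point (fst z) (snd z)) -` box l u = {l $ a <..< u $ a} \<times> {l $ b <..< u $ b}"
      unfolding box_def Basis by (auto simp: inner_axis)
    then have "emeasure ?M (box l u) = emeasure (lborel \<Otimes>\<^sub>M lborel) ({l $ a <..< u $ a} \<times> {l $ b <..< u $ b})"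
      by (subst emeasure_distr) (auto simp: space_pair_measure)
    also have "\<dots> = ennreal (u $ a - l $ a) * ennreal (u $ b - l $ b)"
      using le by (subst lborel.emeasure_pair_measure_Times) auto
    also have "\<dots> = ennreal (\<Prod>c\<in>Basis. (u - l) \<bullet> c)"
      unfolding Basis using ne le by (simp add: inner_axis ennreal_mult)
    finally show "emeasure ?M (box l u) = ennreal (\<Prod>c\<in>Basis. (u - l) \<bullet> c)" .
  qed simp
  then have "(\<integral>\<^sup>+x. f x \<partial>lborel) = (\<integral>\<^sup>+x. f x \<partial>?M)" by simp
  also have "\<dots> = (\<integral>\<^sup>+z. f (plane_point (fst z) (snd z)) \<partial>(lborel \<Otimes>\<^sub>M lborel))"
    by (rule nn_integral_distr) measurable
  also have "\<dots> = (\<integral>\<^sup>+p. \<integral>\<^sup>+q. f (plane_point p q) \<partial>lborel \<partial>lborel)"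
    by (subst lborel.nn_integral_fst[symmetric]) auto
  finally show ?thesis .
qed

text \<open>The Gaussian density depends on the norm alone, so the invariance of Lebesgue measure
  carries over. The orientation of \<open>plane_rotation\<close> is matched by taking
  \<open>- sin t\<close> for the sine.\<close>

lemma nn_integral_sphere_plane_rotation:
  fixes A :: "real ^ 'n \<Rightarrow> ennreal"
  assumes [measurable]: "A \<in> borel_measurable borel"
  shows "(\<integral>\<^sup>+x. A (plane_rotation t (sgn x)) \<partial>gauss) = (\<integral>\<^sup>+x. A x \<partial>sphere_measure)"
proof -
  let ?\<Psi> = "\<lambda>z. ennreal (gauss_density (plane_point (fst z) (snd z))) * A (sgn (plane_point (fst z) (snd z)))"
  have gd: "gauss_density x = gauss_density (plane_rotation t x)" for x :: "real ^ 'n"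
    by (simp add: gauss_density_def)
  have rot: "plane_rotation t (plane_point p q) =
      plane_point (cos t *\<^sub>R p + (- sin t) *\<^sub>R q) (cos t *\<^sub>R q - (- sin t) *\<^sub>R p)" for p q
    by (simp add: plane_rotation_def add.commute)
  have "(\<integral>\<^sup>+x. A (plane_rotation t (sgn x)) \<partial>gauss) =
      (\<integral>\<^sup>+x. ennreal (gauss_density (plane_rotation t x)) * A (sgn (plane_rotation t x)) \<partial>lborel)"
    by (subst nn_integral_gauss) (simp_all add: sgn_plane_rotation gd[symmetric])
  also have "\<dots> = (\<integral>\<^sup>+p. \<integral>\<^sup>+q. ?\<Psi> (cos t *\<^sub>R p + (- sin t) *\<^sub>R q, cos t *\<^sub>R q - (- sin t) *\<^sub>R p) \<partial>lborel \<partial>lborel)"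
    by (subst nn_integral_plane, measurable) (simp only: rot fst_conv snd_conv)
  also have "\<dots> = (\<integral>\<^sup>+p. \<integral>\<^sup>+q. ?\<Psi> (p, q) \<partial>lborel \<partial>lborel)"
    by (rule lborel_rotation) auto
  also have "\<dots> = (\<integral>\<^sup>+x. ennreal (gauss_density x) * A (sgn x) \<partial>lborel)"
    by (subst nn_integral_plane) auto
  also have "\<dots> = (\<integral>\<^sup>+x. A x \<partial>sphere_measure)"
    by (subst nn_integral_gauss[symmetric]) (simp_all add: nn_integral_gauss_sgn)
  finally show ?thesis .
qed

lemma plane_rotation_surj:
  assumes "norm x = 1" "norm y = 1"
  obtains t where "0 \<le> t" "t \<le> 2 * pi" "y = plane_rotation t x"
proof -
  \<comment> \<open>Inner product and determinant of \<open>x\<close> and \<open>y\<close>, that is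
    cosine and sine of the angle from \<open>x\<close> to \<open>y\<close>.\<close>
  let ?c = "x $ a * y $ a + x $ b * y $ b" and ?s = "x $ a * y $ b - x $ b * y $ a"
  have n: "(x $ a)\<^sup>2 + (x $ b)\<^sup>2 = 1" "(y $ a)\<^sup>2 + (y $ b)\<^sup>2 = 1"
    using assms plane_norm[of x] plane_norm[of y] by auto
  have "?c\<^sup>2 + ?s\<^sup>2 = ((x $ a)\<^sup>2 + (x $ b)\<^sup>2) * ((y $ a)\<^sup>2 + (y $ b)\<^sup>2)"
    by (simp add: power2_eq_square algebra_simps)
  with n have "?c\<^sup>2 + ?s\<^sup>2 = 1" by simp
  from sincos_total_2pi_le[OF this] obtain t where t: "0 \<le> t" "t \<le> 2 * pi" "?c = cos t" "?s = sin t" by blast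
  have "cos t * x $ a - sin t * x $ b = ((x $ a)\<^sup>2 + (x $ b)\<^sup>2) * y $ a"
    "sin t * x $ a + cos t * x $ b = ((x $ a)\<^sup>2 + (x $ b)\<^sup>2) * y $ b"
    unfolding t(3,4)[symmetric] by (simp_all add: power2_eq_square algebra_simps)
  then have "y = plane_rotation t x" using n by (intro plane_vec_eqI) (simp_all add: plane_rotation_def)
  with t that show ?thesis by blast
qed

text \<open>The two arcs joining a pair of points make up the whole circle, so the oscillation is at most half
  of the total variation.\<close>

lemma circle_oscillation_le:
  fixes g :: "real ^ 'n \<Rightarrow> real"
  assumes g: "C1_punctured g g'" and x: "norm x = 1" and y: "norm y = 1" and z: "norm z = 1"
  shows "ennreal (2 * \<bar>g x - g y\<bar>) \<le> (\<integral>\<^sup>+t. ennreal (norm (g' (plane_rotation t z))) * indicator {0..2 * pi} t \<partial>lborel)"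
proof -
  define r where "r t = plane_rotation t z" for t
  define r' where "r' t = plane_rotation (t + pi / 2) z" for t
  define \<phi> where "\<phi> t = g (r t)" for t
  define G where "G t = norm (g' (r t))" for t
  have nr: "r t \<noteq> 0" for t using z norm_plane_rotation[of t z] by (auto simp: r_def simp del: norm_plane_rotation)
  have r_eq: "r t = cos t *\<^sub>R z + sin t *\<^sub>R plane_point (- z $ b) (z $ a)" for t
    by (rule plane_vec_eqI) (simp_all add: r_def plane_rotation_def)
  have r'_eq: "r' t = (- sin t) *\<^sub>R z + cos t *\<^sub>R plane_point (- z $ b) (z $ a)" for t
    by (rule plane_vec_eqI) (simp_all add: r'_def plane_rotation_def cos_add sin_add)
  have r_deriv: "(r has_derivative (\<lambda>h. h *\<^sub>R r' t)) (at t)" for t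
    unfolding r_eq[abs_def] r'_eq by (auto intro!: derivative_eq_intros simp: algebra_simps)
  have cr: "continuous_on UNIV r"
    by (intro continuous_at_imp_continuous_on ballI has_derivative_continuous[OF r_deriv])
  have cG: "continuous_on UNIV G"
    unfolding G_def[abs_def] using nr
    by (intro continuous_on_norm continuous_on_compose2[OF C1_punctured_continuous(2)[OF g] cr]) auto
  have \<phi>_deriv: "(\<phi> has_real_derivative (g' (r t) \<bullet> r' t)) (at t)" for t
    using has_derivative_compose[OF r_deriv C1_puncturedD[OF g nr]]
    by (simp add: \<phi>_def[abs_def] has_field_derivative_def mult.commute[of _ "_ \<bullet> _"] mult_commute_abs)
  have bound: "\<bar>g' (r t) \<bullet> r' t\<bar> \<le> G t" for t
    using Cauchy_Schwarz_ineq2[of "g' (r t)" "r' t"] z by (simp add: r'_def G_def)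
  \<comment> \<open>Integrating from -1, and using 2 pi < 8 on the other side, makes every angle of
    the closed interval from 0 to 2 pi an interior point, so that the derivative of \<open>I\<close>
    is two-sided.\<close>
  define I where "I t = integral {-1..t} G" for t
  have I_deriv: "(I has_real_derivative G t) (at t)" if "0 \<le> t" "t \<le> 2 * pi" for t
  proof -
    have "t < 8" using that pi_less_4 by simp
    have "(I has_real_derivative G t) (at t within {-1..8})"
      unfolding I_def using that \<open>t < 8\<close>
      by (intro integral_has_real_derivative continuous_on_subset[OF cG]) auto
    then show ?thesis using that \<open>t < 8\<close> by (simp add: at_within_Icc_at)
  qed
  have var: "\<bar>\<phi> t - \<phi> s\<bar> \<le> I t - I s" if st: "0 \<le> s" "s \<le> t" "t \<le> 2 * pi" for s t
  proof -
    have "I s - \<phi> s \<le> I t - \<phi> t"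
    proof (rule DERIV_nonneg_imp_nondecreasing[OF st(2)])
      fix w assume "s \<le> w" "w \<le> t"
      with st have "((\<lambda>w. I w - \<phi> w) has_real_derivative (G w - g' (r w) \<bullet> r' w)) (at w)"
        by (intro DERIV_diff I_deriv \<phi>_deriv) auto
      moreover have "0 \<le> G w - g' (r w) \<bullet> r' w" using bound[of w] by simp
      ultimately show "\<exists>y. ((\<lambda>w. I w - \<phi> w) has_real_derivative y) (at w) \<and> 0 \<le> y" by blast
    qed
    moreover have "I s + \<phi> s \<le> I t + \<phi> t"
    proof (rule DERIV_nonneg_imp_nondecreasing[OF st(2)])
      fix w assume "s \<le> w" "w \<le> t"
      with st have "((\<lambda>w. I w + \<phi> w) has_real_derivative (G w + g' (r w) \<bullet> r' w)) (at w)"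
        by (intro DERIV_add I_deriv \<phi>_deriv) auto
      moreover have "0 \<le> G w + g' (r w) \<bullet> r' w" using bound[of w] by simp
      ultimately show "\<exists>y. ((\<lambda>w. I w + \<phi> w) has_real_derivative y) (at w) \<and> 0 \<le> y" by blast
    qed
    ultimately show ?thesis by (simp add: abs_le_iff)
  qed
  have period: "\<phi> (2 * pi) = \<phi> 0" by (simp add: \<phi>_def r_eq)
  have osc: "2 * \<bar>\<phi> t - \<phi> s\<bar> \<le> I (2 * pi) - I 0" if "0 \<le> s" "s \<le> t" "t \<le> 2 * pi" for s t
  proof -
    have "\<bar>\<phi> t - \<phi> s\<bar> \<le> I t - I s" "\<bar>\<phi> s - \<phi> 0\<bar> \<le> I s - I 0" "\<bar>\<phi> (2 * pi) - \<phi> t\<bar> \<le> I (2 * pi) - I t"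
      using that by (auto intro!: var)
    note v = this
    have "\<bar>A\<bar> \<le> a \<Longrightarrow> \<bar>B\<bar> \<le> b \<Longrightarrow> \<bar>C\<bar> \<le> c \<Longrightarrow> A = - (B + C) \<Longrightarrow> 2 * \<bar>A\<bar> \<le> a + b + c" for A B C a b c :: real
      by linarith
    from this[OF v] period show ?thesis by simp
  qed
  obtain t where t: "0 \<le> t" "t \<le> 2 * pi" "x = r t"
    using plane_rotation_surj[OF z x] by (auto simp: r_def)
  obtain s where s: "0 \<le> s" "s \<le> 2 * pi" "y = r s"
    using plane_rotation_surj[OF z y] by (auto simp: r_def)
  have le: "2 * \<bar>g x - g y\<bar> \<le> I (2 * pi) - I 0"
    using osc[of s t] osc[of t s] s t by (cases "s \<le> t") (auto simp: \<phi>_def abs_minus_commute)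
  have "(\<integral>\<^sup>+t. ennreal (G t) * indicator {0..2 * pi} t \<partial>lborel) = ennreal (I (2 * pi) - I 0)"
  proof (rule nn_integral_FTC_Icc)
    show "G \<in> borel_measurable borel" by (rule borel_measurable_continuous_onI[OF cG])
    show "0 \<le> G t" for t by (simp add: G_def)
  qed (auto intro: I_deriv)
  with le show ?thesis by (simp add: G_def r_def ennreal_leI)
qed

text \<open>Averaging the previous bound over a uniformly distributed starting point
  \<open>z\<close> replaces the integral along the circle, by Fubini and rotation invariance, with 2
  pi times the spherical mean; the factor 2 on the left reduces this to pi.\<close>

lemma circle_oscillation_le_integral:
  fixes g :: "real ^ 'n \<Rightarrow> real"
  assumes g: "C1_punctured g g'" and x: "norm x = 1" and y: "norm y = 1"
  shows "\<bar>g x - g y\<bar> \<le> pi * (\<integral>z. norm (g' z) \<partial>sphere_measure)"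
proof -
  note c = C1_punctured_continuous[OF g]
  have [measurable]: "g' \<in> borel_measurable borel" by (rule borel_measurable_punctured[OF c(2)])
  interpret pair_sigma_finite "gauss :: (real ^ 'n) measure" "lborel :: real measure" ..
  let ?F = "\<lambda>z t. ennreal (norm (g' (plane_rotation t (sgn z)))) * indicator {0..2 * pi} t"
  have "ennreal (2 * \<bar>g x - g y\<bar>) = (\<integral>\<^sup>+z. ennreal (2 * \<bar>g x - g y\<bar>) \<partial>(gauss :: (real ^ 'n) measure))"
    using gauss.emeasure_space_1[where 'a = "real ^ 'n"] by simp
  also have "\<dots> \<le> (\<integral>\<^sup>+z. \<integral>\<^sup>+t. ?F z t \<partial>lborel \<partial>gauss)"
  proof (rule nn_integral_mono_AE)
    show "AE z in gauss. ennreal (2 * \<bar>g x - g y\<bar>) \<le> (\<integral>\<^sup>+t. ?F z t \<partial>lborel)"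
      using AE_gauss_neq[of 0]
      by eventually_elim (rule circle_oscillation_le[OF g x y], simp add: norm_sgn)
  qed
  also have "\<dots> = (\<integral>\<^sup>+t. \<integral>\<^sup>+z. ?F z t \<partial>gauss \<partial>lborel)"
    by (rule Fubini'[symmetric]) measurable
  also have "\<dots> = (\<integral>\<^sup>+t. (\<integral>\<^sup>+z. ennreal (norm (g' z)) \<partial>sphere_measure) * indicator {0..2 * pi} t \<partial>lborel)"
  proof (rule nn_integral_cong)
    fix t
    have "(\<integral>\<^sup>+z. ?F z t \<partial>gauss) = (\<integral>\<^sup>+z. ennreal (norm (g' (plane_rotation t (sgn z)))) \<partial>gauss) * indicator {0..2 * pi} t"
      by (rule nn_integral_multc) measurable
    also have "(\<integral>\<^sup>+z. ennreal (norm (g' (plane_rotation t (sgn z)))) \<partial>gauss) = (\<integral>\<^sup>+z. ennreal (norm (g' z)) \<partial>sphere_measure)"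
      by (rule nn_integral_sphere_plane_rotation) measurable
    finally show "(\<integral>\<^sup>+z. ?F z t \<partial>gauss) = (\<integral>\<^sup>+z. ennreal (norm (g' z)) \<partial>sphere_measure) * indicator {0..2 * pi} t" .
  qed
  also have "\<dots> = (\<integral>\<^sup>+z. ennreal (norm (g' z)) \<partial>sphere_measure) * ennreal (2 * pi)"
    by (simp add: nn_integral_cmult)
  also have "(\<integral>\<^sup>+z. ennreal (norm (g' z)) \<partial>sphere_measure) = ennreal (\<integral>z. norm (g' z) \<partial>sphere_measure)"
    by (intro nn_integral_eq_integral integrable_sphere_punctured continuous_on_norm c) simp
  finally have "ennreal (2 * \<bar>g x - g y\<bar>) \<le> ennreal ((\<integral>z. norm (g' z) \<partial>sphere_measure) * (2 * pi))"
    by (simp add: ennreal_mult)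
  then show ?thesis by (simp add: ennreal_le_iff mult_ac)
qed

text \<open>With mean zero, \<open>g x\<close> is the average over \<open>y\<close> of g x - g y.
  Cauchy-Schwarz then passes to the quadratic mean of the gradient.\<close>

lemma circle_bound:
  fixes g :: "real ^ 'n \<Rightarrow> real"
  assumes g: "C1_punctured g g'" and mean: "(\<integral>x. g x \<partial>sphere_measure) = 0" and x: "norm x = 1"
  shows "\<bar>g x\<bar> \<le> pi * sqrt (\<integral>z. (norm (g' z))\<^sup>2 \<partial>sphere_measure)"
proof -
  note c = C1_punctured_continuous[OF g]
  let ?b = "pi * (\<integral>z. norm (g' z) \<partial>sphere_measure)"
  have int: "integrable sphere_measure g" by (rule integrable_sphere_punctured[OF c(1)])
  have "g x = (\<integral>y. g x - g y \<partial>sphere_measure)" using int mean by simp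
  also have "\<bar>\<dots>\<bar> \<le> (\<integral>y. \<bar>g x - g y\<bar> \<partial>sphere_measure)" by (rule integral_abs_bound)
  also have "\<dots> \<le> (\<integral>y. ?b \<partial>(sphere_measure :: (real ^ 'n) measure))"
    using int by (intro integral_mono) (auto intro!: circle_oscillation_le_integral[OF g x])
  also have "\<dots> = ?b" by simp
  also have "\<dots> \<le> pi * sqrt (\<integral>z. (norm (g' z))\<^sup>2 \<partial>sphere_measure)"
    by (intro mult_left_mono sphere_integral_le_sqrt integrable_sphere_punctured continuous_intros c) simp
  finally show ?thesis .
qed

end

section \<open>Exponential integrability\<close>

lemma power_powr_divide:
  fixes x :: real
  assumes x: "x > 0" and d: "d \<ge> 1"
  shows "(x ^ d) powr (real k / real d) = x ^ k"
proof -
  have "(x ^ d) powr (real k / real d) = x powr (real d * (real k / real d))"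
    by (simp only: powr_realpow[OF x, symmetric] powr_powr)
  also have "real d * (real k / real d) = real k" using d by simp
  finally show ?thesis by (simp only: powr_realpow[OF x])
qed

section \<open>Numerical estimates for the circle\<close>

lemma pi_squared_le: "pi\<^sup>2 \<le> 12"
proof -
  \<comment> \<open>The inequality x \<le> tan x at pi / 6, where the tangent is 1 / sqrt 3, yields
    pi \<le> 2 sqrt 3.\<close>
  have "pi / 6 \<le> tan (pi / 6)"
  proof -
    have "\<exists>z>0. z < pi / 6 \<and> tan (pi / 6) - tan 0 = (pi / 6 - 0) * inverse ((cos z)\<^sup>2)"
    proof (rule MVT2)
      fix x assume "0 \<le> x" "x \<le> pi / 6"
      then have "- (pi / 2) < x" "x < pi / 2" using pi_gt_zero by linarith+
      then have "cos x > 0" by (rule cos_gt_zero_pi)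
      then show "(tan has_real_derivative inverse ((cos x)\<^sup>2)) (at x)" by (intro DERIV_tan) simp
    qed simp
    then obtain z where z: "0 < z" "z < pi / 6" "tan (pi / 6) = pi / 6 * inverse ((cos z)\<^sup>2)" by auto
    have "- (pi / 2) < z" "z < pi / 2" using z(1,2) pi_gt_zero by linarith+
    then have "cos z > 0" by (rule cos_gt_zero_pi)
    then have "1 \<le> inverse ((cos z)\<^sup>2)" by (simp add: one_le_inverse_iff power_le_one)
    from mult_left_mono[OF this, of "pi / 6"] z(3) show ?thesis by simp
  qed
  then have "pi \<le> 6 / sqrt 3" by (simp add: tan_30)
  then have "pi\<^sup>2 \<le> (6 / sqrt 3)\<^sup>2" by (intro power_mono) auto
  then show ?thesis by (simp add: power_divide)
qed

lemma exp_pi_squared_le: "exp (1 / (8 * exp 1) * pi\<^sup>2) \<le> (2::real)"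
proof -
  have e: "(5 / 2 :: real) \<le> exp 1" using exp_lower_Taylor_quadratic[of "1::real"] by simp
  \<comment> \<open>With e \<ge> 5/2 and pi^2 \<le> 12 the exponent is at most 12 / 20.\<close>
  have "1 / (8 * exp 1) * pi\<^sup>2 \<le> 1 / (8 * (5 / 2)) * (12 :: real)"
    using e pi_squared_le by (intro mult_mono divide_left_mono) auto
  also have "\<dots> = 3 / 5" by simp
  finally have "exp (1 / (8 * exp 1) * pi\<^sup>2) \<le> exp (3 / 5)"
    by (rule exp_le_cancel_iff[THEN iffD2])
  \<comment> \<open>Compare fifth powers: e^3 \<le> 27 < 32.\<close>
  moreover have "exp (3 / 5 :: real) \<le> 2"
  proof (rule power_le_imp_le_base)
    have "exp (3 / 5 :: real) ^ Suc 4 = exp 1 ^ 3" by (simp flip: exp_of_nat_mult)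
    also have "\<dots> \<le> 3 ^ 3" by (intro power_mono exp_le) auto
    finally show "exp (3 / 5 :: real) ^ Suc 4 \<le> 2 ^ Suc 4" by simp
  qed simp
  ultimately show ?thesis by (rule order_trans)
qed

lemma deriv_HS_0: "(deriv_HS 0 f x)\<^sup>2 = (f x)\<^sup>2"
  by (simp add: deriv_HS_def)

lemma deriv_HS_1: "(deriv_HS (Suc 0) f x)\<^sup>2 = (norm (\<chi> i. iter_partial_deriv [i] f x))\<^sup>2"
  unfolding deriv_HS_def sum_lists_Suc
  by (simp add: norm_vec_def L2_set_def sum_nonneg)

text \<open>Squared and integrated, the pointwise bound is a Poincare inequality with constant pi^2.
  It carries the control of the d-th derivative down to the first, and one more pointwise bound
  reaches \<open>f\<close>.\<close>

lemma circle_pointwise_bound: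
  fixes f :: "real ^ 'n \<Rightarrow> real"
  assumes n: "CARD('n) = 2" and d: "d \<ge> 1" and f: "C_smooth_on d (UNIV - {0}) f" and hom: "homogeneous p f"
    and orth: "\<And>q. q \<in> poly_fun_le (d - 1) \<Longrightarrow> (\<integral>x. f x * q x \<partial>sphere_measure) = 0"
    and HS: "deriv_HS_L2 d f \<le> 1" and x: "norm x = 1"
  shows "\<bar>f x\<bar> \<le> pi ^ d"
proof -
  obtain a b :: 'n where ab: "a \<noteq> b" "UNIV = {a, b}"
    using n by (metis card_2_iff)
  have poincare: "(\<integral>x. (g x)\<^sup>2 \<partial>sphere_measure) \<le> pi\<^sup>2 * (\<integral>x. (norm (g' x))\<^sup>2 \<partial>sphere_measure)"
    if g: "C1_punctured g g'" "(\<integral>x. g x \<partial>sphere_measure) = 0" for g :: "real ^ 'n \<Rightarrow> real" and g'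
  proof -
    let ?I = "\<integral>x. (norm (g' x))\<^sup>2 \<partial>sphere_measure"
    have "(g x)\<^sup>2 \<le> pi\<^sup>2 * ?I" if "norm x = 1" for x
    proof -
      have "\<bar>g x\<bar>\<^sup>2 \<le> (pi * sqrt ?I)\<^sup>2" using circle_bound[OF ab g that] by (intro power_mono) auto
      then show ?thesis by (simp add: power_mult_distrib)
    qed
    then have "(\<integral>x. (g x)\<^sup>2 \<partial>sphere_measure) \<le> (\<integral>x. pi\<^sup>2 * ?I \<partial>(sphere_measure :: (real ^ 'n) measure))"
      by (intro integral_mono integrable_sphere_punctured continuous_intros C1_punctured_continuous(1)[OF g(1)]) auto
    then show ?thesis by simp
  qed
  have "(\<integral>x. f x \<partial>sphere_measure) = 0"
    using iter_partial_deriv_orthogonal[OF f hom orth, of "[]" "[]"] d by simp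
  moreover have "C1_punctured f (\<lambda>x. \<chi> i. iter_partial_deriv [i] f x)"
    using C1_punctured_iter_partial_deriv[OF f, of "[]"] d by simp
  ultimately have "\<bar>f x\<bar> \<le> pi * sqrt (\<integral>x. (deriv_HS (Suc 0) f x)\<^sup>2 \<partial>sphere_measure)"
    unfolding deriv_HS_1 using circle_bound[OF ab _ _ x] by blast
  also have "\<dots> \<le> pi * sqrt ((pi\<^sup>2) ^ (d - Suc 0))"
    by (intro mult_left_mono real_sqrt_le_mono sphere_HS_chain[OF f hom orth poincare HS]) (use d in auto)
  also have "\<dots> = pi ^ d"
    using d by (simp add: real_sqrt_power flip: power_Suc)
  finally show ?thesis .
qed

section \<open>Power moments and the exponential series\<close>

lemma self_power_le_exp_fact: "real k ^ k \<le> exp (real k) * fact k"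
proof -
  have s: "(\<lambda>j. real k ^ j /\<^sub>R fact j) sums exp (real k)" by (rule exp_converges)
  \<comment> \<open>A single term of the series for exp k already gives the bound.\<close>
  have "(\<Sum>j\<in>{k}. real k ^ j /\<^sub>R fact j) \<le> (\<Sum>j. real k ^ j /\<^sub>R fact j)"
    by (rule sum_le_suminf[OF sums_summable[OF s]]) auto
  then have "real k ^ k / fact k \<le> exp (real k)" using sums_unique[OF s] by (simp add: divide_inverse mult.commute)
  then show ?thesis by (simp add: field_simps)
qed

text \<open>One has K^2 \<le> q / N \<le> 2 k / N. For d \<ge> 2 also (K + P)^2 \<le> 2 (K^2 + P^2)
  = 2 q / N \<le> 2 k / N, since q = 2 k / d \<le> k; for d = 1 the power of K + P is empty. So the
  square of the product is at most (2 k / N)^d, and raising it to k / d gives the claim.\<close>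

lemma iteration_constant_le:
  fixes N q :: real
  assumes N: "N > 0" and d: "d \<ge> 1" and q: "q = 2 * real k / real d" "q \<ge> 2"
  defines "K \<equiv> sqrt ((q - 1) / N)" and "P \<equiv> sqrt (1 / N)"
  shows "(K * (K + P) ^ (d - 1)) powr q \<le> (2 * real k / N) ^ k"
proof -
  have KP: "K > 0" "P > 0" using N q by (auto simp: K_def P_def)
  have k: "k > 0" using q d by (cases "k = 0") auto
  have K2: "K\<^sup>2 \<le> 2 * real k / N"
  proof -
    have "q \<le> 2 * real k" using d by (simp add: q(1) divide_le_eq mult_le_cancel_left1)
    then show ?thesis using N q(2) by (simp add: K_def divide_right_mono)
  qed
  have KP2: "((K + P)\<^sup>2) ^ (d - 1) \<le> (2 * real k / N) ^ (d - 1)"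
  proof (cases "d = 1")
    case False
    have "0 \<le> (K - P)\<^sup>2" by simp
    then have "(K + P)\<^sup>2 \<le> 2 * (K\<^sup>2 + P\<^sup>2)" by (simp add: power2_sum power2_diff)
    also have "K\<^sup>2 + P\<^sup>2 = q / N" using N q(2) by (simp add: K_def P_def add_divide_distrib[symmetric])
    also have "q \<le> real k"
    proof -
      have "2 \<le> real d" using False d by simp
      from mult_left_mono[OF this, of "real k"] show ?thesis using d by (simp add: q(1) divide_le_eq mult.commute)
    qed
    finally have "(K + P)\<^sup>2 \<le> 2 * real k / N" using N by (simp add: divide_right_mono)
    then show ?thesis by (intro power_mono) auto
  qed simp
  let ?X = "K * (K + P) ^ (d - 1)"
  have "?X\<^sup>2 = K\<^sup>2 * ((K + P)\<^sup>2) ^ (d - 1)"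
    by (simp add: power_mult_distrib flip: power_mult) (simp add: mult.commute)
  also have "\<dots> \<le> (2 * real k / N) * (2 * real k / N) ^ (d - 1)"
    using K2 KP2 N by (intro mult_mono) auto
  also have "\<dots> = (2 * real k / N) ^ d" using d by (simp flip: power_Suc)
  finally have X2: "?X\<^sup>2 \<le> (2 * real k / N) ^ d" .
  have "?X powr q = (?X powr 2) powr (real k / real d)" by (simp add: powr_powr q(1))
  also have "?X powr 2 = ?X\<^sup>2" using KP by simp
  also have "(?X\<^sup>2) powr (real k / real d) \<le> ((2 * real k / N) ^ d) powr (real k / real d)"
    using X2 by (intro powr_mono2) auto
  also have "\<dots> = (2 * real k / N) ^ k"
    using N k d by (intro power_powr_divide) auto
  finally show ?thesis .
qed

text \<open>A concave power lies below its tangent at \<open>b\<close>; integrated, this becomes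
  Jensen's inequality.\<close>

lemma powr_le_tangent:
  fixes y b \<alpha> :: real
  assumes "y \<ge> 0" "b > 0" and \<alpha>: "0 < \<alpha>" "\<alpha> < 1"
  shows "y powr \<alpha> \<le> b powr \<alpha> * (\<alpha> * (y / b) + (1 - \<alpha>))"
proof (cases "y = 0")
  case False
  have "(y / b) powr \<alpha> * 1 powr (1 - \<alpha>) \<le> \<alpha> * (y / b) + (1 - \<alpha>) * 1"
    using assms False by (intro Youngs_inequality_0) auto
  then have "b powr \<alpha> * (y / b) powr \<alpha> \<le> b powr \<alpha> * (\<alpha> * (y / b) + (1 - \<alpha>))"
    by (intro mult_left_mono) auto
  then show ?thesis using assms False by (simp flip: powr_mult)
qed (use assms in simp)

text \<open>For k \<ge> d the exponent is at least 2 and the iterated inequality applies. For k < d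
  concavity reduces the claim to the second moment, which the Poincare chain bounds by (n - 2)^(-d);
  the power k / d of that is (n - 2)^(-k).\<close>

lemma sphere_power_moment:
  fixes f :: "real ^ 'n \<Rightarrow> real"
  assumes n: "CARD('n) \<ge> 3" and d: "d \<ge> 1" and f: "C_smooth_on d (UNIV - {0}) f" and hom: "homogeneous p f"
    and orth: "\<And>q. q \<in> poly_fun_le (d - 1) \<Longrightarrow> (\<integral>x. f x * q x \<partial>sphere_measure) = 0"
    and HS: "deriv_HS_L2 d f \<le> 1" and Op: "deriv_Op_Linf d f \<le> 1" and k: "k \<ge> 1"
  shows "(\<integral>x. \<bar>f x\<bar> powr (2 * real k / real d) \<partial>sphere_measure) \<le> (2 * real k / (real CARD('n) - 2)) ^ k"
proof (cases "k \<ge> d")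
  case True
  then have "2 * real k / real d \<ge> 2" using d by (simp add: field_simps)
  from sphere_moment_iterated[OF n d f hom orth HS Op this]
    iteration_constant_le[OF _ d refl this, of "real CARD('n) - 2"] n show ?thesis by linarith
next
  case False
  let ?N = "real CARD('n) - 2"
  define \<alpha> where "\<alpha> = real k / real d"
  have \<alpha>: "0 < \<alpha>" "\<alpha> < 1" using False k d by (auto simp: \<alpha>_def)
  define b where "b = (1 / ?N) ^ d"
  have b: "b > 0" using n by (simp add: b_def)
  have c: "continuous_on (- {0}) f" using continuous_on_iter_partial_deriv[OF f, of "[]"] by simp
  have f2: "(\<integral>x. (f x)\<^sup>2 \<partial>sphere_measure) \<le> b"
  proof -
    have "(\<integral>x. (deriv_HS 0 f x)\<^sup>2 \<partial>sphere_measure) \<le> (1 / ?N) ^ (d - 0)"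
    proof (rule sphere_HS_chain[OF f hom orth _ HS])
      show "(\<integral>x. (g x)\<^sup>2 \<partial>sphere_measure) \<le> 1 / ?N * (\<integral>x. (norm (g' x))\<^sup>2 \<partial>sphere_measure)"
        if "C1_punctured g g'" "(\<integral>x. g x \<partial>sphere_measure) = 0" for g :: "real ^ 'n \<Rightarrow> real" and g'
        using sphere_poincare[OF n that] by simp
    qed (use n in auto)
    then show ?thesis by (simp add: deriv_HS_0 b_def)
  qed
  have int2: "integrable sphere_measure (\<lambda>x. (f x)\<^sup>2)" by (intro integrable_sphere_punctured continuous_intros c)
  let ?Z = "\<lambda>x. b powr \<alpha> * (\<alpha> * ((f x)\<^sup>2 / b) + (1 - \<alpha>))"
  have "(\<integral>x. \<bar>f x\<bar> powr (2 * real k / real d) \<partial>sphere_measure) \<le> (\<integral>x. ?Z x \<partial>sphere_measure)"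
  proof (rule integral_mono')
    show "integrable sphere_measure ?Z" using int2 by simp
    fix x
    have "\<bar>f x\<bar> powr (2 * real k / real d) = (\<bar>f x\<bar> powr 2) powr \<alpha>"
      by (simp only: powr_powr \<alpha>_def times_divide_eq_right)
    also have "\<bar>f x\<bar> powr 2 = (f x)\<^sup>2" by simp
    also have "(f x)\<^sup>2 powr \<alpha> \<le> ?Z x" using b \<alpha> by (intro powr_le_tangent) auto
    finally show "\<bar>f x\<bar> powr (2 * real k / real d) \<le> ?Z x" .
    then show "0 \<le> ?Z x" by (rule order_trans[rotated]) simp
  qed
  also have "\<dots> = b powr \<alpha> * (\<alpha> * ((\<integral>x. (f x)\<^sup>2 \<partial>sphere_measure) / b) + (1 - \<alpha>))"
    using int2 by simp
  also have "\<dots> \<le> b powr \<alpha> * (\<alpha> * 1 + (1 - \<alpha>))"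
    using f2 b \<alpha> by (intro mult_left_mono add_right_mono) auto
  also have "\<dots> = (1 / ?N) ^ k"
    using power_powr_divide[of "1 / ?N" d k] n d by (simp add: b_def \<alpha>_def)
  also have "\<dots> \<le> (2 * real k / ?N) ^ k"
    using n k by (intro power_mono divide_right_mono) auto
  finally show ?thesis .
qed

lemma exp_moment_le_two:
  fixes f :: "real ^ 'n \<Rightarrow> real"
  assumes n: "CARD('n) \<ge> 3" and d: "d \<ge> 1" and [measurable]: "f \<in> borel_measurable borel"
    and int: "\<And>k. k \<ge> 1 \<Longrightarrow> integrable sphere_measure (\<lambda>x. \<bar>f x\<bar> powr (2 * real k / real d))"
    and moment: "\<And>k. k \<ge> 1 \<Longrightarrow> (\<integral>x. \<bar>f x\<bar> powr (2 * real k / real d) \<partial>sphere_measure) \<le>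
      (2 * real k / (real CARD('n) - 2)) ^ k"
  shows "(\<integral>\<^sup>+x. ennreal (exp (1 / (8 * exp 1) * (real CARD('n) - 1) * \<bar>f x\<bar> powr (2 / real d))) \<partial>sphere_measure) \<le> 2"
proof -
  define C where "C = 1 / (8 * exp 1) * (real CARD('n) - 1)"
  let ?N = "real CARD('n) - 2"
  have C: "C \<ge> 0" using n by (simp add: C_def)
  define z where "z x = C * \<bar>f x\<bar> powr (2 / real d)" for x
  have z0: "z x \<ge> 0" for x using C by (simp add: z_def)
  have [measurable]: "f \<in> borel_measurable sphere_measure" by (rule borel_measurable_sphere_measure) fact
  have [measurable]: "z \<in> borel_measurable sphere_measure" unfolding z_def[abs_def] by measurable
  have "(\<lambda>k. z x ^ k / fact k) sums exp (z x)" for x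
    using exp_converges[of "z x"] by (simp add: divide_inverse mult.commute)
  then have exp_z: "ennreal (exp (z x)) = (\<Sum>k. ennreal (z x ^ k / fact k))" for x
    using z0 by (subst suminf_ennreal2) (auto simp: sums_iff)
  have term_le: "(\<integral>\<^sup>+x. ennreal (z x ^ k / fact k) \<partial>sphere_measure) \<le> ennreal ((1 / 2) ^ k)" for k
  \<comment> \<open>The zeroth term is the constant 1. It is kept apart because
    \<open>0 powr 0 = 0\<close>, so the real power would misstate it at the zeros of
    \<open>f\<close>.\<close>
  proof (cases "k = 0")
    case True
    then show ?thesis using sphere.emeasure_space_1[where 'n = 'n] by simp
  next
    case False
    then have k: "k \<ge> 1" by simp
    have "z x ^ k / fact k = C ^ k / fact k * \<bar>f x\<bar> powr (2 * real k / real d)" for x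
    proof -
      have "(\<bar>f x\<bar> powr (2 / real d)) ^ k = \<bar>f x\<bar> powr (2 * real k / real d)"
        using k d by (cases "f x = 0") (simp_all add: powr_powr powr_realpow[symmetric] mult_ac)
      then show ?thesis by (simp add: z_def power_mult_distrib)
    qed
    then have "(\<integral>\<^sup>+x. ennreal (z x ^ k / fact k) \<partial>sphere_measure) =
        ennreal (\<integral>x. C ^ k / fact k * \<bar>f x\<bar> powr (2 * real k / real d) \<partial>sphere_measure)"
      using C int[OF k] by (simp only:) (intro nn_integral_eq_integral, auto)
    also have "\<dots> \<le> ennreal ((1 / 2) ^ k)"
    proof (rule ennreal_leI)
      have "(\<integral>x. C ^ k / fact k * \<bar>f x\<bar> powr (2 * real k / real d) \<partial>sphere_measure) \<le>
          C ^ k / fact k * (2 * real k / ?N) ^ k"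
        using C moment[OF k] by (simp add: divide_right_mono mult_left_mono)
      also have "\<dots> = (C / ?N * (2 * real k)) ^ k / fact k" by (simp add: power_mult_distrib power_divide)
      also have "\<dots> \<le> (1 / (4 * exp 1) * (2 * real k)) ^ k / fact k"
      proof (intro divide_right_mono power_mono mult_right_mono)
        \<comment> \<open>Equality at n = 3: this is where the passage from n - 1 to n - 2 costs its
          factor 2.\<close>
        have "real CARD('n) - 1 \<le> 2 * ?N" using n by simp
        then have "C \<le> 1 / (8 * exp 1) * (2 * ?N)" unfolding C_def by (intro mult_left_mono) auto
        then show "C / ?N \<le> 1 / (4 * exp 1)" using n by (simp add: field_simps)
        show "0 \<le> C / ?N * (2 * real k)" using C n by simp
      qed auto
      also have "\<dots> = (1 / 2) ^ k * (real k ^ k / (exp (real k) * fact k))"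
      proof -
        have "1 / (4 * exp 1) * (2 * real k) = 1 / 2 * (real k / exp 1)" by simp
        moreover have "exp (1 :: real) ^ k = exp (real k)" using exp_of_nat_mult[of k "1 :: real"] by simp
        ultimately show ?thesis by (simp only: power_mult_distrib power_divide) simp
      qed
      also have "\<dots> \<le> (1 / 2) ^ k * 1"
        using self_power_le_exp_fact[of k] by (intro mult_left_mono) (auto simp: divide_le_eq)
      finally show "(\<integral>x. C ^ k / fact k * \<bar>f x\<bar> powr (2 * real k / real d) \<partial>sphere_measure) \<le> (1 / 2) ^ k" by simp
    qed
    finally show ?thesis .
  qed
  have "(\<integral>\<^sup>+x. ennreal (exp (z x)) \<partial>sphere_measure) = (\<Sum>k. \<integral>\<^sup>+x. ennreal (z x ^ k / fact k) \<partial>sphere_measure)"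
    unfolding exp_z by (rule nn_integral_suminf) measurable
  also have "\<dots> \<le> (\<Sum>k. ennreal ((1 / 2) ^ k))" by (intro suminf_le term_le) auto
  also have "\<dots> = ennreal (\<Sum>k. (1 / 2) ^ k)" by (rule suminf_ennreal2) (auto intro: summable_geometric)
  also have "\<dots> = 2" by (subst suminf_geometric) auto
  finally show ?thesis by (simp add: z_def C_def)
qed

theorem theorem1p14:
  fixes f :: "real ^ 'n \<Rightarrow> real" and d :: nat and p :: real
  assumes "CARD('n) \<ge> 2" and "d \<ge> 1"
    and "C_smooth_on d (UNIV - {0}) f"
    and "homogeneous p f"
    and "p > real d - 3 \<or> (p \<le> real d - 3 \<and> real CARD('n) > real d - p - 1)"
    and "\<And>q. q \<in> poly_fun_le (d - 1) \<Longrightarrow> (\<integral>x. f x * q x \<partial>sphere_measure) = 0"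
    and "deriv_HS_L2 d f \<le> 1"
    and "deriv_Op_Linf d f \<le> 1"
  shows "(\<integral>\<^sup>+x. ennreal (exp (1 / (8 * exp 1) * (real CARD('n) - 1) * \<bar>f x\<bar> powr (2 / real d)))
            \<partial>sphere_measure) \<le> 2"
proof (cases "CARD('n) = 2")
  case True
  \<comment> \<open>For n = 2 the integrand itself is at most 2, since n - 1 = 1 and |f|^(2/d) \<le>
    pi^2 on the circle.\<close>
  have "(\<integral>\<^sup>+x. ennreal (exp (1 / (8 * exp 1) * (real CARD('n) - 1) * \<bar>f x\<bar> powr (2 / real d))) \<partial>sphere_measure)
      \<le> (\<integral>\<^sup>+x. 2 \<partial>(sphere_measure :: (real ^ 'n) measure))"
  proof (rule nn_integral_mono)
    fix x :: "real ^ 'n" assume "x \<in> space sphere_measure"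
    then have "\<bar>f x\<bar> \<le> pi ^ d" by (intro circle_pointwise_bound[OF True assms(2-4,6,7)]) auto
    then have "\<bar>f x\<bar> powr (2 / real d) \<le> (pi ^ d) powr (2 / real d)" by (intro powr_mono2) auto
    also have "\<dots> = pi\<^sup>2" using power_powr_divide[of pi d 2] \<open>d \<ge> 1\<close> by simp
    finally have "exp (1 / (8 * exp 1) * (real CARD('n) - 1) * \<bar>f x\<bar> powr (2 / real d)) \<le> exp (1 / (8 * exp 1) * pi\<^sup>2)"
      by (simp add: True divide_right_mono)
    also have "\<dots> \<le> 2" by (rule exp_pi_squared_le)
    finally have "ennreal (exp (1 / (8 * exp 1) * (real CARD('n) - 1) * \<bar>f x\<bar> powr (2 / real d))) \<le> ennreal 2"
      by (rule ennreal_leI)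
    then show "ennreal (exp (1 / (8 * exp 1) * (real CARD('n) - 1) * \<bar>f x\<bar> powr (2 / real d))) \<le> 2"
      unfolding ennreal_numeral .
  qed
  also have "\<dots> = 2" using sphere.emeasure_space_1[where 'n = 'n] by simp
  finally show ?thesis .
next
  case False
  then have n: "CARD('n) \<ge> 3" using assms(1) by simp
  have c: "continuous_on (- {0}) f" using continuous_on_iter_partial_deriv[OF assms(3), of "[]"] by simp
  show ?thesis
  proof (rule exp_moment_le_two[OF n \<open>d \<ge> 1\<close>])
    show "f \<in> borel_measurable borel" by (rule borel_measurable_punctured[OF c])
    show "integrable sphere_measure (\<lambda>x. \<bar>f x\<bar> powr (2 * real k / real d))" if "k \<ge> 1" for k
      using that assms(2) by (intro integrable_sphere_punctured continuous_on_nonneg_powr continuous_intros c) auto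
    show "(\<integral>x. \<bar>f x\<bar> powr (2 * real k / real d) \<partial>sphere_measure) \<le> (2 * real k / (real CARD('n) - 2)) ^ k"
      if "k \<ge> 1" for k
      by (rule sphere_power_moment[OF n assms(2-4,6-8) that])
  qed
qed

end
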